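(* Let $(\mathfrak A,\alpha)$ and $(\mathfrak B,\beta)$ be $\mathbb Z_2$-graded $C^*$-algebras, and let $\theta_o$ be the grading $*$-automorphism of the algebraic Fermi tensor product $\mathfrak A\odot_F\mathfrak B$ given by $\theta_o(a\odot b)=\alpha(a)\odot\beta(b)$. Then the involutive grading $*$-automorphism $\theta_o$ uniquely extends to an involutive $*$-automorphism $\theta$ (i.e. $\theta^2=\mathrm{id}$) of the whole Fermi $C^*$-tensor product $\mathfrak A\otimes_F\mathfrak B$, and thus makes $(\mathfrak A\otimes_F\mathfrak B,\theta)$ a $\mathbb Z_2$-graded $C^*$-algebra.
   Context: A $\mathbb Z_2$-graded $C^*$-algebra is a pair $(\mathfrak A,\alpha)$ with $\mathfrak A$ a $C^*$-algebra and $\alpha$ a $*$-automorphism with $\alpha^2=\mathrm{id}$. Put $\mathfrak A_\pm=\{a:\alpha(a)=\pm a\}$ (even/odd elements; the elements of $\mathfrak A_+\cup\mathfrak A_-$ are homogeneous). A state $\varphi$ is even if $\varphi\circ\alpha=\varphi$; $\mathcal S_+(\mathfrak A)$ is the set of even states. The algebraic Fermi tensor product $\mathfrak A\odot_F\mathfrak B$ is the algebraic tensor product $\mathfrak A\odot\mathfrak B$ made an involutive algebra by the product and involution determined on homogeneous elements by $(a\odot b)(a'\odot b')=\epsilon(b,a')\,aa'\odot bb'$ and $(a\odot b)^*=\epsilon(a,b)\,a^*\odot b^*$, where $\epsilon(x,y)=-1$ if $x,y$ are both odd and $1$ otherwise. For $\varphi\in\mathcal S_+(\mathfrak A)$ and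 $\psi\in\mathcal S_+(\mathfrak B)$, the product functional $(\varphi\times\psi)(a\odot b)=\varphi(a)\psi(b)$ is positive on $\mathfrak A\odot_F\mathfrak B$, and its GNS representation $\pi_{\varphi\times\psi}$ is by bounded operators. The minimal norm is $\|x\|=\sup\{\|\pi_{\varphi\times\psi}(x)\|:\varphi\in\mathcal S_+(\mathfrak A),\psi\in\mathcal S_+(\mathfrak B)\}$; this is a $C^*$-norm on $\mathfrak A\odot_F\mathfrak B$, and the Fermi $C^*$-tensor product $\mathfrak A\otimes_F\mathfrak B$ is the completion of $\mathfrak A\odot_F\mathfrak B$ in this norm. *)

theory Defs
  imports "HOL-Analysis.Analysis" "HOL-Library.Poly_Mapping"
begin

section \<open>Involutive algebras and $C^*$-algebras over an explicit carrier\<close>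

text \<open>
  Algebras are complex, associative and not necessarily unital. The carrier is explicit because
  the Fermi tensor product depends on the gradings, which are term variables.
\<close>

record 'a star_algebra =
  carrier :: "'a set"
  azero :: 'a  (\<open>\<zero>\<index>\<close>)
  aadd :: "'a \<Rightarrow> 'a \<Rightarrow> 'a"  (infixl \<open>\<oplus>\<index>\<close> 65)
  ascale :: "complex \<Rightarrow> 'a \<Rightarrow> 'a"  (infixr \<open>\<odot>\<index>\<close> 75)
  amult :: "'a \<Rightarrow> 'a \<Rightarrow> 'a"  (infixl \<open>\<otimes>\<index>\<close> 70)
  astar :: "'a \<Rightarrow> 'a"

record 'a normed_star_algebra = "'a star_algebra" +
  anorm :: "'a \<Rightarrow> real"

definition adiff :: "('a, 'm) star_algebra_scheme \<Rightarrow> 'a \<Rightarrow> 'a \<Rightarrow> 'a"  (infixl \<open>\<ominus>\<index>\<close> 65)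
  where "x \<ominus>\<^bsub>A\<^esub> y = x \<oplus>\<^bsub>A\<^esub> (-1) \<odot>\<^bsub>A\<^esub> y"

locale star_algebra =
  fixes A (structure)
  assumes zero_closed: "\<zero> \<in> carrier A"
    and add_closed: "\<lbrakk>x \<in> carrier A; y \<in> carrier A\<rbrakk> \<Longrightarrow> x \<oplus> y \<in> carrier A"
    and scale_closed: "x \<in> carrier A \<Longrightarrow> c \<odot> x \<in> carrier A"
    and mult_closed: "\<lbrakk>x \<in> carrier A; y \<in> carrier A\<rbrakk> \<Longrightarrow> x \<otimes> y \<in> carrier A"
    and star_closed: "x \<in> carrier A \<Longrightarrow> astar A x \<in> carrier A"
    and add_assoc: "\<lbrakk>x \<in> carrier A; y \<in> carrier A; z \<in> carrier A\<rbrakk> \<Longrightarrow> (x \<oplus> y) \<oplus> z = x \<oplus> (y \<oplus> z)"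
    and add_comm: "\<lbrakk>x \<in> carrier A; y \<in> carrier A\<rbrakk> \<Longrightarrow> x \<oplus> y = y \<oplus> x"
    and add_zero: "x \<in> carrier A \<Longrightarrow> x \<oplus> \<zero> = x"
    and diff_self: "x \<in> carrier A \<Longrightarrow> x \<ominus> x = \<zero>"
    and scale_add_right: "\<lbrakk>x \<in> carrier A; y \<in> carrier A\<rbrakk> \<Longrightarrow> c \<odot> (x \<oplus> y) = c \<odot> x \<oplus> c \<odot> y"
    and scale_add_left: "x \<in> carrier A \<Longrightarrow> (c + d) \<odot> x = c \<odot> x \<oplus> d \<odot> x"
    and scale_scale: "x \<in> carrier A \<Longrightarrow> c \<odot> d \<odot> x = (c * d) \<odot> x"
    and scale_one: "x \<in> carrier A \<Longrightarrow> 1 \<odot> x = x"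
    and mult_assoc: "\<lbrakk>x \<in> carrier A; y \<in> carrier A; z \<in> carrier A\<rbrakk> \<Longrightarrow> (x \<otimes> y) \<otimes> z = x \<otimes> (y \<otimes> z)"
    and mult_add_left: "\<lbrakk>x \<in> carrier A; y \<in> carrier A; z \<in> carrier A\<rbrakk> \<Longrightarrow> (x \<oplus> y) \<otimes> z = x \<otimes> z \<oplus> y \<otimes> z"
    and mult_add_right: "\<lbrakk>x \<in> carrier A; y \<in> carrier A; z \<in> carrier A\<rbrakk> \<Longrightarrow> x \<otimes> (y \<oplus> z) = x \<otimes> y \<oplus> x \<otimes> z"
    and mult_scale_left: "\<lbrakk>x \<in> carrier A; y \<in> carrier A\<rbrakk> \<Longrightarrow> (c \<odot> x) \<otimes> y = c \<odot> (x \<otimes> y)"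
    and mult_scale_right: "\<lbrakk>x \<in> carrier A; y \<in> carrier A\<rbrakk> \<Longrightarrow> x \<otimes> (c \<odot> y) = c \<odot> (x \<otimes> y)"
    and star_star: "x \<in> carrier A \<Longrightarrow> astar A (astar A x) = x"
    and star_add: "\<lbrakk>x \<in> carrier A; y \<in> carrier A\<rbrakk> \<Longrightarrow> astar A (x \<oplus> y) = astar A x \<oplus> astar A y"
    and star_scale: "x \<in> carrier A \<Longrightarrow> astar A (c \<odot> x) = cnj c \<odot> astar A x"
    and star_mult: "\<lbrakk>x \<in> carrier A; y \<in> carrier A\<rbrakk> \<Longrightarrow> astar A (x \<otimes> y) = astar A y \<otimes> astar A x"

definition seminorm_Cauchy :: "('a, 'm) star_algebra_scheme \<Rightarrow> ('a \<Rightarrow> real) \<Rightarrow> (nat \<Rightarrow> 'a) \<Rightarrow> bool" where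
  "seminorm_Cauchy A p X \<longleftrightarrow> (\<forall>n. X n \<in> carrier A) \<and>
     (\<forall>e>0. \<exists>N. \<forall>m\<ge>N. \<forall>n\<ge>N. p (X m \<ominus>\<^bsub>A\<^esub> X n) < e)"

locale cstar_algebra = star_algebra +
  assumes norm_eq_zero: "x \<in> carrier A \<Longrightarrow> anorm A x = 0 \<longleftrightarrow> x = \<zero>"
    and norm_nonneg: "x \<in> carrier A \<Longrightarrow> 0 \<le> anorm A x"
    and norm_triangle: "\<lbrakk>x \<in> carrier A; y \<in> carrier A\<rbrakk> \<Longrightarrow> anorm A (x \<oplus> y) \<le> anorm A x + anorm A y"
    and norm_scale: "x \<in> carrier A \<Longrightarrow> anorm A (c \<odot> x) = cmod c * anorm A x"
    and norm_mult: "\<lbrakk>x \<in> carrier A; y \<in> carrier A\<rbrakk> \<Longrightarrow> anorm A (x \<otimes> y) \<le> anorm A x * anorm A y"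
    and cstar_identity: "x \<in> carrier A \<Longrightarrow> anorm A (astar A x \<otimes> x) = (anorm A x)\<^sup>2"
    and complete: "seminorm_Cauchy A (anorm A) X \<Longrightarrow>
      \<exists>L\<in>carrier A. (\<lambda>n. anorm A (X n \<ominus> L)) \<longlonglongrightarrow> 0"

definition star_automorphism :: "('a, 'm) star_algebra_scheme \<Rightarrow> ('a \<Rightarrow> 'a) \<Rightarrow> bool" where
  "star_automorphism A \<theta> \<longleftrightarrow> bij_betw \<theta> (carrier A) (carrier A) \<and>
     (\<forall>x\<in>carrier A. \<forall>y\<in>carrier A. \<theta> (x \<oplus>\<^bsub>A\<^esub> y) = \<theta> x \<oplus>\<^bsub>A\<^esub> \<theta> y) \<and>
     (\<forall>c. \<forall>x\<in>carrier A. \<theta> (c \<odot>\<^bsub>A\<^esub> x) = c \<odot>\<^bsub>A\<^esub> \<theta> x) \<and>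
     (\<forall>x\<in>carrier A. \<forall>y\<in>carrier A. \<theta> (x \<otimes>\<^bsub>A\<^esub> y) = \<theta> x \<otimes>\<^bsub>A\<^esub> \<theta> y) \<and>
     (\<forall>x\<in>carrier A. \<theta> (astar A x) = astar A (\<theta> x))"

locale graded_cstar_algebra = cstar_algebra +
  fixes \<alpha>
  assumes grading_automorphism: "star_automorphism A \<alpha>"
    and grading_involutive: "x \<in> carrier A \<Longrightarrow> \<alpha> (\<alpha> x) = x"

text \<open>The flag \<open>s\<close> is the parity: \<open>True\<close> for odd and \<open>False\<close> for even.\<close>

definition parity_sign :: "bool \<Rightarrow> complex" where
  "parity_sign s = (if s then -1 else 1)"

definition homogeneous :: "('a, 'm) star_algebra_scheme \<Rightarrow> ('a \<Rightarrow> 'a) \<Rightarrow> bool \<Rightarrow> 'a \<Rightarrow> bool" where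
  "homogeneous A \<alpha> s a \<longleftrightarrow> a \<in> carrier A \<and> \<alpha> a = parity_sign s \<odot>\<^bsub>A\<^esub> a"

definition hpart :: "('a, 'm) star_algebra_scheme \<Rightarrow> ('a \<Rightarrow> 'a) \<Rightarrow> bool \<Rightarrow> 'a \<Rightarrow> 'a" where
  "hpart A \<alpha> s a = (1/2) \<odot>\<^bsub>A\<^esub> (a \<oplus>\<^bsub>A\<^esub> parity_sign s \<odot>\<^bsub>A\<^esub> \<alpha> a)"

definition state :: "('a, 'm) normed_star_algebra_scheme \<Rightarrow> ('a \<Rightarrow> complex) \<Rightarrow> bool" where
  "state A \<phi> \<longleftrightarrow>
     (\<forall>x\<in>carrier A. \<forall>y\<in>carrier A. \<phi> (x \<oplus>\<^bsub>A\<^esub> y) = \<phi> x + \<phi> y) \<and>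
     (\<forall>c. \<forall>x\<in>carrier A. \<phi> (c \<odot>\<^bsub>A\<^esub> x) = c * \<phi> x) \<and>
     (\<forall>x\<in>carrier A. \<phi> (astar A x \<otimes>\<^bsub>A\<^esub> x) \<in> \<real>\<^sub>\<ge>\<^sub>0) \<and>
     bdd_above {cmod (\<phi> x) |x. x \<in> carrier A \<and> anorm A x \<le> 1} \<and>
     Sup {cmod (\<phi> x) |x. x \<in> carrier A \<and> anorm A x \<le> 1} = 1"

definition even_states :: "('a, 'm) normed_star_algebra_scheme \<Rightarrow> ('a \<Rightarrow> 'a) \<Rightarrow> ('a \<Rightarrow> complex) set" where
  "even_states A \<alpha> = {\<phi>. state A \<phi> \<and> (\<forall>x\<in>carrier A. \<phi> (\<alpha> x) = \<phi> x)}"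


section \<open>Operations on quotients\<close>

definition quot_lift :: "('a \<times> 'a) set \<Rightarrow> ('a \<Rightarrow> 'a) \<Rightarrow> 'a set \<Rightarrow> 'a set" where
  "quot_lift r f \<xi> = (\<Union>x\<in>\<xi>. r `` {f x})"

definition quot_lift2 :: "('a \<times> 'a) set \<Rightarrow> ('a \<Rightarrow> 'a \<Rightarrow> 'a) \<Rightarrow> 'a set \<Rightarrow> 'a set \<Rightarrow> 'a set" where
  "quot_lift2 r f \<xi> \<eta> = (\<Union>x\<in>\<xi>. \<Union>y\<in>\<eta>. r `` {f x y})"

definition quot_value :: "('a \<Rightarrow> 'c) \<Rightarrow> 'a set \<Rightarrow> 'c" where
  "quot_value f \<xi> = the_elem (f ` \<xi>)"


section \<open>The algebraic Fermi tensor product\<close>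

text \<open>
  The algebraic tensor product is the free complex vector space on
  \<open>carrier A \<times> carrier B\<close> modulo the span of the bilinearity relations.
\<close>

type_synonym ('a, 'b) free = "('a \<times> 'b) \<Rightarrow>\<^sub>0 complex"

definition fscale :: "complex \<Rightarrow> ('k \<Rightarrow>\<^sub>0 complex) \<Rightarrow> ('k \<Rightarrow>\<^sub>0 complex)" where
  "fscale c = Poly_Mapping.map ((*) c)"

definition pure :: "'a \<Rightarrow> 'b \<Rightarrow> ('a, 'b) free" where
  "pure a b = Poly_Mapping.single (a, b) 1"

definition free_carrier ::
    "('a, 'm) star_algebra_scheme \<Rightarrow> ('b, 'n) star_algebra_scheme \<Rightarrow> ('a, 'b) free set" where
  "free_carrier A B = {x. Poly_Mapping.keys x \<subseteq> carrier A \<times> carrier B}"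

definition bilinearity_relations ::
    "('a, 'm) star_algebra_scheme \<Rightarrow> ('b, 'n) star_algebra_scheme \<Rightarrow> ('a, 'b) free set" where
  "bilinearity_relations A B =
     {pure (a \<oplus>\<^bsub>A\<^esub> a') b - pure a b - pure a' b |a a' b.
        a \<in> carrier A \<and> a' \<in> carrier A \<and> b \<in> carrier B} \<union>
     {pure a (b \<oplus>\<^bsub>B\<^esub> b') - pure a b - pure a b' |a b b'.
        a \<in> carrier A \<and> b \<in> carrier B \<and> b' \<in> carrier B} \<union>
     {pure (c \<odot>\<^bsub>A\<^esub> a) b - fscale c (pure a b) |c a b. a \<in> carrier A \<and> b \<in> carrier B} \<union>
     {pure a (c \<odot>\<^bsub>B\<^esub> b) - fscale c (pure a b) |c a b. a \<in> carrier A \<and> b \<in> carrier B}"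

definition tensor_rel ::
    "('a, 'm) star_algebra_scheme \<Rightarrow> ('b, 'n) star_algebra_scheme \<Rightarrow> (('a, 'b) free \<times> ('a, 'b) free) set" where
  "tensor_rel A B = {(x, y). x \<in> free_carrier A B \<and> y \<in> free_carrier A B \<and>
     x - y \<in> module.span fscale (bilinearity_relations A B)}"

definition tensor ::
    "('a, 'm) star_algebra_scheme \<Rightarrow> ('b, 'n) star_algebra_scheme \<Rightarrow> 'a \<Rightarrow> 'b \<Rightarrow> ('a, 'b) free set" where
  "tensor A B a b = tensor_rel A B `` {pure a b}"

definition koszul :: "bool \<Rightarrow> bool \<Rightarrow> complex" where
  "koszul s t = (if s \<and> t then -1 else 1)"

text \<open>
  Product and involution are prescribed on homogeneous elements only; on arbitrary simple
  tensors they are obtained by splitting the factors into homogeneous parts, and on arbitrary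
  elements by (conjugate-)linear extension. See \<open>fermi_mult_homogeneous\<close> and
  \<open>fermi_star_homogeneous\<close> below.
\<close>

definition pure_mult where
  "pure_mult A \<alpha> B \<beta> p q =
     (\<Sum>s\<in>UNIV. \<Sum>t\<in>UNIV. fscale (koszul s t)
        (pure (fst p \<otimes>\<^bsub>A\<^esub> hpart A \<alpha> t (fst q)) (hpart B \<beta> s (snd p) \<otimes>\<^bsub>B\<^esub> snd q)))"

definition pure_star where
  "pure_star A \<alpha> B \<beta> p =
     (\<Sum>s\<in>UNIV. \<Sum>t\<in>UNIV. fscale (koszul s t)
        (pure (astar A (hpart A \<alpha> s (fst p))) (astar B (hpart B \<beta> t (snd p)))))"

definition free_mult where
  "free_mult A \<alpha> B \<beta> x y = (\<Sum>p\<in>Poly_Mapping.keys x. \<Sum>q\<in>Poly_Mapping.keys y.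
     fscale (Poly_Mapping.lookup x p * Poly_Mapping.lookup y q) (pure_mult A \<alpha> B \<beta> p q))"

definition free_star where
  "free_star A \<alpha> B \<beta> x = (\<Sum>p\<in>Poly_Mapping.keys x.
     fscale (cnj (Poly_Mapping.lookup x p)) (pure_star A \<alpha> B \<beta> p))"

definition free_grading where
  "free_grading \<alpha> \<beta> x = (\<Sum>p\<in>Poly_Mapping.keys x.
     fscale (Poly_Mapping.lookup x p) (pure (\<alpha> (fst p)) (\<beta> (snd p))))"

definition fermi_algebra ::
    "('a, 'm) star_algebra_scheme \<Rightarrow> ('a \<Rightarrow> 'a) \<Rightarrow> ('b, 'n) star_algebra_scheme \<Rightarrow> ('b \<Rightarrow> 'b) \<Rightarrow>
      ('a, 'b) free set star_algebra" where
  "fermi_algebra A \<alpha> B \<beta> =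
     \<lparr>carrier = free_carrier A B // tensor_rel A B,
      azero = tensor_rel A B `` {0},
      aadd = quot_lift2 (tensor_rel A B) (+),
      ascale = (\<lambda>c. quot_lift (tensor_rel A B) (fscale c)),
      amult = quot_lift2 (tensor_rel A B) (free_mult A \<alpha> B \<beta>),
      astar = quot_lift (tensor_rel A B) (free_star A \<alpha> B \<beta>)\<rparr>"

definition fermi_grading ::
    "('a, 'm) star_algebra_scheme \<Rightarrow> ('a \<Rightarrow> 'a) \<Rightarrow> ('b, 'n) star_algebra_scheme \<Rightarrow> ('b \<Rightarrow> 'b) \<Rightarrow>
      ('a, 'b) free set \<Rightarrow> ('a, 'b) free set" where
  "fermi_grading A \<alpha> B \<beta> = quot_lift (tensor_rel A B) (free_grading \<alpha> \<beta>)"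

definition product_functional ::
    "('a \<Rightarrow> complex) \<Rightarrow> ('b \<Rightarrow> complex) \<Rightarrow> ('a, 'b) free set \<Rightarrow> complex" where
  "product_functional \<phi> \<psi> = quot_value (\<lambda>x. \<Sum>p\<in>Poly_Mapping.keys x.
     Poly_Mapping.lookup x p * (\<phi> (fst p) * \<psi> (snd p)))"


section \<open>Completion with respect to a seminorm\<close>

text \<open>
  Cauchy sequences modulo null sequences. For a seminorm this is the completion of the quotient
  by the null space, as needed for the GNS space; for a norm it is the usual completion.
\<close>

definition completion_rel ::
    "('a, 'm) star_algebra_scheme \<Rightarrow> ('a \<Rightarrow> real) \<Rightarrow> ((nat \<Rightarrow> 'a) \<times> (nat \<Rightarrow> 'a)) set" where
  "completion_rel A p = {(X, Y). seminorm_Cauchy A p X \<and> seminorm_Cauchy A p Y \<and>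
     (\<lambda>n. p (X n \<ominus>\<^bsub>A\<^esub> Y n)) \<longlonglongrightarrow> 0}"

definition completion_carrier ::
    "('a, 'm) star_algebra_scheme \<Rightarrow> ('a \<Rightarrow> real) \<Rightarrow> (nat \<Rightarrow> 'a) set set" where
  "completion_carrier A p = Collect (seminorm_Cauchy A p) // completion_rel A p"

definition completion_embed ::
    "('a, 'm) star_algebra_scheme \<Rightarrow> ('a \<Rightarrow> real) \<Rightarrow> 'a \<Rightarrow> (nat \<Rightarrow> 'a) set" where
  "completion_embed A p x = completion_rel A p `` {\<lambda>_. x}"

definition completion_norm :: "('a \<Rightarrow> real) \<Rightarrow> (nat \<Rightarrow> 'a) set \<Rightarrow> real" where
  "completion_norm p = quot_value (\<lambda>X. lim (\<lambda>n. p (X n)))"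

definition completion ::
    "('a, 'm) star_algebra_scheme \<Rightarrow> ('a \<Rightarrow> real) \<Rightarrow> (nat \<Rightarrow> 'a) set normed_star_algebra" where
  "completion A p =
     \<lparr>carrier = completion_carrier A p,
      azero = completion_embed A p \<zero>\<^bsub>A\<^esub>,
      aadd = quot_lift2 (completion_rel A p) (\<lambda>X Y n. X n \<oplus>\<^bsub>A\<^esub> Y n),
      ascale = (\<lambda>c. quot_lift (completion_rel A p) (\<lambda>X n. c \<odot>\<^bsub>A\<^esub> X n)),
      amult = quot_lift2 (completion_rel A p) (\<lambda>X Y n. X n \<otimes>\<^bsub>A\<^esub> Y n),
      astar = quot_lift (completion_rel A p) (\<lambda>X n. astar A (X n)),
      anorm = completion_norm p\<rparr>"


section \<open>GNS representation, minimal norm, Fermi $C^*$-tensor product\<close>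

text \<open>
  The GNS space of a positive functional \<open>\<omega>\<close> is the completion for the seminorm of the
  inner product \<open>\<langle>x, y\<rangle> = \<omega> (x\<^sup>* y)\<close>; algebra elements act by the extension of left multiplication.
\<close>

definition gns_seminorm :: "('a, 'm) star_algebra_scheme \<Rightarrow> ('a \<Rightarrow> complex) \<Rightarrow> 'a \<Rightarrow> real" where
  "gns_seminorm A \<omega> x = sqrt (Re (\<omega> (astar A x \<otimes>\<^bsub>A\<^esub> x)))"

definition gns_space :: "('a, 'm) star_algebra_scheme \<Rightarrow> ('a \<Rightarrow> complex) \<Rightarrow> (nat \<Rightarrow> 'a) set set" where
  "gns_space A \<omega> = completion_carrier A (gns_seminorm A \<omega>)"

definition gns_rep ::
    "('a, 'm) star_algebra_scheme \<Rightarrow> ('a \<Rightarrow> complex) \<Rightarrow> 'a \<Rightarrow> (nat \<Rightarrow> 'a) set \<Rightarrow> (nat \<Rightarrow> 'a) set" where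
  "gns_rep A \<omega> x = quot_lift (completion_rel A (gns_seminorm A \<omega>)) (\<lambda>Y n. x \<otimes>\<^bsub>A\<^esub> Y n)"

definition gns_opnorm :: "('a, 'm) star_algebra_scheme \<Rightarrow> ('a \<Rightarrow> complex) \<Rightarrow> 'a \<Rightarrow> real" where
  "gns_opnorm A \<omega> x = Sup {completion_norm (gns_seminorm A \<omega>) (gns_rep A \<omega> x \<xi>) |\<xi>.
     \<xi> \<in> gns_space A \<omega> \<and> completion_norm (gns_seminorm A \<omega>) \<xi> \<le> 1}"

text \<open>Inserting \<open>0\<close> only matters if \<open>A\<close> or \<open>B\<close> is zero: then there are no states.\<close>

definition fermi_norm ::
    "('a, 'm) normed_star_algebra_scheme \<Rightarrow> ('a \<Rightarrow> 'a) \<Rightarrow> ('b, 'n) normed_star_algebra_scheme \<Rightarrow> ('b \<Rightarrow> 'b) \<Rightarrow>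
      ('a, 'b) free set \<Rightarrow> real" where
  "fermi_norm A \<alpha> B \<beta> x = Sup (insert 0
     {gns_opnorm (fermi_algebra A \<alpha> B \<beta>) (product_functional \<phi> \<psi>) x |\<phi> \<psi>.
        \<phi> \<in> even_states A \<alpha> \<and> \<psi> \<in> even_states B \<beta>})"

definition fermi_cstar_tensor ::
    "('a, 'm) normed_star_algebra_scheme \<Rightarrow> ('a \<Rightarrow> 'a) \<Rightarrow> ('b, 'n) normed_star_algebra_scheme \<Rightarrow> ('b \<Rightarrow> 'b) \<Rightarrow>
      (nat \<Rightarrow> ('a, 'b) free set) set normed_star_algebra" where
  "fermi_cstar_tensor A \<alpha> B \<beta> = completion (fermi_algebra A \<alpha> B \<beta>) (fermi_norm A \<alpha> B \<beta>)"

definition fermi_embed ::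
    "('a, 'm) normed_star_algebra_scheme \<Rightarrow> ('a \<Rightarrow> 'a) \<Rightarrow> ('b, 'n) normed_star_algebra_scheme \<Rightarrow> ('b \<Rightarrow> 'b) \<Rightarrow>
      ('a, 'b) free set \<Rightarrow> (nat \<Rightarrow> ('a, 'b) free set) set" where
  "fermi_embed A \<alpha> B \<beta> = completion_embed (fermi_algebra A \<alpha> B \<beta>) (fermi_norm A \<alpha> B \<beta>)"


section \<open>The operations on simple tensors\<close>

lemma lookup_fscale [simp]: "Poly_Mapping.lookup (fscale c x) p = c * Poly_Mapping.lookup x p"
  by (simp add: fscale_def map.rep_eq when_def)

interpretation free: vector_space fscale
  by unfold_locales (auto intro!: poly_mapping_eqI simp: lookup_add algebra_simps)

definition free_ext :: "(complex \<Rightarrow> complex) \<Rightarrow> ('k \<Rightarrow> 'l \<Rightarrow>\<^sub>0 complex) \<Rightarrow> ('k \<Rightarrow>\<^sub>0 complex) \<Rightarrow> ('l \<Rightarrow>\<^sub>0 complex)" where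
  "free_ext h g x = (\<Sum>p\<in>Poly_Mapping.keys x. fscale (h (Poly_Mapping.lookup x p)) (g p))"

locale scalar_map =
  fixes h :: "complex \<Rightarrow> complex"
  assumes h_add: "h (c + d) = h c + h d" and h_mult: "h (c * d) = h c * h d" and h_one: "h 1 = 1"
begin

lemma h_zero: "h 0 = 0"
  using h_add[of 0 0] by simp

lemma free_ext_superset:
  assumes "finite S" "Poly_Mapping.keys x \<subseteq> S"
  shows "free_ext h g x = (\<Sum>p\<in>S. fscale (h (Poly_Mapping.lookup x p)) (g p))"
  unfolding free_ext_def using assms
  by (intro sum.mono_neutral_left) (auto simp: in_keys_iff h_zero)

lemma free_ext_add: "free_ext h g (x + y) = free_ext h g x + free_ext h g y"
proof -
  let ?S = "Poly_Mapping.keys x \<union> Poly_Mapping.keys y"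
  have "Poly_Mapping.keys (x + y) \<subseteq> ?S" by (rule keys_add)
  then show ?thesis
    by (simp add: free_ext_superset[of ?S] lookup_add h_add free.scale_left_distrib sum.distrib)
qed

lemma free_ext_scale: "free_ext h g (fscale c x) = fscale (h c) (free_ext h g x)"
proof -
  have "Poly_Mapping.keys (fscale c x) \<subseteq> Poly_Mapping.keys x" by (auto simp: in_keys_iff)
  then show ?thesis
    by (simp add: free_ext_superset[of "Poly_Mapping.keys x"] h_mult free.scale_sum_right)
qed

lemma free_ext_diff: "free_ext h g (x - y) = free_ext h g x - free_ext h g y"
  by (metis add_diff_cancel_right' diff_add_cancel free_ext_add)

lemma free_ext_pure: "free_ext h g (pure a b) = g (a, b)"
  by (simp add: free_ext_def pure_def h_one)

end

interpretation lin: scalar_map "\<lambda>c. c" by unfold_locales auto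
interpretation conjugate: scalar_map cnj by unfold_locales auto

abbreviation tspan where "tspan A B \<equiv> free.span (bilinearity_relations A B)"

definition tensor_cong where
  "tensor_cong A B g h \<longleftrightarrow>
     (\<forall>a\<in>carrier A. \<forall>a'\<in>carrier A. \<forall>b\<in>carrier B. g (a \<oplus>\<^bsub>A\<^esub> a', b) - g (a, b) - g (a', b) \<in> tspan A B) \<and>
     (\<forall>a\<in>carrier A. \<forall>b\<in>carrier B. \<forall>b'\<in>carrier B. g (a, b \<oplus>\<^bsub>B\<^esub> b') - g (a, b) - g (a, b') \<in> tspan A B) \<and>
     (\<forall>c. \<forall>a\<in>carrier A. \<forall>b\<in>carrier B. g (c \<odot>\<^bsub>A\<^esub> a, b) - fscale (h c) (g (a, b)) \<in> tspan A B) \<and>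
     (\<forall>c. \<forall>a\<in>carrier A. \<forall>b\<in>carrier B. g (a, c \<odot>\<^bsub>B\<^esub> b) - fscale (h c) (g (a, b)) \<in> tspan A B)"

lemma (in scalar_map) free_ext_span:
  assumes "tensor_cong A B g h" "x \<in> tspan A B"
  shows "free_ext h g x \<in> tspan A B"
  using assms(2)
proof (induction x rule: free.span_induct_alt)
  case base
  show ?case by (simp add: free_ext_def free.span_zero)
next
  case (step c x y)
  have "free_ext h g x \<in> tspan A B"
    using step(1) assms(1) unfolding bilinearity_relations_def tensor_cong_def
    by (auto simp: free_ext_diff free_ext_scale free_ext_pure)
  then show ?case
    using step(2) by (simp add: free_ext_add free_ext_scale free.span_add free.span_scale)
qed

lemma equiv_tensor_rel: "equiv (free_carrier A B) (tensor_rel A B)"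
proof (rule equivI)
  show "tensor_rel A B \<subseteq> free_carrier A B \<times> free_carrier A B" by (auto simp: tensor_rel_def)
  show "refl_on (free_carrier A B) (tensor_rel A B)"
    by (auto simp: refl_on_def tensor_rel_def free.span_zero)
  show "sym (tensor_rel A B)"
  proof (rule symI)
    fix x y assume "(x, y) \<in> tensor_rel A B"
    then show "(y, x) \<in> tensor_rel A B"
      using free.span_neg[of "x - y" "bilinearity_relations A B"] by (simp add: tensor_rel_def)
  qed
  show "trans (tensor_rel A B)"
  proof (rule transI)
    fix x y z assume "(x, y) \<in> tensor_rel A B" "(y, z) \<in> tensor_rel A B"
    then show "(x, z) \<in> tensor_rel A B"
      using free.span_add[of "x - y" "bilinearity_relations A B" "y - z"] by (simp add: tensor_rel_def)
  qed
qed

lemma pure_in_free: "\<lbrakk>a \<in> carrier A; b \<in> carrier B\<rbrakk> \<Longrightarrow> pure a b \<in> free_carrier A B"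
  by (simp add: free_carrier_def pure_def)

lemma free_carrier_add: "\<lbrakk>x \<in> free_carrier A B; y \<in> free_carrier A B\<rbrakk> \<Longrightarrow> x + y \<in> free_carrier A B"
  unfolding free_carrier_def using keys_add[of x y] by auto

lemma free_carrier_zero: "0 \<in> free_carrier A B"
  by (simp add: free_carrier_def)

lemma free_carrier_scale: "x \<in> free_carrier A B \<Longrightarrow> fscale c x \<in> free_carrier A B"
  by (auto simp: free_carrier_def in_keys_iff subset_iff)

lemma free_carrier_sum: "(\<And>i. i \<in> I \<Longrightarrow> f i \<in> free_carrier A B) \<Longrightarrow> (\<Sum>i\<in>I. f i) \<in> free_carrier A B"
  by (induction I rule: infinite_finite_induct) (auto simp: free_carrier_add free_carrier_zero)

lemma UN_constant_on: "\<lbrakk>x \<in> C; \<And>y. y \<in> C \<Longrightarrow> g y = D\<rbrakk> \<Longrightarrow> (\<Union>y\<in>C. g y) = D"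
  by auto

lemma quot_lift_class:
  assumes r: "equiv S r" and x: "x \<in> S" and f: "\<And>y. (x, y) \<in> r \<Longrightarrow> (f x, f y) \<in> r"
  shows "quot_lift r f (r `` {x}) = r `` {f x}"
  unfolding quot_lift_def
proof (rule UN_constant_on)
  show "x \<in> r `` {x}" using r x by (rule equiv_class_self)
  show "r `` {f y} = r `` {f x}" if "y \<in> r `` {x}" for y
    using equiv_class_eq[OF r f[of y]] that by blast
qed

lemma quot_lift2_class:
  assumes r: "equiv S r" and x: "x \<in> S" and y: "y \<in> S"
    and f: "\<And>x' y'. (x, x') \<in> r \<Longrightarrow> (y, y') \<in> r \<Longrightarrow> (f x y, f x' y') \<in> r"
  shows "quot_lift2 r f (r `` {x}) (r `` {y}) = r `` {f x y}"
  unfolding quot_lift2_def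
proof (rule UN_constant_on)
  show "x \<in> r `` {x}" using r x by (rule equiv_class_self)
  show "(\<Union>y'\<in>r `` {y}. r `` {f x' y'}) = r `` {f x y}" if "x' \<in> r `` {x}" for x'
  proof (rule UN_constant_on)
    show "y \<in> r `` {y}" using r y by (rule equiv_class_self)
    show "r `` {f x' y'} = r `` {f x y}" if "y' \<in> r `` {y}" for y'
      using equiv_class_eq[OF r f[of x' y']] that \<open>x' \<in> r `` {x}\<close> by blast
  qed
qed

definition scalar_hom ::
    "(complex \<Rightarrow> complex) \<Rightarrow> ('a, 'm) star_algebra_scheme \<Rightarrow> ('a \<Rightarrow> 'a) \<Rightarrow> bool" where
  "scalar_hom h A u \<longleftrightarrow> (\<forall>x\<in>carrier A. u x \<in> carrier A) \<and>
     (\<forall>x\<in>carrier A. \<forall>y\<in>carrier A. u (x \<oplus>\<^bsub>A\<^esub> y) = u x \<oplus>\<^bsub>A\<^esub> u y) \<and>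
     (\<forall>c. \<forall>x\<in>carrier A. u (c \<odot>\<^bsub>A\<^esub> x) = h c \<odot>\<^bsub>A\<^esub> u x)"

lemma scalar_hom_compose:
  "\<lbrakk>scalar_hom h A u; scalar_hom h' A v\<rbrakk> \<Longrightarrow> scalar_hom (\<lambda>c. h (h' c)) A (\<lambda>x. u (v x))"
  by (simp add: scalar_hom_def)

lemma tensor_cong_pure:
  assumes "scalar_hom h A u" "scalar_hom h B v"
  shows "tensor_cong A B (\<lambda>p. pure (u (fst p)) (v (snd p))) h"
proof -
  have u: "u a \<in> carrier A" "u (a \<oplus>\<^bsub>A\<^esub> a') = u a \<oplus>\<^bsub>A\<^esub> u a'" "u (c \<odot>\<^bsub>A\<^esub> a) = h c \<odot>\<^bsub>A\<^esub> u a"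
    if "a \<in> carrier A" "a' \<in> carrier A" for a a' c
    using assms(1) that by (simp_all add: scalar_hom_def)
  have v: "v b \<in> carrier B" "v (b \<oplus>\<^bsub>B\<^esub> b') = v b \<oplus>\<^bsub>B\<^esub> v b'" "v (c \<odot>\<^bsub>B\<^esub> b) = h c \<odot>\<^bsub>B\<^esub> v b"
    if "b \<in> carrier B" "b' \<in> carrier B" for b b' c
    using assms(2) that by (simp_all add: scalar_hom_def)
  have r1: "pure (a \<oplus>\<^bsub>A\<^esub> a') b - pure a b - pure a' b \<in> tspan A B"
    if "a \<in> carrier A" "a' \<in> carrier A" "b \<in> carrier B" for a a' b
    using that unfolding bilinearity_relations_def by (intro free.span_base) blast
  have r2: "pure a (b \<oplus>\<^bsub>B\<^esub> b') - pure a b - pure a b' \<in> tspan A B"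
    if "a \<in> carrier A" "b \<in> carrier B" "b' \<in> carrier B" for a b b'
    using that unfolding bilinearity_relations_def by (intro free.span_base) blast
  have r3: "pure (c \<odot>\<^bsub>A\<^esub> a) b - fscale c (pure a b) \<in> tspan A B"
    if "a \<in> carrier A" "b \<in> carrier B" for a b c
    using that unfolding bilinearity_relations_def by (intro free.span_base) blast
  have r4: "pure a (c \<odot>\<^bsub>B\<^esub> b) - fscale c (pure a b) \<in> tspan A B"
    if "a \<in> carrier A" "b \<in> carrier B" for a b c
    using that unfolding bilinearity_relations_def by (intro free.span_base) blast
  show ?thesis
    unfolding tensor_cong_def fst_conv snd_conv
    by (intro conjI ballI allI) (simp_all only: u v r1 r2 r3 r4)
qed

lemma tensor_cong_scale:
  assumes "tensor_cong A B g h"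
  shows "tensor_cong A B (\<lambda>p. fscale k (g p)) h"
proof -
  have "fscale k x - fscale k y - fscale k z \<in> tspan A B" if "x - y - z \<in> tspan A B" for x y z
    using free.span_scale[OF that, of k] by (simp add: free.scale_right_diff_distrib)
  moreover have "fscale k x - fscale c (fscale k y) \<in> tspan A B" if "x - fscale c y \<in> tspan A B" for x y c
    using free.span_scale[OF that, of k] by (simp add: free.scale_right_diff_distrib mult.commute)
  ultimately show ?thesis using assms unfolding tensor_cong_def by blast
qed

lemma tensor_cong_sum:
  assumes "\<And>i. i \<in> I \<Longrightarrow> tensor_cong A B (g i) h"
  shows "tensor_cong A B (\<lambda>p. \<Sum>i\<in>I. g i p) h"
  using assms unfolding tensor_cong_def
  by (simp add: sum_subtractf[symmetric] free.scale_sum_right free.span_sum)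

lemma (in star_algebra) scale_zero: "x \<in> carrier A \<Longrightarrow> 0 \<odot> x = \<zero>"
  using scale_add_left[of x 1 "-1"] diff_self[of x] by (simp add: adiff_def scale_one)

lemma (in star_algebra) add_swap:
  assumes "a \<in> carrier A" "b \<in> carrier A" "c \<in> carrier A" "d \<in> carrier A"
  shows "(a \<oplus> b) \<oplus> (c \<oplus> d) = (a \<oplus> c) \<oplus> (b \<oplus> d)"
proof -
  have "(a \<oplus> b) \<oplus> (c \<oplus> d) = a \<oplus> ((b \<oplus> c) \<oplus> d)" using assms by (simp add: add_assoc add_closed)
  also have "\<dots> = a \<oplus> ((c \<oplus> b) \<oplus> d)" using assms add_comm[of b c] by simp
  also have "\<dots> = (a \<oplus> c) \<oplus> (b \<oplus> d)" using assms by (simp add: add_assoc add_closed)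
  finally show ?thesis .
qed

context graded_cstar_algebra
begin

lemma grading_hom: "scalar_hom (\<lambda>c. c) A \<alpha>"
  using grading_automorphism by (auto simp: star_automorphism_def scalar_hom_def bij_betw_def)

lemma hpart_hom: "scalar_hom (\<lambda>c. c) A (hpart A \<alpha> s)"
  using grading_hom unfolding scalar_hom_def hpart_def
  by (simp add: add_closed scale_closed scale_add_right add_swap scale_scale mult.commute)

lemma star_hom: "scalar_hom cnj A (astar A)"
  by (simp add: scalar_hom_def star_closed star_add star_scale)

lemma mult_left_hom: "x \<in> carrier A \<Longrightarrow> scalar_hom (\<lambda>c. c) A (\<lambda>y. x \<otimes> y)"
  by (simp add: scalar_hom_def mult_closed mult_add_right mult_scale_right)

lemma mult_right_hom: "x \<in> carrier A \<Longrightarrow> scalar_hom (\<lambda>c. c) A (\<lambda>y. y \<otimes> x)"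
  by (simp add: scalar_hom_def mult_closed mult_add_left mult_scale_left)

lemma hpart_closed: "x \<in> carrier A \<Longrightarrow> hpart A \<alpha> s x \<in> carrier A"
  using hpart_hom by (simp add: scalar_hom_def)

lemma hpart_homogeneous:
  assumes "homogeneous A \<alpha> s a"
  shows "hpart A \<alpha> t a = (if t = s then a else \<zero>)"
proof -
  have a: "a \<in> carrier A" and "\<alpha> a = parity_sign s \<odot> a" using assms by (simp_all add: homogeneous_def)
  then have "hpart A \<alpha> t a = (1/2) \<odot> (1 \<odot> a \<oplus> (parity_sign t * parity_sign s) \<odot> a)"
    by (simp add: hpart_def scale_scale scale_one)
  also have "\<dots> = ((1/2) * (1 + parity_sign t * parity_sign s)) \<odot> a"
    using a by (simp only: scale_add_left[symmetric] scale_scale)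
  also have "\<dots> = (if t = s then a else \<zero>)"
    using a by (simp add: parity_sign_def scale_one scale_zero)
  finally show ?thesis .
qed

end

locale fermi_pair = A: graded_cstar_algebra A \<alpha> + B: graded_cstar_algebra B \<beta>
  for A :: "('a, 'm) normed_star_algebra_scheme" and \<alpha>
    and B :: "('b, 'n) normed_star_algebra_scheme" and \<beta>
begin

lemma pure_mult_cong_left:
  assumes "fst q \<in> carrier A" "snd q \<in> carrier B"
  shows "tensor_cong A B (\<lambda>p. pure_mult A \<alpha> B \<beta> p q) (\<lambda>c. c)"
  unfolding pure_mult_def
  using scalar_hom_compose[OF B.mult_right_hom B.hpart_hom] A.mult_right_hom
  by (intro tensor_cong_sum tensor_cong_scale tensor_cong_pure) (simp_all add: assms A.hpart_closed)

lemma pure_mult_cong_right: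
  assumes "fst p \<in> carrier A" "snd p \<in> carrier B"
  shows "tensor_cong A B (pure_mult A \<alpha> B \<beta> p) (\<lambda>c. c)"
  unfolding pure_mult_def[abs_def]
  using scalar_hom_compose[OF A.mult_left_hom A.hpart_hom] B.mult_left_hom
  by (intro tensor_cong_sum tensor_cong_scale tensor_cong_pure) (simp_all add: assms B.hpart_closed)

lemma pure_star_cong: "tensor_cong A B (pure_star A \<alpha> B \<beta>) cnj"
  unfolding pure_star_def[abs_def]
  using scalar_hom_compose[OF A.star_hom A.hpart_hom] scalar_hom_compose[OF B.star_hom B.hpart_hom]
  by (intro tensor_cong_sum tensor_cong_scale tensor_cong_pure) simp_all

lemma free_mult_left:
  "free_mult A \<alpha> B \<beta> x y = free_ext (\<lambda>c. c) (\<lambda>p. free_ext (\<lambda>c. c) (pure_mult A \<alpha> B \<beta> p) y) x"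
  by (simp add: free_mult_def free_ext_def free.scale_sum_right)

lemma free_mult_right:
  "free_mult A \<alpha> B \<beta> x y = free_ext (\<lambda>c. c) (\<lambda>q. free_ext (\<lambda>c. c) (\<lambda>p. pure_mult A \<alpha> B \<beta> p q) x) y"
  unfolding free_mult_def free_ext_def
  by (subst sum.swap) (simp add: free.scale_sum_right mult.commute)

lemma free_mult_span_left:
  assumes "x \<in> tspan A B" "y \<in> free_carrier A B"
  shows "free_mult A \<alpha> B \<beta> x y \<in> tspan A B"
  unfolding free_mult_left
proof (rule lin.free_ext_span[OF _ assms(1)])
  show "tensor_cong A B (\<lambda>p. free_ext (\<lambda>c. c) (pure_mult A \<alpha> B \<beta> p) y) (\<lambda>c. c)"
    unfolding free_ext_def using assms(2)
    by (intro tensor_cong_sum tensor_cong_scale pure_mult_cong_left) (auto simp: free_carrier_def)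
qed

lemma free_mult_span_right:
  assumes "x \<in> free_carrier A B" "y \<in> tspan A B"
  shows "free_mult A \<alpha> B \<beta> x y \<in> tspan A B"
  unfolding free_mult_right
proof (rule lin.free_ext_span[OF _ assms(2)])
  show "tensor_cong A B (\<lambda>q. free_ext (\<lambda>c. c) (\<lambda>p. pure_mult A \<alpha> B \<beta> p q) x) (\<lambda>c. c)"
    unfolding free_ext_def using assms(1)
    by (intro tensor_cong_sum tensor_cong_scale pure_mult_cong_right) (auto simp: free_carrier_def)
qed

lemma pure_mult_closed:
  "\<lbrakk>fst p \<in> carrier A; snd p \<in> carrier B; fst q \<in> carrier A; snd q \<in> carrier B\<rbrakk> \<Longrightarrow>
     pure_mult A \<alpha> B \<beta> p q \<in> free_carrier A B"
  unfolding pure_mult_def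
  by (intro free_carrier_sum free_carrier_scale pure_in_free)
    (simp_all add: A.mult_closed B.mult_closed A.hpart_closed B.hpart_closed)

lemma pure_star_closed:
  "\<lbrakk>fst p \<in> carrier A; snd p \<in> carrier B\<rbrakk> \<Longrightarrow> pure_star A \<alpha> B \<beta> p \<in> free_carrier A B"
  unfolding pure_star_def
  by (intro free_carrier_sum free_carrier_scale pure_in_free)
    (simp_all add: A.star_closed B.star_closed A.hpart_closed B.hpart_closed)

lemma free_mult_closed:
  "\<lbrakk>x \<in> free_carrier A B; y \<in> free_carrier A B\<rbrakk> \<Longrightarrow> free_mult A \<alpha> B \<beta> x y \<in> free_carrier A B"
  unfolding free_mult_def
  by (intro free_carrier_sum free_carrier_scale pure_mult_closed) (auto simp: free_carrier_def)

lemma free_star_closed: "x \<in> free_carrier A B \<Longrightarrow> free_star A \<alpha> B \<beta> x \<in> free_carrier A B"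
  unfolding free_star_def
  by (intro free_carrier_sum free_carrier_scale pure_star_closed) (auto simp: free_carrier_def)

lemma free_grading_closed: "x \<in> free_carrier A B \<Longrightarrow> free_grading \<alpha> \<beta> x \<in> free_carrier A B"
  unfolding free_grading_def using A.grading_hom B.grading_hom
  by (intro free_carrier_sum free_carrier_scale pure_in_free) (auto simp: free_carrier_def scalar_hom_def)

lemma free_mult_rel:
  assumes "(x, x') \<in> tensor_rel A B" "(y, y') \<in> tensor_rel A B"
  shows "(free_mult A \<alpha> B \<beta> x y, free_mult A \<alpha> B \<beta> x' y') \<in> tensor_rel A B"
proof -
  have l: "free_mult A \<alpha> B \<beta> (x - x') y = free_mult A \<alpha> B \<beta> x y - free_mult A \<alpha> B \<beta> x' y"
    by (simp only: free_mult_left lin.free_ext_diff)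
  have r: "free_mult A \<alpha> B \<beta> x' (y - y') = free_mult A \<alpha> B \<beta> x' y - free_mult A \<alpha> B \<beta> x' y'"
    by (simp only: free_mult_right lin.free_ext_diff)
  have "free_mult A \<alpha> B \<beta> x y - free_mult A \<alpha> B \<beta> x' y'
      = free_mult A \<alpha> B \<beta> (x - x') y + free_mult A \<alpha> B \<beta> x' (y - y')"
    by (simp add: l r)
  then show ?thesis
    using assms free_mult_span_left[of "x - x'" y] free_mult_span_right[of x' "y - y'"]
    by (simp add: tensor_rel_def free_mult_closed free.span_add)
qed

lemma free_star_rel:
  assumes "(x, x') \<in> tensor_rel A B"
  shows "(free_star A \<alpha> B \<beta> x, free_star A \<alpha> B \<beta> x') \<in> tensor_rel A B"
proof -
  have *: "free_star A \<alpha> B \<beta> z = free_ext cnj (pure_star A \<alpha> B \<beta>) z" for z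
    by (simp add: free_star_def free_ext_def)
  show ?thesis
    using assms conjugate.free_ext_span[OF pure_star_cong, of "x - x'"]
    by (simp add: tensor_rel_def free_star_closed) (simp add: * conjugate.free_ext_diff)
qed

lemma free_grading_rel:
  assumes "(x, x') \<in> tensor_rel A B"
  shows "(free_grading \<alpha> \<beta> x, free_grading \<alpha> \<beta> x') \<in> tensor_rel A B"
proof -
  have *: "free_grading \<alpha> \<beta> z = free_ext (\<lambda>c. c) (\<lambda>p. pure (\<alpha> (fst p)) (\<beta> (snd p))) z" for z
    by (simp add: free_grading_def free_ext_def)
  show ?thesis
    using assms lin.free_ext_span[OF tensor_cong_pure[OF A.grading_hom B.grading_hom], of "x - x'"]
    by (simp add: tensor_rel_def free_grading_closed) (simp add: * lin.free_ext_diff)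
qed

lemma fscale_rel: "(x, x') \<in> tensor_rel A B \<Longrightarrow> (fscale c x, fscale c x') \<in> tensor_rel A B"
  using free.span_scale[of "x - x'" "bilinearity_relations A B" c]
  by (simp add: tensor_rel_def free_carrier_scale free.scale_right_diff_distrib)

lemma pure_zero:
  assumes "a \<in> carrier A" "b \<in> carrier B"
  shows "pure \<zero>\<^bsub>A\<^esub> b \<in> tspan A B" "pure a \<zero>\<^bsub>B\<^esub> \<in> tspan A B"
proof -
  have "tensor_cong A B (\<lambda>p. pure (fst p) (snd p)) (\<lambda>c. c)"
    by (rule tensor_cong_pure) (simp_all add: scalar_hom_def)
  then have "pure (0 \<odot>\<^bsub>A\<^esub> a) b - fscale 0 (pure a b) \<in> tspan A B"
    "pure a (0 \<odot>\<^bsub>B\<^esub> b) - fscale 0 (pure a b) \<in> tspan A B"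
    using assms by (simp_all only: tensor_cong_def fst_conv snd_conv)
  then show "pure \<zero>\<^bsub>A\<^esub> b \<in> tspan A B" "pure a \<zero>\<^bsub>B\<^esub> \<in> tspan A B"
    using assms by (simp_all add: A.scale_zero B.scale_zero)
qed

lemma sum_parity: "(\<Sum>s\<in>UNIV. f s) = f True + (f False :: 'c::ab_group_add)"
  by (simp add: UNIV_bool add.commute)

theorem fermi_mult_homogeneous:
  assumes a: "a \<in> carrier A" and b: "homogeneous B \<beta> s b"
    and a': "homogeneous A \<alpha> t a'" and b': "b' \<in> carrier B"
  shows "tensor A B a b \<otimes>\<^bsub>fermi_algebra A \<alpha> B \<beta>\<^esub> tensor A B a' b'
       = koszul s t \<odot>\<^bsub>fermi_algebra A \<alpha> B \<beta>\<^esub> tensor A B (a \<otimes>\<^bsub>A\<^esub> a') (b \<otimes>\<^bsub>B\<^esub> b')"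
proof -
  have c: "b \<in> carrier B" "a' \<in> carrier A" using b a' by (simp_all add: homogeneous_def)
  let ?z = "\<lambda>s' t'. fscale (koszul s' t')
      (pure (a \<otimes>\<^bsub>A\<^esub> hpart A \<alpha> t' a') (hpart B \<beta> s' b \<otimes>\<^bsub>B\<^esub> b'))"
  have az: "a \<otimes>\<^bsub>A\<^esub> \<zero>\<^bsub>A\<^esub> = \<zero>\<^bsub>A\<^esub>"
    using A.mult_scale_right[OF a a, of 0] a by (simp add: A.scale_zero A.mult_closed)
  have zb: "\<zero>\<^bsub>B\<^esub> \<otimes>\<^bsub>B\<^esub> b' = \<zero>\<^bsub>B\<^esub>"
    using B.mult_scale_left[OF b' b', of 0] b' by (simp add: B.scale_zero B.mult_closed)
  have z: "?z s' t' \<in> tspan A B" if "s' \<noteq> s \<or> t' \<noteq> t" for s' t'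
    using that a b' c
    by (auto simp: A.hpart_homogeneous[OF a'] B.hpart_homogeneous[OF b] az zb
        intro!: free.span_scale pure_zero A.mult_closed B.mult_closed A.zero_closed B.zero_closed)
  have e: "?z s t = fscale (koszul s t) (pure (a \<otimes>\<^bsub>A\<^esub> a') (b \<otimes>\<^bsub>B\<^esub> b'))"
    by (simp add: A.hpart_homogeneous[OF a'] B.hpart_homogeneous[OF b])
  have "(\<Sum>s'\<in>UNIV. \<Sum>t'\<in>UNIV. ?z s' t') - ?z s t
      = ?z (\<not> s) t + ?z s (\<not> t) + ?z (\<not> s) (\<not> t)"
    by (cases s; cases t; simp only: sum_parity; simp)
  also have "\<dots> \<in> tspan A B"
    using z by (intro free.span_add) simp_all
  finally have "(pure_mult A \<alpha> B \<beta> (a, b) (a', b'),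
      fscale (koszul s t) (pure (a \<otimes>\<^bsub>A\<^esub> a') (b \<otimes>\<^bsub>B\<^esub> b'))) \<in> tensor_rel A B"
    using a b' c
    by (simp add: tensor_rel_def e pure_mult_closed free_carrier_scale pure_in_free A.mult_closed B.mult_closed)
      (simp add: pure_mult_def)
  moreover have "free_mult A \<alpha> B \<beta> (pure a b) (pure a' b') = pure_mult A \<alpha> B \<beta> (a, b) (a', b')"
    by (simp add: free_mult_left lin.free_ext_pure)
  ultimately have "tensor_rel A B `` {free_mult A \<alpha> B \<beta> (pure a b) (pure a' b')}
      = tensor_rel A B `` {fscale (koszul s t) (pure (a \<otimes>\<^bsub>A\<^esub> a') (b \<otimes>\<^bsub>B\<^esub> b'))}"
    using equiv_class_eq[OF equiv_tensor_rel] by metis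
  then show ?thesis
    using a b' c
    by (simp add: fermi_algebra_def tensor_def quot_lift2_class[OF equiv_tensor_rel] free_mult_rel
        quot_lift_class[OF equiv_tensor_rel] fscale_rel pure_in_free A.mult_closed B.mult_closed)
qed

theorem fermi_star_homogeneous:
  assumes a: "homogeneous A \<alpha> s a" and b: "homogeneous B \<beta> t b"
  shows "astar (fermi_algebra A \<alpha> B \<beta>) (tensor A B a b)
       = koszul s t \<odot>\<^bsub>fermi_algebra A \<alpha> B \<beta>\<^esub> tensor A B (astar A a) (astar B b)"
proof -
  have c: "a \<in> carrier A" "b \<in> carrier B" using a b by (simp_all add: homogeneous_def)
  let ?z = "\<lambda>s' t'. fscale (koszul s' t')
      (pure (astar A (hpart A \<alpha> s' a)) (astar B (hpart B \<beta> t' b)))"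
  have az: "astar A \<zero>\<^bsub>A\<^esub> = \<zero>\<^bsub>A\<^esub>"
    using A.star_scale[OF c(1), of 0] c by (simp add: A.scale_zero A.star_closed)
  have bz: "astar B \<zero>\<^bsub>B\<^esub> = \<zero>\<^bsub>B\<^esub>"
    using B.star_scale[OF c(2), of 0] c by (simp add: B.scale_zero B.star_closed)
  have z: "?z s' t' \<in> tspan A B" if "s' \<noteq> s \<or> t' \<noteq> t" for s' t'
    using that c
    by (auto simp: A.hpart_homogeneous[OF a] B.hpart_homogeneous[OF b] az bz
        intro!: free.span_scale pure_zero A.star_closed B.star_closed A.zero_closed B.zero_closed)
  have e: "?z s t = fscale (koszul s t) (pure (astar A a) (astar B b))"
    by (simp add: A.hpart_homogeneous[OF a] B.hpart_homogeneous[OF b])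
  have "(\<Sum>s'\<in>UNIV. \<Sum>t'\<in>UNIV. ?z s' t') - ?z s t
      = ?z (\<not> s) t + ?z s (\<not> t) + ?z (\<not> s) (\<not> t)"
    by (cases s; cases t; simp only: sum_parity; simp)
  also have "\<dots> \<in> tspan A B"
    using z by (intro free.span_add) simp_all
  finally have "(pure_star A \<alpha> B \<beta> (a, b), fscale (koszul s t) (pure (astar A a) (astar B b)))
      \<in> tensor_rel A B"
    using c
    by (simp add: tensor_rel_def e pure_star_closed free_carrier_scale pure_in_free A.star_closed B.star_closed)
      (simp add: pure_star_def)
  moreover have "free_star A \<alpha> B \<beta> (pure a b) = pure_star A \<alpha> B \<beta> (a, b)"
    using conjugate.free_ext_pure[of "pure_star A \<alpha> B \<beta>" a b] by (simp add: free_star_def free_ext_def)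
  ultimately have "tensor_rel A B `` {free_star A \<alpha> B \<beta> (pure a b)}
      = tensor_rel A B `` {fscale (koszul s t) (pure (astar A a) (astar B b))}"
    using equiv_class_eq[OF equiv_tensor_rel] by metis
  then show ?thesis
    using c
    by (simp add: fermi_algebra_def tensor_def free_star_rel
        quot_lift_class[OF equiv_tensor_rel] fscale_rel pure_in_free A.star_closed B.star_closed)
qed

theorem fermi_grading_tensor:
  assumes "a \<in> carrier A" "b \<in> carrier B"
  shows "fermi_grading A \<alpha> B \<beta> (tensor A B a b) = tensor A B (\<alpha> a) (\<beta> b)"
proof -
  have "free_grading \<alpha> \<beta> (pure a b) = pure (\<alpha> a) (\<beta> b)"
    using lin.free_ext_pure[of "\<lambda>p. pure (\<alpha> (fst p)) (\<beta> (snd p))" a b]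
    by (simp add: free_grading_def free_ext_def)
  then show ?thesis
    using quot_lift_class[OF equiv_tensor_rel pure_in_free[OF assms] free_grading_rel]
    by (simp add: fermi_grading_def tensor_def)
qed

theorem product_functional_tensor:
  assumes "state A \<phi>" "state B \<psi>" "a \<in> carrier A" "b \<in> carrier B"
  shows "product_functional \<phi> \<psi> (tensor A B a b) = \<phi> a * \<psi> b"
proof -
  define f where "f x = (\<Sum>p\<in>Poly_Mapping.keys x. Poly_Mapping.lookup x p * (\<phi> (fst p) * \<psi> (snd p)))" for x
  have super: "f x = (\<Sum>p\<in>S. Poly_Mapping.lookup x p * (\<phi> (fst p) * \<psi> (snd p)))"
    if "finite S" "Poly_Mapping.keys x \<subseteq> S" for x S
    unfolding f_def using that by (intro sum.mono_neutral_left) (auto simp: in_keys_iff)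
  have add: "f (x + y) = f x + f y" for x y
    using keys_add[of x y]
    by (simp add: super[of "Poly_Mapping.keys x \<union> Poly_Mapping.keys y"] lookup_add algebra_simps sum.distrib)
  have scale: "f (fscale c x) = c * f x" for c x
  proof -
    have "Poly_Mapping.keys (fscale c x) \<subseteq> Poly_Mapping.keys x" by (auto simp: in_keys_iff)
    then show ?thesis
      by (simp add: super[of "Poly_Mapping.keys x"] sum_distrib_left mult.assoc)
  qed
  have diff: "f (x - y) = f x - f y" for x y
    using add[of "x - y" y] by simp
  have gen: "f (pure a b) = \<phi> a * \<psi> b" for a b
    by (simp add: f_def pure_def)
  have rels: "f x = 0" if "x \<in> bilinearity_relations A B" for x
    using that assms(1,2) unfolding bilinearity_relations_def state_def
    by (elim UnE CollectE exE conjE; simp only: diff scale gen; simp add: algebra_simps)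
  have span: "f x = 0" if "x \<in> tspan A B" for x
    using that by (induction x rule: free.span_induct_alt) (simp_all only: add scale rels, simp_all add: f_def)
  have "f y = \<phi> a * \<psi> b" if "y \<in> tensor A B a b" for y
    using that span[of "pure a b - y"] by (simp only: tensor_def tensor_rel_def Image_singleton_iff)
      (simp add: diff gen)
  moreover have "pure a b \<in> tensor A B a b"
    unfolding tensor_def by (rule equiv_class_self[OF equiv_tensor_rel pure_in_free[OF assms(3,4)]])
  ultimately have "f ` tensor A B a b = {\<phi> a * \<psi> b}"
    by (auto intro!: rev_image_eqI[of "pure a b"])
  then show ?thesis by (simp add: product_functional_def quot_value_def f_def[symmetric])
qed

end

end

theory Submission
  imports Defs
begin

text \<open>
  The grading \<open>\<theta>\<^sub>o\<close> of the algebraic Fermi tensor product is an involutive \<open>*\<close>-automorphism, and it leaves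
  every product functional \<open>\<phi> \<times> \<psi>\<close> of even states invariant. It is therefore isometric for every GNS
  seminorm and for the minimal norm (\<open>fermi_norm_grading\<close>). An isometric involutive automorphism extends
  to the completion term by term along Cauchy sequences (\<open>completion_map_automorphism\<close>).

  The completion is a $C^*$-algebra (\<open>completion_cstar_algebra\<close>) because the minimal norm is a
  $C^*$-seminorm. This holds for the supremum of the GNS operator norms of any family of positive functionals
  for which left multiplications are uniformly bounded (\<open>sup_norm_cstar_seminorm\<close>). For product functionals
  positivity and boundedness come from one computation: with respect to \<open>\<phi> \<times> \<psi>\<close> homogeneous tensors have the
  inner product \<open>\<phi> (a\<^sup>*a') \<psi> (b\<^sup>*b')\<close>, because \<open>\<phi>\<close> vanishes on odd elements and the signs cancel on even ones
  (\<open>product_form_tensors\<close>). The Gram kernel is thus a Schur product of two positive semidefinite kernels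
  (\<open>schur_product\<close>), and the bound \<open>\<parallel>a\<parallel> \<parallel>b\<parallel>\<close> for left multiplication by \<open>a \<odot> b\<close> follows from the inequality
  \<open>\<phi> (y\<^sup>*a\<^sup>*a y) \<le> \<parallel>a\<parallel>\<^sup>2 \<phi> (y\<^sup>*y)\<close> in each factor (\<open>state_left_bounded\<close>).

  Uniqueness concerns all \<open>*\<close>-automorphisms of the completion, with no continuity assumed. They are
  automatically bounded (\<open>star_automorphism_bounded\<close>): a small self-adjoint \<open>h\<close> is the imaginary part of some
  \<open>z\<close> with \<open>z\<^sup>*z = z + z\<^sup>*\<close>, that is, with \<open>1 - z\<close> isometric; \<open>\<theta>\<close> preserves this relation, which bounds the norm of
  \<open>\<theta> z\<close>. An automorphism is therefore determined by its values on the dense algebraic tensor product.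
\<close>

section \<open>Linear algebra over a carrier\<close>

context star_algebra
begin

lemma add_left_comm: "\<lbrakk>x \<in> carrier A; y \<in> carrier A; z \<in> carrier A\<rbrakk> \<Longrightarrow> x \<oplus> (y \<oplus> z) = y \<oplus> (x \<oplus> z)"
  by (metis add_assoc add_comm)

lemma diff_closed: "\<lbrakk>x \<in> carrier A; y \<in> carrier A\<rbrakk> \<Longrightarrow> x \<ominus> y \<in> carrier A"
  by (simp add: adiff_def add_closed scale_closed)

lemmas closed = zero_closed add_closed scale_closed mult_closed star_closed diff_closed

lemma scale_zero_right: "c \<odot> \<zero> = \<zero>"
  using scale_scale[of \<zero> c 0] scale_zero[of \<zero>] by (simp add: zero_closed)

lemma zero_add: "x \<in> carrier A \<Longrightarrow> \<zero> \<oplus> x = x"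
  by (simp add: add_comm[of \<zero>] add_zero zero_closed)

lemma diff_zero: "x \<in> carrier A \<Longrightarrow> x \<ominus> \<zero> = x"
  by (simp add: adiff_def scale_zero_right add_zero)

lemma diff_eq_zero:
  assumes "x \<in> carrier A" "y \<in> carrier A" "x \<ominus> y = \<zero>"
  shows "x = y"
proof -
  have "(x \<ominus> y) \<oplus> y = x \<oplus> ((-1) \<odot> y \<oplus> 1 \<odot> y)"
    using assms(1,2) by (simp add: adiff_def closed add_assoc scale_one)
  also have "\<dots> = x \<oplus> ((-1) + 1) \<odot> y"
    using assms(1,2) by (simp only: scale_add_left)
  also have "\<dots> = x" using assms(1,2) by (simp add: scale_zero add_zero)
  finally show ?thesis using assms by (simp add: zero_add)
qed

lemma diff_add_diff:
  assumes "x \<in> carrier A" "y \<in> carrier A" "z \<in> carrier A"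
  shows "(x \<ominus> y) \<oplus> (y \<ominus> z) = x \<ominus> z"
proof -
  have "(x \<ominus> y) \<oplus> (y \<ominus> z) = (x \<oplus> (-1) \<odot> z) \<oplus> (y \<ominus> y)"
    using assms by (simp add: adiff_def closed add_assoc add_comm add_left_comm)
  then show ?thesis using assms by (simp add: diff_self add_zero closed) (simp add: adiff_def)
qed

lemma add_diff_add:
  "\<lbrakk>x \<in> carrier A; y \<in> carrier A; x' \<in> carrier A; y' \<in> carrier A\<rbrakk> \<Longrightarrow>
     (x \<oplus> y) \<ominus> (x' \<oplus> y') = (x \<ominus> x') \<oplus> (y \<ominus> y')"
  by (simp add: adiff_def scale_add_right closed add_assoc add_comm add_left_comm)

lemma scale_diff:
  "\<lbrakk>x \<in> carrier A; y \<in> carrier A\<rbrakk> \<Longrightarrow> c \<odot> (x \<ominus> y) = c \<odot> x \<ominus> c \<odot> y"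
  by (simp add: adiff_def scale_add_right closed scale_scale mult.commute)

lemma diff_swap: "\<lbrakk>x \<in> carrier A; y \<in> carrier A\<rbrakk> \<Longrightarrow> x \<ominus> y = (-1) \<odot> (y \<ominus> x)"
  by (simp add: adiff_def scale_add_right closed scale_scale scale_one add_comm)

lemma star_diff: "\<lbrakk>x \<in> carrier A; y \<in> carrier A\<rbrakk> \<Longrightarrow> astar A (x \<ominus> y) = astar A x \<ominus> astar A y"
  by (simp add: adiff_def star_add star_scale closed)

lemma star_zero: "astar A \<zero> = \<zero>"
  using star_scale[of \<zero> 0] by (simp add: scale_zero closed)

lemma mult_diff_right:
  "\<lbrakk>x \<in> carrier A; y \<in> carrier A; z \<in> carrier A\<rbrakk> \<Longrightarrow> x \<otimes> (y \<ominus> z) = x \<otimes> y \<ominus> x \<otimes> z"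
  by (simp add: adiff_def mult_add_right mult_scale_right closed)

lemma mult_diff_left:
  "\<lbrakk>x \<in> carrier A; y \<in> carrier A; z \<in> carrier A\<rbrakk> \<Longrightarrow> (y \<ominus> z) \<otimes> x = y \<otimes> x \<ominus> z \<otimes> x"
  by (simp add: adiff_def mult_add_left mult_scale_left closed)

lemma mult_diff_mult:
  "\<lbrakk>x \<in> carrier A; y \<in> carrier A; x' \<in> carrier A; y' \<in> carrier A\<rbrakk> \<Longrightarrow>
     x \<otimes> y \<ominus> x' \<otimes> y' = x \<otimes> (y \<ominus> y') \<oplus> (x \<ominus> x') \<otimes> y'"
  by (simp add: mult_diff_right mult_diff_left diff_add_diff closed)

lemma star_automorphism_diff:
  "\<lbrakk>star_automorphism A \<theta>; x \<in> carrier A; y \<in> carrier A\<rbrakk> \<Longrightarrow> \<theta> (x \<ominus> y) = \<theta> x \<ominus> \<theta> y"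
  by (simp add: star_automorphism_def adiff_def closed)

end

section \<open>Seminorms and completions\<close>

text \<open>
  A function constant on an equivalence class descends to the quotient with that value; this is the
  form in which \<open>quot_value\<close> is evaluated.
\<close>

lemma image_constant_on: "\<lbrakk>x \<in> S; \<And>y. y \<in> S \<Longrightarrow> g y = d\<rbrakk> \<Longrightarrow> g ` S = {d}"
  by auto

locale seminorm_on = star_algebra +
  fixes p
  assumes p_nonneg: "x \<in> carrier A \<Longrightarrow> 0 \<le> p x"
    and p_triangle: "\<lbrakk>x \<in> carrier A; y \<in> carrier A\<rbrakk> \<Longrightarrow> p (x \<oplus> y) \<le> p x + p y"
    and p_scale: "x \<in> carrier A \<Longrightarrow> p (c \<odot> x) = cmod c * p x"
begin

lemma p_zero: "p \<zero> = 0"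
  using p_scale[of \<zero> 0] by (simp add: scale_zero zero_closed)

lemma p_diff_swap: "\<lbrakk>x \<in> carrier A; y \<in> carrier A\<rbrakk> \<Longrightarrow> p (x \<ominus> y) = p (y \<ominus> x)"
  by (subst diff_swap) (simp_all add: p_scale closed)

lemma p_diff_triangle:
  "\<lbrakk>x \<in> carrier A; y \<in> carrier A; z \<in> carrier A\<rbrakk> \<Longrightarrow> p (x \<ominus> z) \<le> p (x \<ominus> y) + p (y \<ominus> z)"
  using p_triangle[of "x \<ominus> y" "y \<ominus> z"] by (simp add: diff_add_diff closed)

lemma p_diff_bound:
  assumes "x \<in> carrier A" "y \<in> carrier A"
  shows "\<bar>p x - p y\<bar> \<le> p (x \<ominus> y)"
  using p_diff_triangle[of x y \<zero>] p_diff_triangle[of y x \<zero>] p_diff_swap[of x y] assms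
  by (simp add: diff_zero closed)

lemma Cauchy_closed: "seminorm_Cauchy A p X \<Longrightarrow> X n \<in> carrier A"
  by (simp add: seminorm_Cauchy_def)

lemma Cauchy_const: "x \<in> carrier A \<Longrightarrow> seminorm_Cauchy A p (\<lambda>_. x)"
  by (simp add: seminorm_Cauchy_def diff_self p_zero)

lemma Cauchy_convergent_norm:
  assumes "seminorm_Cauchy A p X"
  shows "convergent (\<lambda>n. p (X n))"
proof -
  have "Cauchy (\<lambda>n. p (X n))"
  proof (rule metric_CauchyI)
    fix e :: real assume "0 < e"
    then obtain N where N: "\<And>m n. m \<ge> N \<Longrightarrow> n \<ge> N \<Longrightarrow> p (X m \<ominus> X n) < e"
      using assms unfolding seminorm_Cauchy_def by blast
    have "dist (p (X m)) (p (X n)) < e" if "m \<ge> N" "n \<ge> N" for m n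
      using p_diff_bound[of "X m" "X n"] N[OF that] assms by (simp add: dist_real_def Cauchy_closed)
    then show "\<exists>M. \<forall>m\<ge>M. \<forall>n\<ge>M. dist (p (X m)) (p (X n)) < e" by blast
  qed
  then show ?thesis by (simp add: Cauchy_convergent_iff)
qed

lemma tendsto_lim_norm: "seminorm_Cauchy A p X \<Longrightarrow> (\<lambda>n. p (X n)) \<longlonglongrightarrow> lim (\<lambda>n. p (X n))"
  using Cauchy_convergent_norm by (simp add: convergent_LIMSEQ_iff)

lemma null_le:
  assumes "\<And>n. X n \<in> carrier A" "\<And>n. p (X n) \<le> f n" "f \<longlonglongrightarrow> 0"
  shows "(\<lambda>n. p (X n)) \<longlonglongrightarrow> 0"
  by (rule tendsto_sandwich[OF _ _ tendsto_const assms(3)]) (simp_all add: assms p_nonneg)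

lemma equiv_completion_rel: "equiv (Collect (seminorm_Cauchy A p)) (completion_rel A p)"
proof (rule equivI)
  show "completion_rel A p \<subseteq> Collect (seminorm_Cauchy A p) \<times> Collect (seminorm_Cauchy A p)"
    by (auto simp: completion_rel_def)
  show "refl_on (Collect (seminorm_Cauchy A p)) (completion_rel A p)"
    by (auto simp: refl_on_def completion_rel_def diff_self Cauchy_closed p_zero)
  show "sym (completion_rel A p)"
    by (rule symI) (simp add: completion_rel_def p_diff_swap Cauchy_closed)
  show "trans (completion_rel A p)"
  proof (rule transI)
    fix X Y Z assume XY: "(X, Y) \<in> completion_rel A p" and YZ: "(Y, Z) \<in> completion_rel A p"
    have "(\<lambda>n. p (X n \<ominus> Y n) + p (Y n \<ominus> Z n)) \<longlonglongrightarrow> 0"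
      using XY YZ by (auto simp: completion_rel_def intro: tendsto_add_zero)
    then have "(\<lambda>n. p (X n \<ominus> Z n)) \<longlonglongrightarrow> 0"
      using XY YZ
      by (intro null_le[OF _ p_diff_triangle]) (simp_all add: completion_rel_def Cauchy_closed closed)
    then show "(X, Z) \<in> completion_rel A p" using XY YZ by (simp add: completion_rel_def)
  qed
qed

abbreviation Cls where "Cls X \<equiv> completion_rel A p `` {X}"

lemma completion_carrierE:
  assumes "\<xi> \<in> completion_carrier A p"
  obtains X where "seminorm_Cauchy A p X" "\<xi> = Cls X"
  using assms unfolding completion_carrier_def by (auto elim!: quotientE)

lemma Cls_in_carrier: "seminorm_Cauchy A p X \<Longrightarrow> Cls X \<in> completion_carrier A p"
  by (auto simp: completion_carrier_def intro: quotientI)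

lemma Cls_eq:
  assumes "seminorm_Cauchy A p X" "seminorm_Cauchy A p Y"
  shows "Cls X = Cls Y \<longleftrightarrow> (\<lambda>n. p (X n \<ominus> Y n)) \<longlonglongrightarrow> 0"
  using eq_equiv_class_iff[OF equiv_completion_rel, of X Y] assms by (simp add: completion_rel_def)

lemma completion_norm_class:
  assumes "seminorm_Cauchy A p X"
  shows "completion_norm p (Cls X) = lim (\<lambda>n. p (X n))"
proof -
  have "lim (\<lambda>n. p (Y n)) = lim (\<lambda>n. p (X n))" if "Y \<in> Cls X" for Y
  proof -
    have Y: "seminorm_Cauchy A p Y" and 0: "(\<lambda>n. p (X n \<ominus> Y n)) \<longlonglongrightarrow> 0"
      using that by (simp_all add: completion_rel_def)
    have "(\<lambda>n. p (X n) - p (Y n)) \<longlonglongrightarrow> 0"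
      by (rule Lim_null_comparison[OF _ 0]) (simp add: p_diff_bound Cauchy_closed assms Y)
    with tendsto_lim_norm[OF assms] have "(\<lambda>n. p (X n) - (p (X n) - p (Y n))) \<longlonglongrightarrow> lim (\<lambda>n. p (X n)) - 0"
      by (rule tendsto_diff)
    then show ?thesis by (simp add: limI)
  qed
  moreover have "X \<in> Cls X"
    using equiv_class_self[OF equiv_completion_rel] assms by simp
  ultimately have "(\<lambda>X. lim (\<lambda>n. p (X n))) ` Cls X = {lim (\<lambda>n. p (X n))}"
    by (intro image_constant_on)
  then show ?thesis by (simp add: completion_norm_def quot_value_def)
qed

lemma completion_norm_tendsto:
  "seminorm_Cauchy A p X \<Longrightarrow> (\<lambda>n. p (X n)) \<longlonglongrightarrow> completion_norm p (Cls X)"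
  by (simp add: completion_norm_class tendsto_lim_norm)

text \<open>
  Scaling, left multiplication on a GNS space, and, for a $C^*$-seminorm, the involution and isometric
  automorphisms are all Lipschitz, which is what a pointwise operation on sequences needs in order to descend to the
  completion. One lifting lemma serves them all.
\<close>

definition lipschitz where
  "lipschitz u \<longleftrightarrow> (\<forall>x\<in>carrier A. u x \<in> carrier A) \<and>
     (\<exists>K. \<forall>x\<in>carrier A. \<forall>y\<in>carrier A. p (u x \<ominus> u y) \<le> K * p (x \<ominus> y))"

lemma lipschitz_lift:
  assumes u: "lipschitz u" and X: "seminorm_Cauchy A p X"
  shows "seminorm_Cauchy A p (\<lambda>n. u (X n))"
    and "quot_lift (completion_rel A p) (\<lambda>X n. u (X n)) (Cls X) = Cls (\<lambda>n. u (X n))"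
proof -
  obtain K where uc: "\<And>x. x \<in> carrier A \<Longrightarrow> u x \<in> carrier A"
    and K: "\<And>x y. x \<in> carrier A \<Longrightarrow> y \<in> carrier A \<Longrightarrow> p (u x \<ominus> u y) \<le> K * p (x \<ominus> y)"
    using u unfolding lipschitz_def by blast
  have C: "seminorm_Cauchy A p (\<lambda>n. u (X n))" if X: "seminorm_Cauchy A p X" for X
    unfolding seminorm_Cauchy_def
  proof (intro conjI allI impI)
    fix e :: real assume "0 < e"
    then have "0 < e / (\<bar>K\<bar> + 1)" by simp
    then obtain N where N: "\<And>m n. m \<ge> N \<Longrightarrow> n \<ge> N \<Longrightarrow> p (X m \<ominus> X n) < e / (\<bar>K\<bar> + 1)"
      using X unfolding seminorm_Cauchy_def by blast
    have "p (u (X m) \<ominus> u (X n)) < e" if "m \<ge> N" "n \<ge> N" for m n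
    proof -
      have "p (u (X m) \<ominus> u (X n)) \<le> K * p (X m \<ominus> X n)" using K X by (simp add: Cauchy_closed)
      also have "\<dots> \<le> (\<bar>K\<bar> + 1) * p (X m \<ominus> X n)"
        using X by (intro mult_right_mono p_nonneg) (simp_all add: Cauchy_closed closed)
      also have "\<dots> < e" using N[OF that] by (simp add: field_simps)
      finally show ?thesis .
    qed
    then show "\<exists>N. \<forall>m\<ge>N. \<forall>n\<ge>N. p (u (X m) \<ominus> u (X n)) < e" by blast
  qed (simp add: uc Cauchy_closed X)
  show "seminorm_Cauchy A p (\<lambda>n. u (X n))" using C X by blast
  show "quot_lift (completion_rel A p) (\<lambda>X n. u (X n)) (Cls X) = Cls (\<lambda>n. u (X n))"
  proof (rule quot_lift_class[OF equiv_completion_rel])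
    fix Y assume "(X, Y) \<in> completion_rel A p"
    then have Y: "seminorm_Cauchy A p Y" and 0: "(\<lambda>n. p (X n \<ominus> Y n)) \<longlonglongrightarrow> 0"
      by (simp_all add: completion_rel_def)
    have "(\<lambda>n. p (u (X n) \<ominus> u (Y n))) \<longlonglongrightarrow> 0"
      using X Y tendsto_mult_right_zero[OF 0, of K]
      by (intro null_le[OF _ K]) (simp_all add: Cauchy_closed closed uc)
    then show "((\<lambda>n. u (X n)), (\<lambda>n. u (Y n))) \<in> completion_rel A p"
      using C X Y by (simp add: completion_rel_def)
  qed (simp add: X)
qed

lemma scale_lipschitz: "lipschitz (\<lambda>x. c \<odot> x)"
  unfolding lipschitz_def
  by (intro conjI exI[of _ "cmod c"]) (simp_all add: closed p_scale scale_diff[symmetric])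

lemma Cauchy_add:
  assumes X: "seminorm_Cauchy A p X" and Y: "seminorm_Cauchy A p Y"
  shows "seminorm_Cauchy A p (\<lambda>n. X n \<oplus> Y n)"
  unfolding seminorm_Cauchy_def
proof (intro conjI allI impI)
  fix e :: real assume "0 < e"
  then have "0 < e / 2" by simp
  obtain N where N: "\<And>m n. m \<ge> N \<Longrightarrow> n \<ge> N \<Longrightarrow> p (X m \<ominus> X n) < e / 2"
    using X \<open>0 < e / 2\<close> unfolding seminorm_Cauchy_def by blast
  obtain M where M: "\<And>m n. m \<ge> M \<Longrightarrow> n \<ge> M \<Longrightarrow> p (Y m \<ominus> Y n) < e / 2"
    using Y \<open>0 < e / 2\<close> unfolding seminorm_Cauchy_def by blast
  have "p ((X m \<oplus> Y m) \<ominus> (X n \<oplus> Y n)) < e" if "m \<ge> max M N" "n \<ge> max M N" for m n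
    using p_triangle[of "X m \<ominus> X n" "Y m \<ominus> Y n"] M[of m n] N[of m n] that X Y
    by (simp add: add_diff_add Cauchy_closed closed)
  then show "\<exists>N. \<forall>m\<ge>N. \<forall>n\<ge>N. p ((X m \<oplus> Y m) \<ominus> (X n \<oplus> Y n)) < e" by blast
qed (simp add: X Y Cauchy_closed closed)

abbreviation C where "C \<equiv> completion A p"

lemma completion_simps:
  "carrier C = completion_carrier A p" "azero C = Cls (\<lambda>_. \<zero>)" "anorm C = completion_norm p"
  by (simp_all add: completion_def completion_embed_def)

lemma completion_add:
  assumes X: "seminorm_Cauchy A p X" and Y: "seminorm_Cauchy A p Y"
  shows "Cls X \<oplus>\<^bsub>C\<^esub> Cls Y = Cls (\<lambda>n. X n \<oplus> Y n)"
proof -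
  have "quot_lift2 (completion_rel A p) (\<lambda>X Y n. X n \<oplus> Y n) (Cls X) (Cls Y) = Cls (\<lambda>n. X n \<oplus> Y n)"
  proof (rule quot_lift2_class[OF equiv_completion_rel])
    fix X' Y' assume "(X, X') \<in> completion_rel A p" "(Y, Y') \<in> completion_rel A p"
    then have X': "seminorm_Cauchy A p X'" and Y': "seminorm_Cauchy A p Y'"
      and 0: "(\<lambda>n. p (X n \<ominus> X' n) + p (Y n \<ominus> Y' n)) \<longlonglongrightarrow> 0"
      by (auto simp: completion_rel_def intro: tendsto_add_zero)
    have "(\<lambda>n. p ((X n \<oplus> Y n) \<ominus> (X' n \<oplus> Y' n))) \<longlonglongrightarrow> 0"
      using X Y X' Y' by (intro null_le[OF _ _ 0]) (simp_all add: add_diff_add p_triangle Cauchy_closed closed)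
    then show "((\<lambda>n. X n \<oplus> Y n), (\<lambda>n. X' n \<oplus> Y' n)) \<in> completion_rel A p"
      using X Y X' Y' by (simp add: completion_rel_def Cauchy_add)
  qed (simp_all add: X Y)
  then show ?thesis by (simp add: completion_def)
qed

lemma completion_scale:
  "seminorm_Cauchy A p X \<Longrightarrow> c \<odot>\<^bsub>C\<^esub> Cls X = Cls (\<lambda>n. c \<odot> X n)"
  using lipschitz_lift(2)[OF scale_lipschitz] by (simp add: completion_def)

lemmas Cauchy_scale = lipschitz_lift(1)[OF scale_lipschitz]

lemma Cauchy_diff: "\<lbrakk>seminorm_Cauchy A p X; seminorm_Cauchy A p Y\<rbrakk> \<Longrightarrow> seminorm_Cauchy A p (\<lambda>n. X n \<ominus> Y n)"
  by (simp add: adiff_def Cauchy_add Cauchy_scale)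

lemma completion_diff:
  "\<lbrakk>seminorm_Cauchy A p X; seminorm_Cauchy A p Y\<rbrakk> \<Longrightarrow> Cls X \<ominus>\<^bsub>C\<^esub> Cls Y = Cls (\<lambda>n. X n \<ominus> Y n)"
  by (simp add: adiff_def[of C] completion_scale completion_add Cauchy_scale) (simp add: adiff_def)

lemma completion_norm_embed: "x \<in> carrier A \<Longrightarrow> completion_norm p (Cls (\<lambda>_. x)) = p x"
  by (simp add: completion_norm_class Cauchy_const lim_const)

lemma completion_norm_nonneg: "seminorm_Cauchy A p X \<Longrightarrow> 0 \<le> completion_norm p (Cls X)"
  by (rule LIMSEQ_le_const[OF completion_norm_tendsto]) (auto simp: p_nonneg Cauchy_closed)

text \<open>
  The \<open>n\<close>-th term of a Cauchy sequence, seen as a constant sequence, lies within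
  \<open>sup {p (X m \<ominus> X n) | m \<ge> n}\<close> of the class of the sequence.
\<close>

lemma embed_dense:
  assumes "seminorm_Cauchy A p X"
  shows "(\<lambda>n. completion_norm p (Cls X \<ominus>\<^bsub>C\<^esub> Cls (\<lambda>_. X n))) \<longlonglongrightarrow> 0"
proof (rule LIMSEQ_I)
  fix e :: real assume "0 < e"
  then have "0 < e / 2" by simp
  then obtain N where N: "\<And>m n. m \<ge> N \<Longrightarrow> n \<ge> N \<Longrightarrow> p (X m \<ominus> X n) < e / 2"
    using assms unfolding seminorm_Cauchy_def by blast
  have "norm (completion_norm p (Cls X \<ominus>\<^bsub>C\<^esub> Cls (\<lambda>_. X n)) - 0) < e" if "n \<ge> N" for n
  proof -
    have D: "seminorm_Cauchy A p (\<lambda>m. X m \<ominus> X n)" "Cls X \<ominus>\<^bsub>C\<^esub> Cls (\<lambda>_. X n) = Cls (\<lambda>m. X m \<ominus> X n)"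
      using assms by (simp_all add: Cauchy_diff Cauchy_const Cauchy_closed completion_diff)
    have "completion_norm p (Cls (\<lambda>m. X m \<ominus> X n)) \<le> e / 2"
      by (rule LIMSEQ_le_const2[OF completion_norm_tendsto[OF D(1)]])
        (meson N that less_imp_le)
    then show ?thesis using completion_norm_nonneg[OF D(1)] \<open>0 < e\<close> by (simp add: D(2))
  qed
  then show "\<exists>N. \<forall>n\<ge>N. norm (completion_norm p (Cls X \<ominus>\<^bsub>C\<^esub> Cls (\<lambda>_. X n)) - 0) < e" by blast
qed

end

section \<open>Completions of $C^*$-seminorms\<close>

text \<open>
  The completion identifies elements at distance zero, so the completion of a $C^*$-seminorm
  is a $C^*$-algebra.
\<close>

locale cstar_seminorm = seminorm_on +
  assumes p_mult: "\<lbrakk>x \<in> carrier A; y \<in> carrier A\<rbrakk> \<Longrightarrow> p (x \<otimes> y) \<le> p x * p y"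
    and p_cstar: "x \<in> carrier A \<Longrightarrow> p (astar A x \<otimes> x) = (p x)\<^sup>2"
begin

text \<open>
  The $C^*$-identity and submultiplicativity give \<open>(p x)\<^sup>2 \<le> p (x\<^sup>*) p x\<close>; applying the resulting
  inequality to \<open>x\<^sup>*\<close> as well makes the involution isometric.
\<close>

lemma p_star: "x \<in> carrier A \<Longrightarrow> p (astar A x) = p x"
proof -
  have le: "p x \<le> p (astar A x)" if "x \<in> carrier A" for x
    using p_cstar[OF that] p_mult[of "astar A x" x] that p_nonneg[of x] p_nonneg[of "astar A x"]
    by (cases "p x = 0") (simp_all add: power2_eq_square closed)
  show "x \<in> carrier A \<Longrightarrow> p (astar A x) = p x"
    using le[of x] le[of "astar A x"] by (simp add: star_star closed)
qed

lemma star_lipschitz: "lipschitz (astar A)"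
  unfolding lipschitz_def
  by (intro conjI exI[of _ 1]) (simp_all add: closed p_star star_diff[symmetric])

lemma completion_star:
  "seminorm_Cauchy A p X \<Longrightarrow> astar C (Cls X) = Cls (\<lambda>n. astar A (X n))"
  using lipschitz_lift(2)[OF star_lipschitz] by (simp add: completion_def)

lemmas Cauchy_star = lipschitz_lift(1)[OF star_lipschitz]

lemma Cauchy_bounded:
  assumes "seminorm_Cauchy A p X"
  obtains K where "K > 0" "\<And>n. p (X n) \<le> K"
proof -
  obtain K where "K > 0" "\<And>n. norm (p (X n)) \<le> K"
    using convergent_imp_Bseq[OF Cauchy_convergent_norm[OF assms]] by (auto elim: BseqE)
  then show thesis using that[of K] by (metis abs_le_D1 real_norm_def)
qed

lemma p_mult_diff:
  assumes "x \<in> carrier A" "y \<in> carrier A" "x' \<in> carrier A" "y' \<in> carrier A" "p x \<le> K" "p y' \<le> L"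
  shows "p (x \<otimes> y \<ominus> x' \<otimes> y') \<le> K * p (y \<ominus> y') + L * p (x \<ominus> x')"
proof -
  have "p (x \<otimes> y \<ominus> x' \<otimes> y') \<le> p (x \<otimes> (y \<ominus> y')) + p ((x \<ominus> x') \<otimes> y')"
    using assms by (simp add: mult_diff_mult p_triangle closed)
  also have "\<dots> \<le> p x * p (y \<ominus> y') + p (x \<ominus> x') * p y'"
    using assms by (intro add_mono p_mult closed)
  also have "\<dots> \<le> K * p (y \<ominus> y') + p (x \<ominus> x') * L"
    using assms by (intro add_mono mult_right_mono mult_left_mono p_nonneg closed)
  finally show ?thesis by (simp add: mult.commute)
qed

lemma Cauchy_mult:
  assumes X: "seminorm_Cauchy A p X" and Y: "seminorm_Cauchy A p Y"
  shows "seminorm_Cauchy A p (\<lambda>n. X n \<otimes> Y n)"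
  unfolding seminorm_Cauchy_def
proof (intro conjI allI impI)
  fix e :: real assume "0 < e"
  obtain K where K: "K > 0" "\<And>n. p (X n) \<le> K" using Cauchy_bounded[OF X] by blast
  obtain L where L: "L > 0" "\<And>n. p (Y n) \<le> L" using Cauchy_bounded[OF Y] by blast
  have "0 < e / (2 * L)" "0 < e / (2 * K)" using K L \<open>0 < e\<close> by simp_all
  obtain N where N: "\<And>m n. m \<ge> N \<Longrightarrow> n \<ge> N \<Longrightarrow> p (X m \<ominus> X n) < e / (2 * L)"
    using X \<open>0 < e / (2 * L)\<close> unfolding seminorm_Cauchy_def by blast
  obtain M where M: "\<And>m n. m \<ge> M \<Longrightarrow> n \<ge> M \<Longrightarrow> p (Y m \<ominus> Y n) < e / (2 * K)"
    using Y \<open>0 < e / (2 * K)\<close> unfolding seminorm_Cauchy_def by blast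
  have "p (X m \<otimes> Y m \<ominus> X n \<otimes> Y n) < e" if "m \<ge> max M N" "n \<ge> max M N" for m n
  proof -
    have "p (X m \<otimes> Y m \<ominus> X n \<otimes> Y n) \<le> K * p (Y m \<ominus> Y n) + L * p (X m \<ominus> X n)"
      using X Y K L by (intro p_mult_diff) (simp_all add: Cauchy_closed)
    moreover have "K * p (Y m \<ominus> Y n) < e / 2" "L * p (X m \<ominus> X n) < e / 2"
      using M[of m n] N[of m n] that K L by (simp_all add: field_simps)
    ultimately show ?thesis by simp
  qed
  then show "\<exists>N. \<forall>m\<ge>N. \<forall>n\<ge>N. p (X m \<otimes> Y m \<ominus> X n \<otimes> Y n) < e" by blast
qed (simp add: X Y Cauchy_closed closed)

lemma completion_mult:
  assumes X: "seminorm_Cauchy A p X" and Y: "seminorm_Cauchy A p Y"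
  shows "Cls X \<otimes>\<^bsub>C\<^esub> Cls Y = Cls (\<lambda>n. X n \<otimes> Y n)"
proof -
  have "quot_lift2 (completion_rel A p) (\<lambda>X Y n. X n \<otimes> Y n) (Cls X) (Cls Y) = Cls (\<lambda>n. X n \<otimes> Y n)"
  proof (rule quot_lift2_class[OF equiv_completion_rel])
    fix X' Y' assume "(X, X') \<in> completion_rel A p" "(Y, Y') \<in> completion_rel A p"
    then have X': "seminorm_Cauchy A p X'" and Y': "seminorm_Cauchy A p Y'"
      and 0: "(\<lambda>n. p (X n \<ominus> X' n)) \<longlonglongrightarrow> 0" "(\<lambda>n. p (Y n \<ominus> Y' n)) \<longlonglongrightarrow> 0"
      by (auto simp: completion_rel_def)
    obtain K where K: "K > 0" "\<And>n. p (X n) \<le> K" using Cauchy_bounded[OF X] by blast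
    obtain L where L: "L > 0" "\<And>n. p (Y' n) \<le> L" using Cauchy_bounded[OF Y'] by blast
    have "(\<lambda>n. K * p (Y n \<ominus> Y' n) + L * p (X n \<ominus> X' n)) \<longlonglongrightarrow> 0"
      using 0 by (intro tendsto_add_zero tendsto_mult_right_zero)
    then have "(\<lambda>n. p (X n \<otimes> Y n \<ominus> X' n \<otimes> Y' n)) \<longlonglongrightarrow> 0"
      using X Y X' Y' K L by (intro null_le[OF _ p_mult_diff]) (simp_all add: Cauchy_closed closed)
    then show "((\<lambda>n. X n \<otimes> Y n), (\<lambda>n. X' n \<otimes> Y' n)) \<in> completion_rel A p"
      using X Y X' Y' by (simp add: completion_rel_def Cauchy_mult)
  qed (simp_all add: X Y)
  then show ?thesis by (simp add: completion_def)
qed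

lemmas Cauchy_rules = Cauchy_add Cauchy_scale Cauchy_mult Cauchy_star Cauchy_diff Cauchy_const zero_closed
lemmas completion_rules = completion_add completion_scale completion_mult completion_star completion_diff

text \<open>
  Every algebraic law and every inequality holds term by term along representing sequences, and
  survives the limit.
\<close>

lemma completion_seminorm: "seminorm_on C (completion_norm p)"
proof -
  have "star_algebra C"
    by (rule star_algebra.intro; unfold completion_simps)
      (auto elim!: completion_carrierE simp: completion_rules Cls_in_carrier Cauchy_rules
        Cauchy_closed closed add_assoc add_comm add_left_comm add_zero diff_self scale_add_right scale_add_left scale_scale scale_one
        mult_assoc mult_add_left mult_add_right mult_scale_left mult_scale_right star_star star_add star_scale star_mult)
  moreover have "completion_norm p (Cls X \<oplus>\<^bsub>C\<^esub> Cls Y) \<le> completion_norm p (Cls X) + completion_norm p (Cls Y)"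
    if X: "seminorm_Cauchy A p X" and Y: "seminorm_Cauchy A p Y" for X Y
    using LIMSEQ_le[OF completion_norm_tendsto[OF Cauchy_add[OF X Y]]
        tendsto_add[OF completion_norm_tendsto[OF X] completion_norm_tendsto[OF Y]]] X Y
    by (auto simp: completion_add p_triangle Cauchy_closed)
  moreover have "completion_norm p (c \<odot>\<^bsub>C\<^esub> Cls X) = cmod c * completion_norm p (Cls X)"
    if X: "seminorm_Cauchy A p X" for X c
    using completion_norm_tendsto[OF Cauchy_scale[OF X], of c]
      tendsto_mult_left[OF completion_norm_tendsto[OF X], of "cmod c"] X
    by (auto simp: completion_scale p_scale Cauchy_closed intro: LIMSEQ_unique)
  ultimately show ?thesis
    by (auto simp: seminorm_on_def seminorm_on_axioms_def completion_simps completion_norm_nonneg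
        elim!: completion_carrierE)
qed

text \<open>
  A Cauchy sequence in the completion is shadowed by elements \<open>x n\<close> of the algebra at distance less
  than \<open>1 / (n + 1)\<close>. These form a Cauchy sequence in the algebra, whose class is the limit.
\<close>

lemma completion_complete:
  assumes "seminorm_Cauchy C (completion_norm p) \<Xi>"
  shows "\<exists>L\<in>carrier C. (\<lambda>n. completion_norm p (\<Xi> n \<ominus>\<^bsub>C\<^esub> L)) \<longlonglongrightarrow> 0"
proof -
  interpret C: seminorm_on C "completion_norm p" by (rule completion_seminorm)
  have \<Xi>: "\<Xi> n \<in> carrier C" for n using assms by (rule C.Cauchy_closed)
  have "\<exists>x\<in>carrier A. completion_norm p (\<Xi> n \<ominus>\<^bsub>C\<^esub> Cls (\<lambda>_. x)) < 1 / Suc n" for n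
  proof -
    obtain X where X: "seminorm_Cauchy A p X" "\<Xi> n = Cls X"
      using \<Xi>[of n] by (auto simp: completion_simps elim: completion_carrierE)
    have "eventually (\<lambda>m. completion_norm p (Cls X \<ominus>\<^bsub>C\<^esub> Cls (\<lambda>_. X m)) < 1 / Suc n) sequentially"
      by (rule order_tendstoD(2)[OF embed_dense[OF X(1)]]) simp
    then show ?thesis using X by (auto simp: Cauchy_closed eventually_sequentially)
  qed
  then obtain x where x: "\<And>n. x n \<in> carrier A"
    and close: "\<And>n. completion_norm p (\<Xi> n \<ominus>\<^bsub>C\<^esub> Cls (\<lambda>_. x n)) < 1 / Suc n" by metis
  have ex: "Cls (\<lambda>_. x n) \<in> carrier C" for n by (simp add: completion_simps Cls_in_carrier Cauchy_const x)
  have p_eq: "p (x m \<ominus> x n) = completion_norm p (Cls (\<lambda>_. x m) \<ominus>\<^bsub>C\<^esub> Cls (\<lambda>_. x n))" for m n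
    by (simp add: completion_diff Cauchy_const x completion_norm_embed closed)
  have Cx: "seminorm_Cauchy A p x"
    unfolding seminorm_Cauchy_def
  proof (intro conjI allI impI)
    fix e :: real assume "0 < e"
    then have "0 < e / 3" by simp
    then obtain N where N: "\<And>m n. m \<ge> N \<Longrightarrow> n \<ge> N \<Longrightarrow> completion_norm p (\<Xi> m \<ominus>\<^bsub>C\<^esub> \<Xi> n) < e / 3"
      using assms unfolding seminorm_Cauchy_def by blast
    obtain M :: nat where M: "1 / Suc M < e / 3" using nat_approx_posE[OF \<open>0 < e / 3\<close>] by blast
    have small: "completion_norm p (\<Xi> n \<ominus>\<^bsub>C\<^esub> Cls (\<lambda>_. x n)) < e / 3" if "n \<ge> M" for n
    proof -
      have "1 / real (Suc n) \<le> 1 / Suc M" using that by (simp add: frac_le)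
      then show ?thesis using close[of n] M by linarith
    qed
    have "p (x m \<ominus> x n) < e" if "m \<ge> max M N" "n \<ge> max M N" for m n
      using C.p_diff_triangle[OF ex[of m] \<Xi>[of m] ex[of n]] C.p_diff_triangle[OF \<Xi>[of m] \<Xi>[of n] ex[of n]]
        C.p_diff_swap[OF ex[of m] \<Xi>[of m]] small[of m] small[of n] N[of m n] that
      by (simp add: p_eq)
    then show "\<exists>N. \<forall>m\<ge>N. \<forall>n\<ge>N. p (x m \<ominus> x n) < e" by blast
  qed (simp add: x)
  have L: "Cls x \<in> carrier C" by (simp add: completion_simps Cls_in_carrier Cx)
  have "(\<lambda>n. 1 / real (Suc n) + completion_norm p (Cls x \<ominus>\<^bsub>C\<^esub> Cls (\<lambda>_. x n))) \<longlonglongrightarrow> 0"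
    using LIMSEQ_inverse_real_of_nat embed_dense[OF Cx] by (intro tendsto_add_zero) (simp_all add: inverse_eq_divide)
  moreover have "completion_norm p (\<Xi> n \<ominus>\<^bsub>C\<^esub> Cls x)
      \<le> 1 / real (Suc n) + completion_norm p (Cls x \<ominus>\<^bsub>C\<^esub> Cls (\<lambda>_. x n))" for n
    using C.p_diff_triangle[OF \<Xi>[of n] ex[of n] L] C.p_diff_swap[OF ex[of n] L] close[of n] by simp
  ultimately have "(\<lambda>n. completion_norm p (\<Xi> n \<ominus>\<^bsub>C\<^esub> Cls x)) \<longlonglongrightarrow> 0"
    by (intro C.null_le) (simp_all add: C.closed \<Xi> L)
  then show ?thesis using L by blast
qed

theorem completion_cstar_algebra: "cstar_algebra C"
proof -
  interpret C: seminorm_on C "completion_norm p" by (rule completion_seminorm)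
  have zero: "completion_norm p (Cls X) = 0 \<longleftrightarrow> Cls X = Cls (\<lambda>_. \<zero>)" if X: "seminorm_Cauchy A p X" for X
  proof -
    have "Cls X = Cls (\<lambda>_. \<zero>) \<longleftrightarrow> (\<lambda>n. p (X n)) \<longlonglongrightarrow> 0"
      using X by (simp add: Cls_eq Cauchy_const zero_closed diff_zero Cauchy_closed)
    then show ?thesis using completion_norm_tendsto[OF X] LIMSEQ_unique by metis
  qed
  have mult: "completion_norm p (Cls X \<otimes>\<^bsub>C\<^esub> Cls Y) \<le> completion_norm p (Cls X) * completion_norm p (Cls Y)"
    if X: "seminorm_Cauchy A p X" and Y: "seminorm_Cauchy A p Y" for X Y
    using LIMSEQ_le[OF completion_norm_tendsto[OF Cauchy_mult[OF X Y]]
        tendsto_mult[OF completion_norm_tendsto[OF X] completion_norm_tendsto[OF Y]]] X Y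
    by (auto simp: completion_mult p_mult Cauchy_closed)
  have cstar: "completion_norm p (astar C (Cls X) \<otimes>\<^bsub>C\<^esub> Cls X) = (completion_norm p (Cls X))\<^sup>2"
    if X: "seminorm_Cauchy A p X" for X
    using completion_norm_tendsto[OF Cauchy_mult[OF Cauchy_star[OF X] X]]
      tendsto_power[OF completion_norm_tendsto[OF X], of 2] X
    by (auto simp: completion_rules Cauchy_star p_cstar Cauchy_closed intro: LIMSEQ_unique)
  show ?thesis
    using completion_complete
    by (intro cstar_algebra.intro C.star_algebra_axioms cstar_algebra_axioms.intro)
      (auto simp: completion_simps zero mult cstar completion_norm_nonneg completion_norm_embed zero_closed p_zero C.p_triangle C.p_scale
        elim!: completion_carrierE intro: C.p_triangle[unfolded completion_simps] Cls_in_carrier)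
qed

definition completion_map where
  "completion_map \<theta> = quot_lift (completion_rel A p) (\<lambda>X n. \<theta> (X n))"

lemma isometric_automorphism_lipschitz:
  assumes "star_automorphism A \<theta>" "\<And>x. x \<in> carrier A \<Longrightarrow> p (\<theta> x) = p x"
  shows "lipschitz \<theta>"
  unfolding lipschitz_def
proof (intro conjI exI[of _ 1] ballI)
  fix x y assume "x \<in> carrier A" "y \<in> carrier A"
  then show "p (\<theta> x \<ominus> \<theta> y) \<le> 1 * p (x \<ominus> y)"
    using assms by (simp add: star_automorphism_diff[symmetric] closed)
qed (use assms(1) in \<open>auto simp: star_automorphism_def bij_betw_def\<close>)

text \<open>
  The extended map is bijective because it is its own inverse, and the remaining identities hold
  term by term.
\<close>

theorem completion_map_automorphism:
  assumes aut: "star_automorphism A \<theta>"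
    and iso: "\<And>x. x \<in> carrier A \<Longrightarrow> p (\<theta> x) = p x"
    and inv: "\<And>x. x \<in> carrier A \<Longrightarrow> \<theta> (\<theta> x) = x"
  shows "star_automorphism C (completion_map \<theta>)"
    and "\<And>\<xi>. \<xi> \<in> carrier C \<Longrightarrow> completion_map \<theta> (completion_map \<theta> \<xi>) = \<xi>"
    and "\<And>x. x \<in> carrier A \<Longrightarrow>
      completion_map \<theta> (completion_embed A p x) = completion_embed A p (\<theta> x)"
proof -
  have lip: "lipschitz \<theta>" using aut iso by (rule isometric_automorphism_lipschitz)
  note map = lipschitz_lift(2)[OF lip, folded completion_map_def] and C = lipschitz_lift(1)[OF lip]
  note hom = aut[unfolded star_automorphism_def]
  show inv': "completion_map \<theta> (completion_map \<theta> \<xi>) = \<xi>" if "\<xi> \<in> carrier C" for \<xi>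
    using that by (auto simp: completion_simps map C inv Cauchy_closed elim!: completion_carrierE)
  have closed': "completion_map \<theta> \<xi> \<in> carrier C" if "\<xi> \<in> carrier C" for \<xi>
    using that by (auto simp: completion_simps map C Cls_in_carrier elim!: completion_carrierE)
  have "bij_betw (completion_map \<theta>) (carrier C) (carrier C)"
    by (rule bij_betw_byWitness[where f' = "completion_map \<theta>"]) (auto simp: inv' closed')
  then show "star_automorphism C (completion_map \<theta>)"
    unfolding star_automorphism_def
    by (auto simp: completion_simps completion_rules Cauchy_rules map C Cauchy_closed hom
        elim!: completion_carrierE)
  show "completion_map \<theta> (completion_embed A p x) = completion_embed A p (\<theta> x)"
    if "x \<in> carrier A" for x
    using map[OF Cauchy_const[OF that]] by (simp add: completion_embed_def)
qed

end

section \<open>Automatic continuity of \<open>*\<close>-automorphisms\<close>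

sublocale cstar_algebra \<subseteq> cstar_seminorm A "anorm A"
  by unfold_locales (simp_all add: norm_nonneg norm_triangle norm_scale norm_mult cstar_identity)

context cstar_algebra
begin

lemma limit_unique:
  assumes X: "\<And>n. X n \<in> carrier A" and xy: "x \<in> carrier A" "y \<in> carrier A"
    and lim: "(\<lambda>n. anorm A (X n \<ominus> x)) \<longlonglongrightarrow> 0" "(\<lambda>n. anorm A (X n \<ominus> y)) \<longlonglongrightarrow> 0"
  shows "x = y"
proof -
  have "anorm A (x \<ominus> y) \<le> anorm A (X n \<ominus> x) + anorm A (X n \<ominus> y)" for n
    using p_diff_triangle[of x "X n" y] p_diff_swap[of x "X n"] X xy by simp
  moreover have "(\<lambda>n. anorm A (X n \<ominus> x) + anorm A (X n \<ominus> y)) \<longlonglongrightarrow> 0"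
    using lim by (rule tendsto_add_zero)
  ultimately have "anorm A (x \<ominus> y) \<le> 0"
    by (intro LIMSEQ_le_const) auto
  then have "x \<ominus> y = \<zero>"
    using xy p_nonneg[of "x \<ominus> y"] norm_eq_zero[of "x \<ominus> y"] by (simp add: closed)
  with xy show ?thesis by (rule diff_eq_zero)
qed

text \<open>
  The element \<open>s\<close> is \<open>1 - sqrt (1 - h\<^sup>2)\<close> in disguise: the equation says \<open>(1 - s)\<^sup>2 = 1 - h\<^sup>2\<close>, written
  without a unit. It is the fixed point of \<open>s \<mapsto> (h\<^sup>2 + s\<^sup>2) / 2\<close>, which for \<open>\<parallel>h\<parallel> \<le> 1/2\<close> maps the ball of
  radius \<open>1/4\<close> to itself and contracts it by the factor \<open>1/4\<close>. The iterates are polynomials in \<open>h\<close>,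
  so they are self-adjoint and commute with \<open>h\<close>, and the limit inherits both properties.
\<close>

lemma commuting_root:
  assumes h: "h \<in> carrier A" "astar A h = h" "anorm A h \<le> 1 / 2"
  obtains s where "s \<in> carrier A" "astar A s = s" "s \<otimes> h = h \<otimes> s" "h \<otimes> h \<oplus> s \<otimes> s = 2 \<odot> s"
proof -
  let ?f = "\<lambda>s. (1/2) \<odot> (h \<otimes> h \<oplus> s \<otimes> s)"
  define S where "S n = (?f ^^ n) \<zero>" for n
  have S0: "S 0 = \<zero>" and SS: "S (Suc n) = ?f (S n)" for n by (simp_all add: S_def)
  have SC: "S n \<in> carrier A" for n
    by (induction n) (simp_all add: S0 SS closed h)
  have star: "astar A (S n) = S n" for n
    by (induction n) (simp_all add: S0 SS closed h SC star_zero star_scale star_add star_mult)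
  have comm: "S n \<otimes> h = h \<otimes> S n" for n
  proof (induction n)
    case 0
    have "\<zero> \<otimes> h = 0 \<odot> (\<zero> \<otimes> h)" "h \<otimes> \<zero> = 0 \<odot> (h \<otimes> \<zero>)"
      using mult_scale_left[of \<zero> h 0] mult_scale_right[of h \<zero> 0] h by (simp_all add: scale_zero_right zero_closed)
    then show ?case using h by (simp add: S0 scale_zero closed)
  next
    case (Suc n)
    have "S n \<otimes> S n \<otimes> h = h \<otimes> (S n \<otimes> S n)"
      using Suc h SC by (metis mult_assoc)
    then show ?case
      by (simp add: SS closed h SC mult_scale_left mult_scale_right mult_add_left mult_add_right mult_assoc)
  qed
  have bound: "anorm A (S n) \<le> 1 / 4" for n
  proof (induction n)
    case 0 show ?case by (simp add: S0 p_zero)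
  next
    case (Suc n)
    have "anorm A (S (Suc n)) = 1 / 2 * anorm A (h \<otimes> h \<oplus> S n \<otimes> S n)"
      by (simp add: SS p_scale closed h SC)
    also have "\<dots> \<le> 1 / 2 * (anorm A h * anorm A h + anorm A (S n) * anorm A (S n))"
      using p_triangle[of "h \<otimes> h" "S n \<otimes> S n"] p_mult[of h h] p_mult[of "S n" "S n"]
      by (simp add: closed h SC)
    also have "\<dots> \<le> 1 / 2 * (1 / 2 * (1 / 2) + 1 / 4 * (1 / 4))"
      using Suc h by (intro mult_left_mono add_mono mult_mono) (simp_all add: p_nonneg SC)
    finally show ?case by simp
  qed
  have step: "anorm A (S (Suc n) \<ominus> ?f s) \<le> 1 / 2 * (1 / 4 + K) * anorm A (S n \<ominus> s)"
    if s: "s \<in> carrier A" "anorm A s \<le> K" for n s K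
  proof -
    have "S (Suc n) \<ominus> ?f s = (1/2) \<odot> (S n \<otimes> S n \<ominus> s \<otimes> s)"
      using s by (simp add: SS scale_diff[symmetric] add_diff_add closed h SC diff_self zero_add)
    moreover have "anorm A (S n \<otimes> S n \<ominus> s \<otimes> s) \<le> 1 / 4 * anorm A (S n \<ominus> s) + K * anorm A (S n \<ominus> s)"
      using s bound[of n] by (intro p_mult_diff) (simp_all add: SC)
    ultimately show ?thesis using s by (simp add: p_scale closed SC algebra_simps)
  qed
  \<comment> \<open>A bound on all pairs beyond \<open>N\<close> at once yields the Cauchy property without a telescoping sum.\<close>
  have contract: "anorm A (S m \<ominus> S n) \<le> (1 / 4) ^ N" if "m \<ge> N" "n \<ge> N" for m n N
    using that
  proof (induction N arbitrary: m n)
    case 0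
    show ?case
      using p_diff_triangle[of "S m" \<zero> "S n"] p_diff_swap[of \<zero> "S n"] bound[of m] bound[of n]
      by (simp add: SC closed diff_zero)
  next
    case (Suc N)
    then obtain m' n' where mn: "m = Suc m'" "n = Suc n'" "N \<le> m'" "N \<le> n'"
      by (metis Suc_le_D Suc_le_mono)
    have "anorm A (S m \<ominus> S n) \<le> 1 / 4 * anorm A (S m' \<ominus> S n')"
      using step[OF SC bound, of m' n'] by (simp add: mn SS)
    then show ?case using Suc.IH[OF mn(3,4)] by simp
  qed
  have "seminorm_Cauchy A (anorm A) S"
    unfolding seminorm_Cauchy_def
  proof (intro conjI allI impI)
    fix e :: real assume "0 < e"
    then obtain N where "(1 / 4) ^ N < e" using real_arch_pow_inv[of e "1/4"] by auto
    then show "\<exists>N. \<forall>m\<ge>N. \<forall>n\<ge>N. anorm A (S m \<ominus> S n) < e"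
      using contract by (meson le_less_trans)
  qed (simp add: SC)
  then obtain s where s: "s \<in> carrier A" and lim: "(\<lambda>n. anorm A (S n \<ominus> s)) \<longlonglongrightarrow> 0"
    using complete by blast
  have "astar A s = s"
  proof (rule limit_unique[of S])
    have "anorm A (S n \<ominus> astar A s) = anorm A (S n \<ominus> s)" for n
      using p_star[of "S n \<ominus> s"] s by (simp add: star_diff star SC closed)
    then show "(\<lambda>n. anorm A (S n \<ominus> astar A s)) \<longlonglongrightarrow> 0" using lim by simp
  qed (simp_all add: SC s closed lim)
  moreover have "s \<otimes> h = h \<otimes> s"
  proof (rule limit_unique[of "\<lambda>n. S n \<otimes> h"])
    have "anorm A (S n \<otimes> h \<ominus> s \<otimes> h) \<le> anorm A h * anorm A (S n \<ominus> s)" for n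
      using p_mult[of "S n \<ominus> s" h] s h by (simp add: mult_diff_left SC closed mult.commute)
    then show "(\<lambda>n. anorm A (S n \<otimes> h \<ominus> s \<otimes> h)) \<longlonglongrightarrow> 0"
      using lim s h by (intro null_le[OF _ _ tendsto_mult_right_zero]) (simp_all add: SC closed)
    have "anorm A (S n \<otimes> h \<ominus> h \<otimes> s) \<le> anorm A h * anorm A (S n \<ominus> s)" for n
      using p_mult[of h "S n \<ominus> s"] s h by (simp add: mult_diff_right SC closed comm)
    then show "(\<lambda>n. anorm A (S n \<otimes> h \<ominus> h \<otimes> s)) \<longlonglongrightarrow> 0"
      using lim s h by (intro null_le[OF _ _ tendsto_mult_right_zero]) (simp_all add: SC closed)
  qed (simp_all add: SC s closed h)
  moreover have "s = ?f s"
  proof (rule limit_unique[of "\<lambda>n. S (Suc n)"])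
    show "(\<lambda>n. anorm A (S (Suc n) \<ominus> s)) \<longlonglongrightarrow> 0" using lim by (rule LIMSEQ_Suc)
    show "(\<lambda>n. anorm A (S (Suc n) \<ominus> ?f s)) \<longlonglongrightarrow> 0"
      using lim s by (intro null_le[OF _ step[OF s order_refl] tendsto_mult_right_zero]) (simp_all add: SC closed h)
  qed (simp_all add: SC s closed h)
  then have "2 \<odot> s = 2 \<odot> ?f s" by (rule arg_cong)
  then have "h \<otimes> h \<oplus> s \<otimes> s = 2 \<odot> s"
    using s h by (simp add: scale_scale scale_one closed)
  ultimately show thesis using s that by blast
qed

text \<open>
  With \<open>s\<close> as above, put \<open>z = s + \<i>h\<close>. In the unitization \<open>1 - z\<close> is unitary, since
  \<open>(1 - z)\<^sup>*(1 - z) = (1 - s)\<^sup>2 + h\<^sup>2 = 1\<close>; expanded, this is a relation inside the algebra itself.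
  So every small self-adjoint element is the imaginary part of some \<open>z\<close> satisfying a purely algebraic
  relation, which is preserved by \<open>*\<close>-homomorphisms.
\<close>

lemma unitary_defect:
  assumes h: "h \<in> carrier A" "astar A h = h" "anorm A h \<le> 1 / 2"
  obtains z where "z \<in> carrier A" "astar A z \<otimes> z = z \<oplus> astar A z" "z \<ominus> astar A z = (2 * \<i>) \<odot> h"
proof -
  obtain s where s: "s \<in> carrier A" "astar A s = s" "s \<otimes> h = h \<otimes> s" "h \<otimes> h \<oplus> s \<otimes> s = 2 \<odot> s"
    using commuting_root[OF h] by blast
  let ?z = "s \<oplus> \<i> \<odot> h"
  have st: "astar A ?z = s \<oplus> (- \<i>) \<odot> h" using s h by (simp add: star_add star_scale closed)
  have cancel: "\<i> \<odot> y \<oplus> (- \<i>) \<odot> y = \<zero>" if "y \<in> carrier A" for y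
    using that by (simp add: scale_add_left[symmetric] scale_zero)
  have "astar A ?z \<otimes> ?z = (h \<otimes> h \<oplus> s \<otimes> s) \<oplus> (\<i> \<odot> (h \<otimes> s) \<oplus> (- \<i>) \<odot> (h \<otimes> s))"
    using s(1-3) h by (simp only: st) (simp add: scale_add_right mult_add_left mult_add_right mult_scale_left mult_scale_right
        closed scale_scale scale_one add_assoc add_comm add_left_comm)
  also have "\<dots> = 2 \<odot> s" using s h by (simp add: cancel closed add_zero)
  finally have 1: "astar A ?z \<otimes> ?z = 2 \<odot> s" .
  have "?z \<oplus> astar A ?z = (s \<oplus> s) \<oplus> (\<i> \<odot> h \<oplus> (- \<i>) \<odot> h)"
    unfolding st using s h by (intro add_swap) (simp_all add: closed)
  also have "\<dots> = (1 + 1) \<odot> s"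
    using s h by (simp only: cancel scale_add_left scale_one) (simp add: add_zero closed)
  finally have 2: "?z \<oplus> astar A ?z = 2 \<odot> s" by simp
  have "?z \<ominus> astar A ?z = (\<i> + \<i>) \<odot> h"
    unfolding st using s h by (simp only: add_diff_add closed diff_self scale_add_left)
      (simp add: adiff_def closed scale_scale zero_add)
  then have 3: "?z \<ominus> astar A ?z = (2 * \<i>) \<odot> h" by simp
  show thesis using that[of ?z] 1 2 3 s h by (simp add: closed)
qed

text \<open>
  Automatic continuity. The relation \<open>z\<^sup>*z = z + z\<^sup>*\<close> is preserved by \<open>\<theta>\<close> and forces \<open>\<parallel>z\<parallel>\<^sup>2 \<le> 2\<parallel>z\<parallel>\<close>,
  hence \<open>\<parallel>z\<parallel> \<le> 2\<close>. Thus the images of self-adjoint elements of norm at most \<open>1/2\<close>, being imaginary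
  parts of such \<open>\<theta> z\<close>, have norm at most \<open>2\<close>. The $C^*$-identity passes from \<open>x\<^sup>*x\<close> to arbitrary \<open>x\<close>.
  The constant \<open>2\<close> is not optimal (it is \<open>1\<close>), but any constant gives continuity.
\<close>

theorem star_automorphism_bounded:
  assumes aut: "star_automorphism A \<theta>" and x: "x \<in> carrier A"
  shows "anorm A (\<theta> x) \<le> 2 * anorm A x"
proof -
  have \<theta>: "\<And>x. x \<in> carrier A \<Longrightarrow> \<theta> x \<in> carrier A"
    and add: "\<And>x y. x \<in> carrier A \<Longrightarrow> y \<in> carrier A \<Longrightarrow> \<theta> (x \<oplus> y) = \<theta> x \<oplus> \<theta> y"
    and scale: "\<And>c x. x \<in> carrier A \<Longrightarrow> \<theta> (c \<odot> x) = c \<odot> \<theta> x"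
    and mult: "\<And>x y. x \<in> carrier A \<Longrightarrow> y \<in> carrier A \<Longrightarrow> \<theta> (x \<otimes> y) = \<theta> x \<otimes> \<theta> y"
    and star: "\<And>x. x \<in> carrier A \<Longrightarrow> \<theta> (astar A x) = astar A (\<theta> x)"
    using aut by (auto simp: star_automorphism_def bij_betw_def)
  have small: "anorm A (\<theta> h) \<le> 2" if h: "h \<in> carrier A" "astar A h = h" "anorm A h \<le> 1 / 2" for h
  proof -
    obtain z where z: "z \<in> carrier A" "astar A z \<otimes> z = z \<oplus> astar A z" "z \<ominus> astar A z = (2 * \<i>) \<odot> h"
      using unitary_defect[OF h] by blast
    let ?w = "\<theta> z"
    have w: "?w \<in> carrier A" "astar A ?w \<otimes> ?w = ?w \<oplus> astar A ?w" "?w \<ominus> astar A ?w = (2 * \<i>) \<odot> \<theta> h"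
      using z h by (metis \<theta> add scale mult star star_closed star_automorphism_diff[OF aut])+
    have "(anorm A ?w)\<^sup>2 \<le> 2 * anorm A ?w"
      using p_cstar[OF w(1)] p_triangle[of ?w "astar A ?w"] w by (simp add: p_star closed)
    then have "anorm A ?w \<le> 2" using p_nonneg[OF w(1)] by (simp add: power2_eq_square)
        (metis mult_le_cancel_right order_le_less zero_le_numeral)
    moreover have "2 * anorm A (\<theta> h) = anorm A (?w \<ominus> astar A ?w)"
      using h by (simp add: w(3) p_scale \<theta> norm_mult)
    moreover have "anorm A (?w \<ominus> astar A ?w) \<le> anorm A ?w + anorm A ?w"
      using p_triangle[of ?w "(-1) \<odot> astar A ?w"] w(1) by (simp add: adiff_def closed p_scale p_star)
    ultimately show ?thesis by simp
  qed
  have selfadjoint: "anorm A (\<theta> h) \<le> 4 * anorm A h" if h: "h \<in> carrier A" "astar A h = h" for h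
  proof (cases "anorm A h = 0")
    case True
    then have "h = 0 \<odot> h" using norm_eq_zero h by (simp add: scale_zero)
    then have "\<theta> h = 0 \<odot> \<theta> h" using scale h(1) by metis
    then show ?thesis using h True by (simp add: scale_zero \<theta> p_zero)
  next
    case False
    then have pos: "0 < anorm A h" using p_nonneg[OF h(1)] by simp
    \<comment> \<open>Rescale to norm \<open>1/2\<close>.\<close>
    let ?c = "complex_of_real (1 / (2 * anorm A h))"
    have "anorm A (\<theta> (?c \<odot> h)) \<le> 2"
      using h pos by (intro small) (simp_all add: closed star_scale p_scale norm_divide norm_mult)
    then show ?thesis using h pos by (simp add: scale p_scale \<theta> norm_divide norm_mult field_simps)
  qed
  have "(anorm A (\<theta> x))\<^sup>2 = anorm A (\<theta> (astar A x \<otimes> x))"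
    using x by (simp add: p_cstar[symmetric] \<theta> mult star closed)
  also have "\<dots> \<le> 4 * anorm A (astar A x \<otimes> x)"
    using x by (intro selfadjoint) (simp_all add: closed star_mult star_star)
  also have "\<dots> = (2 * anorm A x)\<^sup>2" using x by (simp add: p_cstar power_mult_distrib)
  finally show ?thesis by (rule power2_le_imp_le) (simp add: p_nonneg x)
qed

lemma star_automorphisms_agree_limit:
  assumes "star_automorphism A \<theta>" "star_automorphism A \<theta>'"
    and X: "\<And>n. X n \<in> carrier A" "x \<in> carrier A" "(\<lambda>n. anorm A (x \<ominus> X n)) \<longlonglongrightarrow> 0"
    and agree: "\<And>n. \<theta> (X n) = \<theta>' (X n)"
  shows "\<theta> x = \<theta>' x"
proof -
  have closed': "\<phi> y \<in> carrier A" if "star_automorphism A \<phi>" "y \<in> carrier A" for \<phi> y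
    using that by (auto simp: star_automorphism_def bij_betw_def)
  have lim: "(\<lambda>n. anorm A (\<phi> (X n) \<ominus> \<phi> x)) \<longlonglongrightarrow> 0" if "star_automorphism A \<phi>" for \<phi>
  proof (rule null_le)
    show "anorm A (\<phi> (X n) \<ominus> \<phi> x) \<le> 2 * anorm A (x \<ominus> X n)" for n
      using star_automorphism_bounded[OF that, of "X n \<ominus> x"] X p_diff_swap[of x "X n"]
      by (simp add: star_automorphism_diff[OF that] closed)
    show "(\<lambda>n. 2 * anorm A (x \<ominus> X n)) \<longlonglongrightarrow> 0" using X by (intro tendsto_mult_right_zero)
  qed (use X that in \<open>simp add: closed closed'\<close>)
  show ?thesis
    by (rule limit_unique[of "\<lambda>n. \<theta> (X n)"])
      (use X assms(1,2) lim[OF assms(1)] lim[OF assms(2)] in \<open>simp_all add: agree closed'\<close>)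
qed

end

section \<open>Positive forms and the GNS construction\<close>

definition linear_on :: "('a, 'm) star_algebra_scheme \<Rightarrow> ('a \<Rightarrow> complex) \<Rightarrow> bool" where
  "linear_on A f \<longleftrightarrow> (\<forall>x\<in>carrier A. \<forall>y\<in>carrier A. f (x \<oplus>\<^bsub>A\<^esub> y) = f x + f y) \<and>
     (\<forall>c. \<forall>x\<in>carrier A. f (c \<odot>\<^bsub>A\<^esub> x) = c * f x)"

text \<open>
  Conjugate linear in the first argument, as for the inner product \<open>\<omega> (x\<^sup>*y)\<close> of the GNS construction.
\<close>

definition sesquilinear_on :: "('a, 'm) star_algebra_scheme \<Rightarrow> ('a \<Rightarrow> 'a \<Rightarrow> complex) \<Rightarrow> bool" where
  "sesquilinear_on A q \<longleftrightarrow> (\<forall>x\<in>carrier A. linear_on A (q x)) \<and>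
     (\<forall>y\<in>carrier A. linear_on A (\<lambda>x. cnj (q x y)))"

definition positive_form :: "('a, 'm) star_algebra_scheme \<Rightarrow> ('a \<Rightarrow> 'a \<Rightarrow> complex) \<Rightarrow> bool" where
  "positive_form A q \<longleftrightarrow> sesquilinear_on A q \<and> (\<forall>x\<in>carrier A. q x x \<in> \<real>\<^sub>\<ge>\<^sub>0)"

definition positive_functional :: "('a, 'm) star_algebra_scheme \<Rightarrow> ('a \<Rightarrow> complex) \<Rightarrow> bool" where
  "positive_functional A \<omega> \<longleftrightarrow> linear_on A \<omega> \<and> (\<forall>x\<in>carrier A. \<omega> (astar A x \<otimes>\<^bsub>A\<^esub> x) \<in> \<real>\<^sub>\<ge>\<^sub>0)"

definition form_norm :: "('a \<Rightarrow> 'a \<Rightarrow> complex) \<Rightarrow> 'a \<Rightarrow> real" where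
  "form_norm q x = sqrt (Re (q x x))"

text \<open>
  The scalar core of the Cauchy--Schwarz inequality, shared by sesquilinear forms on an algebra and by
  positive semidefinite kernels on a finite set.
\<close>

lemma nonneg_quadratic:
  fixes a b b' c :: complex
  assumes nonneg: "\<And>t. a + t * b + cnj t * b' + cnj t * t * c \<in> \<real>\<^sub>\<ge>\<^sub>0"
    and a: "a \<in> \<real>\<^sub>\<ge>\<^sub>0" and c: "c \<in> \<real>\<^sub>\<ge>\<^sub>0"
  shows "b' = cnj b" and "(cmod b)\<^sup>2 \<le> Re a * Re c"
proof -
  show herm: "b' = cnj b"
    using nonneg[of 1] nonneg[of \<i>] a c by (simp add: complex_nonneg_Reals_iff complex_eq_iff)
  \<comment> \<open>Choosing \<open>t\<close> opposite in phase to \<open>b\<close> leaves a real quadratic in \<open>r\<close>, minimal at \<open>r = 1 / Re c\<close>.\<close>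
  have ineq: "0 \<le> Re a - 2 * r * (cmod b)\<^sup>2 + r\<^sup>2 * (cmod b)\<^sup>2 * Re c" for r
    using nonneg[of "- of_real r * cnj b"] c unfolding herm cmod_power2
    by (simp add: complex_nonneg_Reals_iff power2_eq_square algebra_simps)
  show "(cmod b)\<^sup>2 \<le> Re a * Re c"
  proof (cases "Re c = 0")
    case True
    have "(cmod b)\<^sup>2 = 0"
    proof (rule ccontr)
      assume "(cmod b)\<^sup>2 \<noteq> 0"
      then show False
        using ineq[of "(Re a + 1) / (2 * (cmod b)\<^sup>2)"] True by (simp add: field_simps)
    qed
    then show ?thesis using True by simp
  next
    case False
    then have "Re c > 0" using c by (simp add: complex_nonneg_Reals_iff)
    then show ?thesis using ineq[of "1 / Re c"] by (simp add: field_simps power2_eq_square)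
  qed
qed

context star_algebra
begin

context
  fixes q assumes q: "positive_form A q"
begin

lemma form_add_right:
  "\<lbrakk>x \<in> carrier A; y \<in> carrier A; z \<in> carrier A\<rbrakk> \<Longrightarrow> q x (y \<oplus> z) = q x y + q x z"
  using q by (simp add: positive_form_def sesquilinear_on_def linear_on_def)

lemma form_scale_right: "\<lbrakk>x \<in> carrier A; y \<in> carrier A\<rbrakk> \<Longrightarrow> q x (c \<odot> y) = c * q x y"
  using q by (simp add: positive_form_def sesquilinear_on_def linear_on_def)

lemma form_add_left:
  assumes "x \<in> carrier A" "y \<in> carrier A" "z \<in> carrier A"
  shows "q (x \<oplus> y) z = q x z + q y z"
proof -
  have "cnj (q (x \<oplus> y) z) = cnj (q x z + q y z)"
    using q assms by (simp add: positive_form_def sesquilinear_on_def linear_on_def)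
  then show ?thesis by (simp only: complex_cnj_cancel_iff)
qed

lemma form_scale_left:
  assumes "x \<in> carrier A" "y \<in> carrier A"
  shows "q (c \<odot> x) y = cnj c * q x y"
proof -
  have "cnj (q (c \<odot> x) y) = cnj (cnj c * q x y)"
    using q assms by (simp add: positive_form_def sesquilinear_on_def linear_on_def)
  then show ?thesis by (simp only: complex_cnj_cancel_iff)
qed

lemma form_positive: "x \<in> carrier A \<Longrightarrow> Re (q x x) \<ge> 0 \<and> Im (q x x) = 0"
  using q by (auto simp: positive_form_def complex_nonneg_Reals_iff)

lemma form_expand:
  "\<lbrakk>x \<in> carrier A; y \<in> carrier A\<rbrakk> \<Longrightarrow>
     q (x \<oplus> t \<odot> y) (x \<oplus> t \<odot> y) = q x x + t * q x y + cnj t * q y x + cnj t * t * q y y"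
  by (simp add: form_add_left form_add_right form_scale_left form_scale_right closed algebra_simps)

lemma form_quadratic:
  assumes "x \<in> carrier A" "y \<in> carrier A"
  shows "q x x + t * q x y + cnj t * q y x + cnj t * t * q y y \<in> \<real>\<^sub>\<ge>\<^sub>0"
    and "q x x \<in> \<real>\<^sub>\<ge>\<^sub>0" "q y y \<in> \<real>\<^sub>\<ge>\<^sub>0"
  using q assms by (simp_all add: form_expand[symmetric] closed positive_form_def)

lemma form_hermitian: "\<lbrakk>x \<in> carrier A; y \<in> carrier A\<rbrakk> \<Longrightarrow> q y x = cnj (q x y)"
  by (rule nonneg_quadratic(1)[OF form_quadratic])

lemma form_norm_square: "x \<in> carrier A \<Longrightarrow> (form_norm q x)\<^sup>2 = Re (q x x)"
  by (simp add: form_norm_def form_positive)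

lemma form_Cauchy_Schwarz:
  assumes x: "x \<in> carrier A" and y: "y \<in> carrier A"
  shows "cmod (q x y) \<le> form_norm q x * form_norm q y"
proof -
  have "(cmod (q x y))\<^sup>2 \<le> Re (q x x) * Re (q y y)"
    by (rule nonneg_quadratic(2)[OF form_quadratic[OF x y]])
  then have "(cmod (q x y))\<^sup>2 \<le> (form_norm q x * form_norm q y)\<^sup>2"
    by (simp add: power_mult_distrib form_norm_square x y)
  then show ?thesis
    by (rule power2_le_imp_le) (simp add: form_norm_def form_positive x y)
qed

lemma form_seminorm: "seminorm_on A (form_norm q)"
proof
  fix x assume x: "x \<in> carrier A"
  show "0 \<le> form_norm q x" using x by (simp add: form_norm_def form_positive)
  fix c
  have "q (c \<odot> x) (c \<odot> x) = of_real ((cmod c)\<^sup>2) * q x x"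
    using x unfolding complex_norm_square
    by (simp add: form_scale_left form_scale_right closed)
  then show "form_norm q (c \<odot> x) = cmod c * form_norm q x"
    by (simp add: form_norm_def real_sqrt_mult)
next
  fix x y assume xy: "x \<in> carrier A" "y \<in> carrier A"
  have "(form_norm q (x \<oplus> y))\<^sup>2 = Re (q x x) + 2 * Re (q x y) + Re (q y y)"
    using form_expand[of x y 1] form_hermitian[of x y] xy
    by (simp add: form_norm_square closed scale_one)
  also have "\<dots> \<le> (form_norm q x)\<^sup>2 + 2 * (form_norm q x * form_norm q y) + (form_norm q y)\<^sup>2"
    using form_Cauchy_Schwarz[of x y] complex_Re_le_cmod[of "q x y"] xy
    by (simp add: form_norm_square)
  also have "\<dots> = (form_norm q x + form_norm q y)\<^sup>2" by (simp add: power2_sum)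
  finally show "form_norm q (x \<oplus> y) \<le> form_norm q x + form_norm q y"
    by (rule power2_le_imp_le) (simp add: form_norm_def form_positive xy)
qed

end

definition gns_form :: "('a \<Rightarrow> complex) \<Rightarrow> 'a \<Rightarrow> 'a \<Rightarrow> complex" where
  "gns_form \<omega> x y = \<omega> (astar A x \<otimes> y)"

lemma gns_seminorm_eq: "gns_seminorm A \<omega> = form_norm (gns_form \<omega>)"
  by (simp add: fun_eq_iff gns_seminorm_def form_norm_def gns_form_def)

lemma gns_form_mult_left:
  "\<lbrakk>x \<in> carrier A; y \<in> carrier A; z \<in> carrier A\<rbrakk> \<Longrightarrow>
     gns_form \<omega> (x \<otimes> y) z = gns_form \<omega> y (astar A x \<otimes> z)"
  by (simp add: gns_form_def star_mult closed mult_assoc)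

lemma gns_form_sesquilinear: "linear_on A \<omega> \<Longrightarrow> sesquilinear_on A (gns_form \<omega>)"
  unfolding sesquilinear_on_def linear_on_def gns_form_def
  by (auto simp: star_add star_scale closed mult_add_left mult_add_right mult_scale_left mult_scale_right)

lemma sesquilinear_pullback:
  assumes "sesquilinear_on A q" "u \<in> carrier A"
  shows "sesquilinear_on A (\<lambda>x y. q (u \<otimes> x) (u \<otimes> y))"
  using assms unfolding sesquilinear_on_def linear_on_def
  by (simp add: closed mult_add_right mult_scale_right)

context
  fixes \<omega> assumes \<omega>: "positive_functional A \<omega>"
begin

lemma gns_form_positive: "positive_form A (gns_form \<omega>)"
  using \<omega> gns_form_sesquilinear by (simp add: positive_form_def positive_functional_def gns_form_def)

lemma gns_seminorm_on: "seminorm_on A (gns_seminorm A \<omega>)"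
  unfolding gns_seminorm_eq by (rule form_seminorm[OF gns_form_positive])

text \<open>
  The Cauchy--Schwarz inequality for \<open>\<langle>y, x\<^sup>*x y\<rangle> = \<parallel>x y\<parallel>\<^sup>2\<close>. It gives the $C^*$-inequality for operator
  norms on the GNS space, and, iterated, the boundedness of the GNS representation of a state.
\<close>

lemma gns_mult_Cauchy_Schwarz:
  assumes "x \<in> carrier A" "y \<in> carrier A"
  shows "(gns_seminorm A \<omega> (x \<otimes> y))\<^sup>2 \<le> gns_seminorm A \<omega> y * gns_seminorm A \<omega> (astar A x \<otimes> x \<otimes> y)"
proof -
  note form = gns_form_positive
  have "(gns_seminorm A \<omega> (x \<otimes> y))\<^sup>2 = Re (gns_form \<omega> y (astar A x \<otimes> x \<otimes> y))"
    using assms by (simp add: gns_seminorm_eq form_norm_square[OF form] closed gns_form_mult_left mult_assoc)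
  also have "\<dots> \<le> gns_seminorm A \<omega> y * gns_seminorm A \<omega> (astar A x \<otimes> x \<otimes> y)"
    using form_Cauchy_Schwarz[OF form, of y "astar A x \<otimes> x \<otimes> y"] assms
    by (simp add: gns_seminorm_eq closed order_trans[OF complex_Re_le_cmod])
  finally show ?thesis .
qed

text \<open>
  The operator norm on the completed GNS space is determined by the action on the dense subspace
  given by the algebra itself: it is the least \<open>K \<ge> 0\<close> with \<open>\<parallel>x y\<parallel> \<le> K \<parallel>y\<parallel>\<close> there.
\<close>

lemma gns_opnorm_bounds:
  assumes x: "x \<in> carrier A" and K: "\<And>y. y \<in> carrier A \<Longrightarrow> gns_seminorm A \<omega> (x \<otimes> y) \<le> K * gns_seminorm A \<omega> y"
    and K0: "0 \<le> K"
  shows "gns_opnorm A \<omega> x \<le> K"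
    and "y \<in> carrier A \<Longrightarrow> gns_seminorm A \<omega> (x \<otimes> y) \<le> gns_opnorm A \<omega> x * gns_seminorm A \<omega> y"
proof -
  interpret S: seminorm_on A "gns_seminorm A \<omega>" by (rule gns_seminorm_on)
  let ?M = "{completion_norm (gns_seminorm A \<omega>) (gns_rep A \<omega> x \<xi>) |\<xi>.
     \<xi> \<in> gns_space A \<omega> \<and> completion_norm (gns_seminorm A \<omega>) \<xi> \<le> 1}"
  have lip: "S.lipschitz ((\<otimes>) x)"
    unfolding S.lipschitz_def
    by (intro conjI exI[of _ K]) (simp_all add: x closed mult_diff_right[symmetric] K)
  note rep = S.lipschitz_lift(2)[OF lip, folded gns_rep_def] and C = S.lipschitz_lift(1)[OF lip]
  have le: "m \<le> K" if m: "m \<in> ?M" for m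
  proof -
    obtain \<xi> where \<xi>: "\<xi> \<in> gns_space A \<omega>" "completion_norm (gns_seminorm A \<omega>) \<xi> \<le> 1"
      "m = completion_norm (gns_seminorm A \<omega>) (gns_rep A \<omega> x \<xi>)"
      using m by blast
    obtain Y where "seminorm_Cauchy A (gns_seminorm A \<omega>) Y" "\<xi> = S.Cls Y"
      using \<xi>(1) unfolding gns_space_def by (rule S.completion_carrierE)
    with \<xi> have Y: "seminorm_Cauchy A (gns_seminorm A \<omega>) Y"
      "completion_norm (gns_seminorm A \<omega>) (S.Cls Y) \<le> 1"
      "m = completion_norm (gns_seminorm A \<omega>) (gns_rep A \<omega> x (S.Cls Y))"
      by simp_all
    have "m \<le> K * completion_norm (gns_seminorm A \<omega>) (S.Cls Y)"
      unfolding Y(3) rep[OF Y(1)]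
      by (rule LIMSEQ_le[OF S.completion_norm_tendsto[OF C[OF Y(1)]]
            tendsto_mult_left[OF S.completion_norm_tendsto[OF Y(1)]]])
        (use K S.Cauchy_closed[OF Y(1)] in blast)
    also have "\<dots> \<le> K" using mult_left_mono[OF Y(2) K0] by simp
    finally show ?thesis .
  qed
  have embed: "gns_seminorm A \<omega> (x \<otimes> y) \<in> ?M" if "y \<in> carrier A" "gns_seminorm A \<omega> y \<le> 1" for y
    using that x by (intro CollectI exI[of _ "S.Cls (\<lambda>_. y)"])
      (simp add: gns_space_def S.Cls_in_carrier S.Cauchy_const rep S.completion_norm_embed closed)
  have "\<zero> \<in> carrier A" "gns_seminorm A \<omega> \<zero> \<le> 1" by (simp_all add: zero_closed S.p_zero)
  from embed[OF this] have "?M \<noteq> {}" by blast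
  then show "gns_opnorm A \<omega> x \<le> K"
    unfolding gns_opnorm_def by (rule cSup_least) (rule le)
  assume y: "y \<in> carrier A"
  show "gns_seminorm A \<omega> (x \<otimes> y) \<le> gns_opnorm A \<omega> x * gns_seminorm A \<omega> y"
  proof (cases "gns_seminorm A \<omega> y = 0")
    case True
    then show ?thesis using K[OF y] by simp
  next
    case False
    then have pos: "gns_seminorm A \<omega> y > 0" using S.p_nonneg[OF y] by simp
    let ?c = "complex_of_real (1 / gns_seminorm A \<omega> y)"
    have "gns_seminorm A \<omega> (x \<otimes> ?c \<odot> y) \<le> gns_opnorm A \<omega> x"
      unfolding gns_opnorm_def
      by (rule cSup_upper[OF embed bdd_aboveI[of _ K, OF le]])
        (use pos y in \<open>simp_all add: S.p_scale closed norm_divide\<close>)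
    then show ?thesis
      using pos x y by (simp add: S.p_scale mult_scale_right closed norm_divide field_simps)
  qed
qed

end

end

section \<open>Suprema of GNS operator norms\<close>

text \<open>
  The element \<open>0\<close> makes the supremum vanish on an empty family.
\<close>

definition gns_sup_norm ::
    "('a, 'm) star_algebra_scheme \<Rightarrow> ('a \<Rightarrow> complex) set \<Rightarrow> 'a \<Rightarrow> real" where
  "gns_sup_norm A \<Omega> x = Sup (insert 0 ((\<lambda>\<omega>. gns_opnorm A \<omega> x) ` \<Omega>))"

text \<open>
  The bound is uniform over the family, so the supremum of the operator norms is finite.
\<close>

locale bounded_functionals = star_algebra +
  fixes \<Omega>
  assumes positive: "\<omega> \<in> \<Omega> \<Longrightarrow> positive_functional A \<omega>"
    and bounded: "x \<in> carrier A \<Longrightarrow>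
      \<exists>K\<ge>0. \<forall>\<omega>\<in>\<Omega>. \<forall>y\<in>carrier A. gns_seminorm A \<omega> (x \<otimes> y) \<le> K * gns_seminorm A \<omega> y"
begin

lemma sup_norm_least:
  assumes "x \<in> carrier A" "0 \<le> K"
    and "\<And>\<omega> y. \<omega> \<in> \<Omega> \<Longrightarrow> y \<in> carrier A \<Longrightarrow> gns_seminorm A \<omega> (x \<otimes> y) \<le> K * gns_seminorm A \<omega> y"
  shows "gns_sup_norm A \<Omega> x \<le> K"
  unfolding gns_sup_norm_def
  using gns_opnorm_bounds(1)[OF positive assms(1,3,2)] assms(2) by (intro cSup_least) auto

lemma sup_norm_upper:
  assumes x: "x \<in> carrier A"
  shows "0 \<le> gns_sup_norm A \<Omega> x"
    and "\<lbrakk>\<omega> \<in> \<Omega>; y \<in> carrier A\<rbrakk> \<Longrightarrow>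
      gns_seminorm A \<omega> (x \<otimes> y) \<le> gns_sup_norm A \<Omega> x * gns_seminorm A \<omega> y"
proof -
  obtain K where K: "0 \<le> K"
    "\<And>\<omega> y. \<omega> \<in> \<Omega> \<Longrightarrow> y \<in> carrier A \<Longrightarrow> gns_seminorm A \<omega> (x \<otimes> y) \<le> K * gns_seminorm A \<omega> y"
    using bounded[OF x] by blast
  have bdd: "bdd_above (insert 0 ((\<lambda>\<omega>. gns_opnorm A \<omega> x) ` \<Omega>))"
    using gns_opnorm_bounds(1)[OF positive x K(2) K(1)] K(1) by (intro bdd_aboveI[of _ K]) auto
  show "0 \<le> gns_sup_norm A \<Omega> x"
    unfolding gns_sup_norm_def by (rule cSup_upper[OF _ bdd]) simp
  assume \<omega>: "\<omega> \<in> \<Omega>" and y: "y \<in> carrier A"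
  have "gns_seminorm A \<omega> (x \<otimes> y) \<le> gns_opnorm A \<omega> x * gns_seminorm A \<omega> y"
    using \<omega> by (intro gns_opnorm_bounds(2)[OF positive x K(2) K(1) y])
  also have "\<dots> \<le> gns_sup_norm A \<Omega> x * gns_seminorm A \<omega> y"
    unfolding gns_sup_norm_def
    using \<omega> y seminorm_on.p_nonneg[OF gns_seminorm_on[OF positive[OF \<omega>]]]
    by (intro mult_right_mono cSup_upper[OF _ bdd]) auto
  finally show "gns_seminorm A \<omega> (x \<otimes> y) \<le> gns_sup_norm A \<Omega> x * gns_seminorm A \<omega> y" .
qed

text \<open>
  Each operator seminorm satisfies the $C^*$-conditions on the GNS space, and these pass to the
  supremum, which is the least constant \<open>K \<ge> 0\<close> that serves for all functionals at once.
\<close>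

theorem sup_norm_cstar_seminorm: "cstar_seminorm A (gns_sup_norm A \<Omega>)"
proof -
  let ?N = "gns_sup_norm A \<Omega>"
  have semi: "seminorm_on A (gns_seminorm A \<omega>)" if "\<omega> \<in> \<Omega>" for \<omega>
    using gns_seminorm_on positive that by blast
  note nonneg = seminorm_on.p_nonneg[OF semi]
  note upper = sup_norm_upper(2) and N0 = sup_norm_upper(1)
  have triangle: "?N (x \<oplus> x') \<le> ?N x + ?N x'" if x: "x \<in> carrier A" "x' \<in> carrier A" for x x'
  proof (rule sup_norm_least)
    fix \<omega> y assume w: "\<omega> \<in> \<Omega>" and y: "y \<in> carrier A"
    show "gns_seminorm A \<omega> ((x \<oplus> x') \<otimes> y) \<le> (?N x + ?N x') * gns_seminorm A \<omega> y"
      using seminorm_on.p_triangle[OF semi[OF w], of "x \<otimes> y" "x' \<otimes> y"] upper[OF x(1) w y] upper[OF x(2) w y] x y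
      by (simp add: mult_add_left closed distrib_right)
  qed (use x N0 in \<open>simp_all add: closed\<close>)
  have scale_le: "?N (c \<odot> x) \<le> cmod c * ?N x" if x: "x \<in> carrier A" for c x
  proof (rule sup_norm_least)
    fix \<omega> y assume w: "\<omega> \<in> \<Omega>" and y: "y \<in> carrier A"
    show "gns_seminorm A \<omega> (c \<odot> x \<otimes> y) \<le> cmod c * ?N x * gns_seminorm A \<omega> y"
      using upper[OF x w y] x y
      by (simp add: mult_scale_left closed seminorm_on.p_scale[OF semi[OF w]] mult.assoc mult_left_mono)
  qed (use x N0 in \<open>simp_all add: closed\<close>)
  have scale: "?N (c \<odot> x) = cmod c * ?N x" if x: "x \<in> carrier A" for c x
  proof (cases "c = 0")
    case True
    then show ?thesis using scale_le[OF x, of c] N0[of "c \<odot> x"] x by (simp add: closed)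
  next
    case False
    have "?N x \<le> cmod (1 / c) * ?N (c \<odot> x)"
      using scale_le[of "c \<odot> x" "1 / c"] x False by (simp add: scale_scale scale_one closed)
    then have "cmod c * ?N x \<le> ?N (c \<odot> x)" using False by (simp add: norm_divide field_simps)
    then show ?thesis using scale_le[OF x, of c] by simp
  qed
  have mult: "?N (x \<otimes> x') \<le> ?N x * ?N x'" if x: "x \<in> carrier A" "x' \<in> carrier A" for x x'
  proof (rule sup_norm_least)
    fix \<omega> y assume w: "\<omega> \<in> \<Omega>" and y: "y \<in> carrier A"
    have "gns_seminorm A \<omega> (x \<otimes> (x' \<otimes> y)) \<le> ?N x * gns_seminorm A \<omega> (x' \<otimes> y)"
      using x y w by (intro upper) (simp_all add: closed)
    also have "\<dots> \<le> ?N x * (?N x' * gns_seminorm A \<omega> y)"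
      using x y w by (intro mult_left_mono upper N0)
    finally show "gns_seminorm A \<omega> (x \<otimes> x' \<otimes> y) \<le> ?N x * ?N x' * gns_seminorm A \<omega> y"
      using x y by (simp add: mult_assoc mult.assoc)
  qed (use x N0 in \<open>simp_all add: closed\<close>)
  have square: "(?N x)\<^sup>2 \<le> ?N (astar A x \<otimes> x)" if x: "x \<in> carrier A" for x
  proof -
    have "?N x \<le> sqrt (?N (astar A x \<otimes> x))"
    proof (rule sup_norm_least)
      fix \<omega> y assume w: "\<omega> \<in> \<Omega>" and y: "y \<in> carrier A"
      have "(gns_seminorm A \<omega> (x \<otimes> y))\<^sup>2 \<le> gns_seminorm A \<omega> y * gns_seminorm A \<omega> (astar A x \<otimes> x \<otimes> y)"
        by (rule gns_mult_Cauchy_Schwarz[OF positive[OF w] x y])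
      also have "\<dots> \<le> gns_seminorm A \<omega> y * (?N (astar A x \<otimes> x) * gns_seminorm A \<omega> y)"
        using x y w by (intro mult_left_mono upper nonneg) (simp_all add: closed)
      also have "\<dots> = (sqrt (?N (astar A x \<otimes> x)) * gns_seminorm A \<omega> y)\<^sup>2"
        using x by (simp add: power_mult_distrib N0 closed) (simp add: power2_eq_square)
      finally show "gns_seminorm A \<omega> (x \<otimes> y) \<le> sqrt (?N (astar A x \<otimes> x)) * gns_seminorm A \<omega> y"
        by (rule power2_le_imp_le) (simp add: N0 nonneg closed x y w)
    qed (use x N0 in \<open>simp_all add: closed\<close>)
    then have "(?N x)\<^sup>2 \<le> (sqrt (?N (astar A x \<otimes> x)))\<^sup>2"
      using N0[OF x] by (rule power_mono)
    then show ?thesis using x by (simp add: N0 closed)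
  qed
  have star_le: "?N x \<le> ?N (astar A x)" if x: "x \<in> carrier A" for x
  proof (cases "?N x = 0")
    case False
    have "?N x * ?N x \<le> ?N (astar A x) * ?N x"
      using square[OF x] mult[of "astar A x" x] x by (simp add: power2_eq_square closed)
    then show ?thesis using False N0[OF x] by simp
  qed (use x N0 in \<open>simp add: closed\<close>)
  have cstar: "?N (astar A x \<otimes> x) = (?N x)\<^sup>2" if x: "x \<in> carrier A" for x
  proof (rule antisym[OF _ square[OF x]])
    have "?N (astar A x \<otimes> x) \<le> ?N (astar A x) * ?N x" using x by (simp add: mult closed)
    also have "\<dots> \<le> ?N x * ?N x"
      using star_le[of "astar A x"] x by (intro mult_right_mono N0) (simp_all add: closed star_star)
    finally show "?N (astar A x \<otimes> x) \<le> (?N x)\<^sup>2" by (simp add: power2_eq_square)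
  qed
  show ?thesis
    by unfold_locales (simp_all add: N0 triangle scale mult cstar)
qed

text \<open>
  An automorphism preserving every functional is isometric for every GNS seminorm, so it conjugates
  left multiplication by \<open>x\<close> into left multiplication by \<open>\<theta> x\<close>.
\<close>

lemma sup_norm_automorphism:
  assumes aut: "star_automorphism A \<theta>" and inv: "\<And>\<omega> x. \<omega> \<in> \<Omega> \<Longrightarrow> x \<in> carrier A \<Longrightarrow> \<omega> (\<theta> x) = \<omega> x"
    and invol: "\<And>x. x \<in> carrier A \<Longrightarrow> \<theta> (\<theta> x) = x" and x: "x \<in> carrier A"
  shows "gns_sup_norm A \<Omega> (\<theta> x) = gns_sup_norm A \<Omega> x"
proof -
  have closed': "\<theta> y \<in> carrier A" if "y \<in> carrier A" for y
    using aut that by (auto simp: star_automorphism_def bij_betw_def)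
  have semi: "gns_seminorm A \<omega> (\<theta> y) = gns_seminorm A \<omega> y" if "\<omega> \<in> \<Omega>" "y \<in> carrier A" for \<omega> y
    using inv[of \<omega> "astar A y \<otimes> y"] aut that
    by (simp add: gns_seminorm_def star_automorphism_def closed)
  have le: "gns_sup_norm A \<Omega> (\<theta> x) \<le> gns_sup_norm A \<Omega> x" if x: "x \<in> carrier A" for x
  proof (rule sup_norm_least)
    fix \<omega> y assume w: "\<omega> \<in> \<Omega>" and y: "y \<in> carrier A"
    \<comment> \<open>Every element is \<open>\<theta>\<close> of an element of the same seminorm, because \<open>\<theta>\<close> is an isometric involution.\<close>
    have "\<theta> x \<otimes> y = \<theta> (x \<otimes> \<theta> y)" using aut x y by (simp add: star_automorphism_def closed' invol)
    then show "gns_seminorm A \<omega> (\<theta> x \<otimes> y) \<le> gns_sup_norm A \<Omega> x * gns_seminorm A \<omega> y"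
      using sup_norm_upper(2)[OF x w closed'[OF y]] semi[OF w] x y by (simp add: closed closed')
  qed (use x in \<open>simp_all add: closed' sup_norm_upper\<close>)
  show ?thesis using le[OF x] le[OF closed'[OF x]] by (simp add: invol x)
qed

end

section \<open>The algebraic Fermi tensor product\<close>

context graded_cstar_algebra
begin

lemma grading_closed: "x \<in> carrier A \<Longrightarrow> \<alpha> x \<in> carrier A"
  using grading_hom by (simp add: scalar_hom_def)

lemma grading_add: "\<lbrakk>x \<in> carrier A; y \<in> carrier A\<rbrakk> \<Longrightarrow> \<alpha> (x \<oplus> y) = \<alpha> x \<oplus> \<alpha> y"
  and grading_scale: "x \<in> carrier A \<Longrightarrow> \<alpha> (c \<odot> x) = c \<odot> \<alpha> x"
  and grading_mult: "\<lbrakk>x \<in> carrier A; y \<in> carrier A\<rbrakk> \<Longrightarrow> \<alpha> (x \<otimes> y) = \<alpha> x \<otimes> \<alpha> y"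
  and grading_star: "x \<in> carrier A \<Longrightarrow> \<alpha> (astar A x) = astar A (\<alpha> x)"
  using grading_automorphism by (simp_all add: star_automorphism_def)

lemma homogeneous_closed: "homogeneous A \<alpha> s a \<Longrightarrow> a \<in> carrier A"
  by (simp add: homogeneous_def)

lemma homogeneous_zero: "homogeneous A \<alpha> s \<zero>"
  using grading_scale[of \<zero> 0] by (simp add: homogeneous_def zero_closed scale_zero scale_zero_right grading_closed)

lemma homogeneous_mult:
  "\<lbrakk>homogeneous A \<alpha> s a; homogeneous A \<alpha> t b\<rbrakk> \<Longrightarrow> homogeneous A \<alpha> (s \<noteq> t) (a \<otimes> b)"
  by (simp add: homogeneous_def closed grading_mult mult_scale_left mult_scale_right scale_scale)
    (simp add: parity_sign_def)

lemma homogeneous_star: "homogeneous A \<alpha> s a \<Longrightarrow> homogeneous A \<alpha> s (astar A a)"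
  by (simp add: homogeneous_def closed grading_star star_scale parity_sign_def)

lemma homogeneous_grading: "homogeneous A \<alpha> s a \<Longrightarrow> homogeneous A \<alpha> s (\<alpha> a)"
  by (simp add: homogeneous_def closed grading_closed grading_scale)

text \<open>
  The grading has order two, so \<open>(a \<plusminus> \<alpha> a) / 2\<close> are its eigenvectors for the eigenvalues \<open>\<plusminus>1\<close>.
\<close>

lemma hpart_is_homogeneous:
  assumes "a \<in> carrier A"
  shows "homogeneous A \<alpha> s (hpart A \<alpha> s a)"
  using assms
  by (simp add: homogeneous_def hpart_def closed grading_closed grading_add grading_scale grading_involutive
      scale_add_right scale_scale add_comm) (simp add: parity_sign_def add_comm closed grading_closed)

lemma hpart_decomposition:
  assumes "a \<in> carrier A"
  shows "a = hpart A \<alpha> False a \<oplus> hpart A \<alpha> True a"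
proof -
  have "hpart A \<alpha> False a \<oplus> hpart A \<alpha> True a = ((1/2) \<odot> a \<oplus> (1/2) \<odot> a) \<oplus> ((1/2) \<odot> \<alpha> a \<oplus> (- (1/2)) \<odot> \<alpha> a)"
    unfolding hpart_def parity_sign_def using assms
    by (simp add: scale_add_right scale_scale closed grading_closed add_swap)
  also have "\<dots> = a"
    using assms by (simp add: scale_add_left[symmetric] scale_zero scale_one add_zero grading_closed)
  finally show ?thesis by simp
qed

end

context fermi_pair
begin

abbreviation "F \<equiv> fermi_algebra A \<alpha> B \<beta>"
abbreviation "cls x \<equiv> tensor_rel A B `` {x}"

lemma fermi_carrierE:
  assumes "\<xi> \<in> carrier F"
  obtains x where "x \<in> free_carrier A B" "\<xi> = cls x"
  using assms unfolding fermi_algebra_def by (auto elim!: quotientE)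

lemma cls_closed: "x \<in> free_carrier A B \<Longrightarrow> cls x \<in> carrier F"
  by (auto simp: fermi_algebra_def intro: quotientI)

lemma cls_eq: "(x, y) \<in> tensor_rel A B \<Longrightarrow> cls x = cls y"
  by (rule equiv_class_eq[OF equiv_tensor_rel])

lemma fermi_zero: "azero F = cls 0"
  by (simp add: fermi_algebra_def)

lemma fermi_add: "\<lbrakk>x \<in> free_carrier A B; y \<in> free_carrier A B\<rbrakk> \<Longrightarrow> cls x \<oplus>\<^bsub>F\<^esub> cls y = cls (x + y)"
  unfolding fermi_algebra_def star_algebra.simps
proof (rule quot_lift2_class[OF equiv_tensor_rel])
  fix x' y' assume "(x, x') \<in> tensor_rel A B" "(y, y') \<in> tensor_rel A B"
  then show "(x + y, x' + y') \<in> tensor_rel A B"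
    using free.span_add[of "x - x'" "bilinearity_relations A B" "y - y'"]
    by (simp add: tensor_rel_def free_carrier_add algebra_simps)
qed

lemma fermi_scale: "x \<in> free_carrier A B \<Longrightarrow> c \<odot>\<^bsub>F\<^esub> cls x = cls (fscale c x)"
  unfolding fermi_algebra_def star_algebra.simps
  by (rule quot_lift_class[OF equiv_tensor_rel]) (simp_all add: fscale_rel)

lemma fermi_mult:
  "\<lbrakk>x \<in> free_carrier A B; y \<in> free_carrier A B\<rbrakk> \<Longrightarrow> cls x \<otimes>\<^bsub>F\<^esub> cls y = cls (free_mult A \<alpha> B \<beta> x y)"
  unfolding fermi_algebra_def star_algebra.simps
  by (rule quot_lift2_class[OF equiv_tensor_rel]) (simp_all add: free_mult_rel)

lemma fermi_star: "x \<in> free_carrier A B \<Longrightarrow> astar F (cls x) = cls (free_star A \<alpha> B \<beta> x)"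
  unfolding fermi_algebra_def star_algebra.simps
  by (rule quot_lift_class[OF equiv_tensor_rel]) (simp_all add: free_star_rel)

lemma fermi_grading_cls:
  "x \<in> free_carrier A B \<Longrightarrow> fermi_grading A \<alpha> B \<beta> (cls x) = cls (free_grading \<alpha> \<beta> x)"
  unfolding fermi_grading_def
  by (rule quot_lift_class[OF equiv_tensor_rel]) (simp_all add: free_grading_rel)

lemmas free_closed = free_carrier_add free_carrier_scale free_carrier_zero free_mult_closed
  free_star_closed free_grading_closed

lemmas fermi_rules = fermi_zero fermi_add fermi_scale fermi_mult fermi_star fermi_grading_cls cls_closed

lemma free_mult_linear_left:
  "free_mult A \<alpha> B \<beta> (x + x') y = free_mult A \<alpha> B \<beta> x y + free_mult A \<alpha> B \<beta> x' y"
  "free_mult A \<alpha> B \<beta> (fscale c x) y = fscale c (free_mult A \<alpha> B \<beta> x y)"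
  by (simp_all only: free_mult_left lin.free_ext_add lin.free_ext_scale)

lemma free_mult_linear_right:
  "free_mult A \<alpha> B \<beta> x (y + y') = free_mult A \<alpha> B \<beta> x y + free_mult A \<alpha> B \<beta> x y'"
  "free_mult A \<alpha> B \<beta> x (fscale c y) = fscale c (free_mult A \<alpha> B \<beta> x y)"
  by (simp_all only: free_mult_right lin.free_ext_add lin.free_ext_scale)

lemma free_star_conjugate_linear:
  "free_star A \<alpha> B \<beta> (x + y) = free_star A \<alpha> B \<beta> x + free_star A \<alpha> B \<beta> y"
  "free_star A \<alpha> B \<beta> (fscale c x) = fscale (cnj c) (free_star A \<alpha> B \<beta> x)"
proof -
  have "free_star A \<alpha> B \<beta> z = free_ext cnj (pure_star A \<alpha> B \<beta>) z" for z
    by (simp add: free_star_def free_ext_def)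
  then show "free_star A \<alpha> B \<beta> (x + y) = free_star A \<alpha> B \<beta> x + free_star A \<alpha> B \<beta> y"
    "free_star A \<alpha> B \<beta> (fscale c x) = fscale (cnj c) (free_star A \<alpha> B \<beta> x)"
    by (simp_all only: conjugate.free_ext_add conjugate.free_ext_scale)
qed

lemma free_grading_linear:
  "free_grading \<alpha> \<beta> (x + y) = free_grading \<alpha> \<beta> x + free_grading \<alpha> \<beta> y"
  "free_grading \<alpha> \<beta> (fscale c x) = fscale c (free_grading \<alpha> \<beta> x)"
proof -
  have "free_grading \<alpha> \<beta> z = free_ext (\<lambda>c. c) (\<lambda>p. pure (\<alpha> (fst p)) (\<beta> (snd p))) z" for z
    by (simp add: free_grading_def free_ext_def)
  then show "free_grading \<alpha> \<beta> (x + y) = free_grading \<alpha> \<beta> x + free_grading \<alpha> \<beta> y"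
    "free_grading \<alpha> \<beta> (fscale c x) = fscale c (free_grading \<alpha> \<beta> x)"
    by (simp_all only: lin.free_ext_add lin.free_ext_scale)
qed

lemmas free_linear = free_mult_linear_left free_mult_linear_right free_star_conjugate_linear free_grading_linear

lemma tensor_closed: "\<lbrakk>a \<in> carrier A; b \<in> carrier B\<rbrakk> \<Longrightarrow> tensor A B a b \<in> carrier F"
  by (simp add: tensor_def cls_closed pure_in_free)

lemma tensor_add_left:
  assumes "a \<in> carrier A" "a' \<in> carrier A" "b \<in> carrier B"
  shows "tensor A B (a \<oplus>\<^bsub>A\<^esub> a') b = tensor A B a b \<oplus>\<^bsub>F\<^esub> tensor A B a' b"
proof -
  have "pure (a \<oplus>\<^bsub>A\<^esub> a') b - pure a b - pure a' b \<in> tspan A B"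
    using assms unfolding bilinearity_relations_def by (intro free.span_base) blast
  then show ?thesis unfolding tensor_def using assms
    by (simp add: fermi_add pure_in_free)
      (rule cls_eq, simp add: tensor_rel_def pure_in_free A.add_closed free_carrier_add diff_diff_eq)
qed

lemma tensor_add_right:
  assumes "a \<in> carrier A" "b \<in> carrier B" "b' \<in> carrier B"
  shows "tensor A B a (b \<oplus>\<^bsub>B\<^esub> b') = tensor A B a b \<oplus>\<^bsub>F\<^esub> tensor A B a b'"
proof -
  have "pure a (b \<oplus>\<^bsub>B\<^esub> b') - pure a b - pure a b' \<in> tspan A B"
    using assms unfolding bilinearity_relations_def by (intro free.span_base) blast
  then show ?thesis unfolding tensor_def using assms
    by (simp add: fermi_add pure_in_free)
      (rule cls_eq, simp add: tensor_rel_def pure_in_free B.add_closed free_carrier_add diff_diff_eq)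
qed

lemma cls_scaled_pure:
  assumes "a \<in> carrier A" "b \<in> carrier B"
  shows "cls (fscale c (pure a b)) = tensor A B (c \<odot>\<^bsub>A\<^esub> a) b"
proof -
  have "pure (c \<odot>\<^bsub>A\<^esub> a) b - fscale c (pure a b) \<in> tspan A B"
    using assms unfolding bilinearity_relations_def by (intro free.span_base) blast
  then have "cls (pure (c \<odot>\<^bsub>A\<^esub> a) b) = cls (fscale c (pure a b))"
    using assms by (intro cls_eq) (simp add: tensor_rel_def pure_in_free A.scale_closed free_carrier_scale)
  then show ?thesis by (simp add: tensor_def)
qed

lemma fermi_add_closed: "\<lbrakk>x \<in> carrier F; y \<in> carrier F\<rbrakk> \<Longrightarrow> x \<oplus>\<^bsub>F\<^esub> y \<in> carrier F"
  by (auto simp: fermi_rules free_closed elim!: fermi_carrierE)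

text \<open>
  Homogeneous simple tensors span the algebra, and a scalar can be absorbed in the first factor
  without leaving this set, so additivity is the only closure property to check. On homogeneous tensors
  product and involution are given by the defining sign rules.
\<close>

lemma fermi_induct [consumes 1, case_names tensor add]:
  assumes x: "x \<in> carrier F"
    and tensor: "\<And>s t a b. \<lbrakk>homogeneous A \<alpha> s a; homogeneous B \<beta> t b\<rbrakk> \<Longrightarrow> P (tensor A B a b)"
    and add: "\<And>x y. \<lbrakk>x \<in> carrier F; y \<in> carrier F; P x; P y\<rbrakk> \<Longrightarrow> P (x \<oplus>\<^bsub>F\<^esub> y)"
  shows "P x"
proof -
  have simple: "P (tensor A B a b)" if ab: "a \<in> carrier A" "b \<in> carrier B" for a b
  proof -
    \<comment> \<open>Split both factors into homogeneous parts; bilinearity gives four homogeneous tensors.\<close>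
    let ?a = "\<lambda>s. hpart A \<alpha> s a" and ?b = "\<lambda>t. hpart B \<beta> t b"
    have "P (tensor A B (?a False \<oplus>\<^bsub>A\<^esub> ?a True) (?b False \<oplus>\<^bsub>B\<^esub> ?b True))"
      using ab by (simp only: tensor_add_left tensor_add_right A.hpart_closed B.hpart_closed A.add_closed B.add_closed)
        (intro add tensor[OF A.hpart_is_homogeneous B.hpart_is_homogeneous] fermi_add_closed tensor_closed
          A.hpart_closed B.hpart_closed)
    then show ?thesis using ab by (simp only: A.hpart_decomposition[symmetric] B.hpart_decomposition[symmetric])
  qed
  have sums: "cls (\<Sum>p\<in>S. fscale (c p) (pure (fst p) (snd p))) \<in> carrier F \<and>
      P (cls (\<Sum>p\<in>S. fscale (c p) (pure (fst p) (snd p))))"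
    if "finite S" "S \<subseteq> carrier A \<times> carrier B" for S c
    using that
  proof (induction S)
    case empty
    \<comment> \<open>Zero is itself a homogeneous simple tensor.\<close>
    have "cls 0 = cls (fscale 0 (pure \<zero>\<^bsub>A\<^esub> \<zero>\<^bsub>B\<^esub>))" by simp
    also have "\<dots> = tensor A B \<zero>\<^bsub>A\<^esub> \<zero>\<^bsub>B\<^esub>"
      by (simp only: cls_scaled_pure A.zero_closed B.zero_closed A.scale_zero)
    finally show ?case
      using tensor[OF A.homogeneous_zero B.homogeneous_zero] tensor_closed[OF A.zero_closed B.zero_closed] by simp
  next
    case (insert p S)
    let ?t = "fscale (c p) (pure (fst p) (snd p))" and ?u = "\<Sum>p\<in>S. fscale (c p) (pure (fst p) (snd p))"
    have p: "fst p \<in> carrier A" "snd p \<in> carrier B" using insert.prems by auto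
    have t: "?t \<in> free_carrier A B" by (simp add: free_carrier_scale pure_in_free p)
    have u: "?u \<in> free_carrier A B"
      using insert.prems by (intro free_carrier_sum free_carrier_scale pure_in_free) auto
    have "cls (\<Sum>p\<in>insert p S. fscale (c p) (pure (fst p) (snd p))) = cls ?t \<oplus>\<^bsub>F\<^esub> cls ?u"
      using insert.hyps t u by (simp add: fermi_add)
    moreover have "P (cls ?t)" using simple[of "c p \<odot>\<^bsub>A\<^esub> fst p" "snd p"] p
      by (simp add: cls_scaled_pure A.scale_closed)
    moreover have "P (cls ?u)" using insert by auto
    ultimately show ?case
      using t u by (simp add: add cls_closed fermi_add_closed)
  qed
  obtain f where f: "f \<in> free_carrier A B" "x = cls f" using x by (rule fermi_carrierE)
  have "f = (\<Sum>p\<in>Poly_Mapping.keys f. fscale (Poly_Mapping.lookup f p) (pure (fst p) (snd p)))"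
    by (rule poly_mapping_eqI)
      (simp add: lookup_sum pure_def lookup_single when_def in_keys_iff if_distrib cong: if_cong)
  then show ?thesis
    using sums[of "Poly_Mapping.keys f" "Poly_Mapping.lookup f"] f by (simp add: free_carrier_def)
qed

lemma fermi_linear_structure:
  shows fermi_scale_closed: "x \<in> carrier F \<Longrightarrow> c \<odot>\<^bsub>F\<^esub> x \<in> carrier F"
    and fermi_mult_closed: "\<lbrakk>x \<in> carrier F; y \<in> carrier F\<rbrakk> \<Longrightarrow> x \<otimes>\<^bsub>F\<^esub> y \<in> carrier F"
    and fermi_star_closed: "x \<in> carrier F \<Longrightarrow> astar F x \<in> carrier F"
    and fermi_add_assoc: "\<lbrakk>x \<in> carrier F; y \<in> carrier F; z \<in> carrier F\<rbrakk> \<Longrightarrow>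
      (x \<oplus>\<^bsub>F\<^esub> y) \<oplus>\<^bsub>F\<^esub> z = x \<oplus>\<^bsub>F\<^esub> (y \<oplus>\<^bsub>F\<^esub> z)"
    and fermi_add_comm: "\<lbrakk>x \<in> carrier F; y \<in> carrier F\<rbrakk> \<Longrightarrow> x \<oplus>\<^bsub>F\<^esub> y = y \<oplus>\<^bsub>F\<^esub> x"
    and fermi_scale_add: "\<lbrakk>x \<in> carrier F; y \<in> carrier F\<rbrakk> \<Longrightarrow> c \<odot>\<^bsub>F\<^esub> (x \<oplus>\<^bsub>F\<^esub> y) = c \<odot>\<^bsub>F\<^esub> x \<oplus>\<^bsub>F\<^esub> c \<odot>\<^bsub>F\<^esub> y"
    and fermi_scale_scale: "x \<in> carrier F \<Longrightarrow> c \<odot>\<^bsub>F\<^esub> d \<odot>\<^bsub>F\<^esub> x = (c * d) \<odot>\<^bsub>F\<^esub> x"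
    and fermi_scale_one: "x \<in> carrier F \<Longrightarrow> 1 \<odot>\<^bsub>F\<^esub> x = x"
    and fermi_mult_add_left: "\<lbrakk>x \<in> carrier F; y \<in> carrier F; z \<in> carrier F\<rbrakk> \<Longrightarrow>
      (x \<oplus>\<^bsub>F\<^esub> y) \<otimes>\<^bsub>F\<^esub> z = x \<otimes>\<^bsub>F\<^esub> z \<oplus>\<^bsub>F\<^esub> y \<otimes>\<^bsub>F\<^esub> z"
    and fermi_mult_add_right: "\<lbrakk>x \<in> carrier F; y \<in> carrier F; z \<in> carrier F\<rbrakk> \<Longrightarrow>
      x \<otimes>\<^bsub>F\<^esub> (y \<oplus>\<^bsub>F\<^esub> z) = x \<otimes>\<^bsub>F\<^esub> y \<oplus>\<^bsub>F\<^esub> x \<otimes>\<^bsub>F\<^esub> z"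
    and fermi_mult_scale_left: "\<lbrakk>x \<in> carrier F; y \<in> carrier F\<rbrakk> \<Longrightarrow> (c \<odot>\<^bsub>F\<^esub> x) \<otimes>\<^bsub>F\<^esub> y = c \<odot>\<^bsub>F\<^esub> (x \<otimes>\<^bsub>F\<^esub> y)"
    and fermi_mult_scale_right: "\<lbrakk>x \<in> carrier F; y \<in> carrier F\<rbrakk> \<Longrightarrow> x \<otimes>\<^bsub>F\<^esub> (c \<odot>\<^bsub>F\<^esub> y) = c \<odot>\<^bsub>F\<^esub> (x \<otimes>\<^bsub>F\<^esub> y)"
    and fermi_star_add: "\<lbrakk>x \<in> carrier F; y \<in> carrier F\<rbrakk> \<Longrightarrow> astar F (x \<oplus>\<^bsub>F\<^esub> y) = astar F x \<oplus>\<^bsub>F\<^esub> astar F y"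
    and fermi_star_scale: "x \<in> carrier F \<Longrightarrow> astar F (c \<odot>\<^bsub>F\<^esub> x) = cnj c \<odot>\<^bsub>F\<^esub> astar F x"
    and fermi_grading_closed: "x \<in> carrier F \<Longrightarrow> fermi_grading A \<alpha> B \<beta> x \<in> carrier F"
    and fermi_grading_add: "\<lbrakk>x \<in> carrier F; y \<in> carrier F\<rbrakk> \<Longrightarrow>
      fermi_grading A \<alpha> B \<beta> (x \<oplus>\<^bsub>F\<^esub> y) = fermi_grading A \<alpha> B \<beta> x \<oplus>\<^bsub>F\<^esub> fermi_grading A \<alpha> B \<beta> y"
    and fermi_grading_scale: "x \<in> carrier F \<Longrightarrow>
      fermi_grading A \<alpha> B \<beta> (c \<odot>\<^bsub>F\<^esub> x) = c \<odot>\<^bsub>F\<^esub> fermi_grading A \<alpha> B \<beta> x"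
  by (auto elim!: fermi_carrierE simp: fermi_rules free_closed free_linear free.scale_right_distrib ac_simps)

text \<open>
  Both signs are multiplicative in the parities, and both bracketings collect the same three:
  one for each pair consisting of a factor in \<open>B\<close> that moves past a later factor in \<open>A\<close>.
\<close>

lemma fermi_tensor_assoc:
  assumes a: "homogeneous A \<alpha> s a" "homogeneous A \<alpha> s' a'" "homogeneous A \<alpha> s'' a''"
    and b: "homogeneous B \<beta> t b" "homogeneous B \<beta> t' b'" "homogeneous B \<beta> t'' b''"
  shows "(tensor A B a b \<otimes>\<^bsub>F\<^esub> tensor A B a' b') \<otimes>\<^bsub>F\<^esub> tensor A B a'' b''
    = tensor A B a b \<otimes>\<^bsub>F\<^esub> (tensor A B a' b' \<otimes>\<^bsub>F\<^esub> tensor A B a'' b'')"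
proof -
  note c = a[THEN A.homogeneous_closed] b[THEN B.homogeneous_closed]
  note m = c A.mult_closed B.mult_closed tensor_closed
  have "(tensor A B a b \<otimes>\<^bsub>F\<^esub> tensor A B a' b') \<otimes>\<^bsub>F\<^esub> tensor A B a'' b''
      = (koszul t s' * koszul (t \<noteq> t') s'') \<odot>\<^bsub>F\<^esub> tensor A B (a \<otimes>\<^bsub>A\<^esub> a' \<otimes>\<^bsub>A\<^esub> a'') (b \<otimes>\<^bsub>B\<^esub> b' \<otimes>\<^bsub>B\<^esub> b'')"
    using fermi_mult_homogeneous[OF c(1) b(1) a(2) c(5)]
      fermi_mult_homogeneous[OF A.mult_closed[OF c(1,2)] B.homogeneous_mult[OF b(1,2)] a(3) c(6)]
    by (simp add: m fermi_mult_scale_left fermi_scale_scale)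
  moreover have "tensor A B a b \<otimes>\<^bsub>F\<^esub> (tensor A B a' b' \<otimes>\<^bsub>F\<^esub> tensor A B a'' b'')
      = (koszul t' s'' * koszul t (s' \<noteq> s'')) \<odot>\<^bsub>F\<^esub> tensor A B (a \<otimes>\<^bsub>A\<^esub> (a' \<otimes>\<^bsub>A\<^esub> a'')) (b \<otimes>\<^bsub>B\<^esub> (b' \<otimes>\<^bsub>B\<^esub> b''))"
    using fermi_mult_homogeneous[OF c(2) b(2) a(3) c(6)]
      fermi_mult_homogeneous[OF c(1) b(1) A.homogeneous_mult[OF a(2,3)] B.mult_closed[OF c(5,6)]]
    by (simp add: m fermi_mult_scale_right fermi_scale_scale)
  moreover have "koszul t s' * koszul (t \<noteq> t') s'' = koszul t' s'' * koszul t (s' \<noteq> s'')"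
    by (auto simp: koszul_def)
  ultimately show ?thesis by (simp add: c A.mult_assoc B.mult_assoc)
qed

lemma fermi_mult_assoc:
  assumes x: "x \<in> carrier F" and y: "y \<in> carrier F" and z: "z \<in> carrier F"
  shows "(x \<otimes>\<^bsub>F\<^esub> y) \<otimes>\<^bsub>F\<^esub> z = x \<otimes>\<^bsub>F\<^esub> (y \<otimes>\<^bsub>F\<^esub> z)"
  using x
proof (induction x rule: fermi_induct)
  case 1: (tensor s t a b)
  then have x: "tensor A B a b \<in> carrier F" by (simp add: tensor_closed A.homogeneous_closed B.homogeneous_closed)
  show ?case using y
  proof (induction y rule: fermi_induct)
    case 2: (tensor s' t' a' b')
    then have y: "tensor A B a' b' \<in> carrier F" by (simp add: tensor_closed A.homogeneous_closed B.homogeneous_closed)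
    show ?case using z
    proof (induction z rule: fermi_induct)
      case (tensor s'' t'' a'' b'')
      with 1 2 show ?case by (intro fermi_tensor_assoc)
    next
      case (add u v)
      then show ?case using x y by (simp add: fermi_mult_add_right fermi_mult_closed)
    qed
  next
    case (add u v)
    then show ?case using x z by (simp add: fermi_mult_add_left fermi_mult_add_right fermi_mult_closed)
  qed
next
  case (add u v)
  then show ?case using y z by (simp add: fermi_mult_add_left fermi_mult_closed)
qed

text \<open>
  Signs: \<open>\<epsilon>(a a', b b')\<close> splits into four factors, of which \<open>\<epsilon>(a', b)\<close> cancels the sign of the product
  on the left; what remains are the signs of the two involutions and of the reversed product.
\<close>

lemma fermi_tensor_star_mult:
  assumes a: "homogeneous A \<alpha> s a" "homogeneous A \<alpha> s' a'"
    and b: "homogeneous B \<beta> t b" "homogeneous B \<beta> t' b'"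
  shows "astar F (tensor A B a b \<otimes>\<^bsub>F\<^esub> tensor A B a' b')
    = astar F (tensor A B a' b') \<otimes>\<^bsub>F\<^esub> astar F (tensor A B a b)"
proof -
  note c = a[THEN A.homogeneous_closed] b[THEN B.homogeneous_closed]
  note m = c A.mult_closed B.mult_closed A.star_closed B.star_closed tensor_closed
  have "astar F (tensor A B a b \<otimes>\<^bsub>F\<^esub> tensor A B a' b')
      = (koszul t s' * koszul (s \<noteq> s') (t \<noteq> t')) \<odot>\<^bsub>F\<^esub> tensor A B (astar A (a \<otimes>\<^bsub>A\<^esub> a')) (astar B (b \<otimes>\<^bsub>B\<^esub> b'))"
    using fermi_mult_homogeneous[OF c(1) b(1) a(2) c(4)]
      fermi_star_homogeneous[OF A.homogeneous_mult[OF a] B.homogeneous_mult[OF b]]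
    by (simp add: m fermi_star_scale fermi_scale_scale) (simp add: koszul_def)
  moreover have "astar F (tensor A B a' b') \<otimes>\<^bsub>F\<^esub> astar F (tensor A B a b)
      = (koszul s' t' * koszul s t * koszul t' s) \<odot>\<^bsub>F\<^esub>
        tensor A B (astar A a' \<otimes>\<^bsub>A\<^esub> astar A a) (astar B b' \<otimes>\<^bsub>B\<^esub> astar B b)"
    using fermi_star_homogeneous[OF a(1) b(1)] fermi_star_homogeneous[OF a(2) b(2)]
      fermi_mult_homogeneous[OF A.star_closed[OF c(2)] B.homogeneous_star[OF b(2)]
        A.homogeneous_star[OF a(1)] B.star_closed[OF c(3)]]
    by (simp add: m fermi_mult_scale_left fermi_mult_scale_right fermi_scale_scale fermi_scale_closed mult_ac)
  moreover have "koszul t s' * koszul (s \<noteq> s') (t \<noteq> t') = koszul s' t' * koszul s t * koszul t' s"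
    by (auto simp: koszul_def)
  ultimately show ?thesis by (simp add: c A.star_mult B.star_mult)
qed

lemma fermi_star_mult:
  assumes x: "x \<in> carrier F" and y: "y \<in> carrier F"
  shows "astar F (x \<otimes>\<^bsub>F\<^esub> y) = astar F y \<otimes>\<^bsub>F\<^esub> astar F x"
  using x
proof (induction x rule: fermi_induct)
  case 1: (tensor s t a b)
  then have x: "tensor A B a b \<in> carrier F" by (simp add: tensor_closed A.homogeneous_closed B.homogeneous_closed)
  show ?case using y
  proof (induction y rule: fermi_induct)
    case (tensor s' t' a' b')
    with 1 show ?case by (intro fermi_tensor_star_mult)
  next
    case (add u v)
    then show ?case using x
      by (simp add: fermi_mult_add_left fermi_mult_add_right fermi_star_add fermi_mult_closed fermi_star_closed)
  qed
next
  case (add u v)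
  then show ?case using y
    by (simp add: fermi_mult_add_left fermi_mult_add_right fermi_star_add fermi_mult_closed fermi_star_closed)
qed

lemma fermi_star_star: "x \<in> carrier F \<Longrightarrow> astar F (astar F x) = x"
proof (induction x rule: fermi_induct)
  case (tensor s t a b)
  have "koszul s t * koszul s t = 1" "cnj (koszul s t) = koszul s t" by (simp_all add: koszul_def)
  then show ?case
    using tensor fermi_star_homogeneous[OF tensor]
      fermi_star_homogeneous[OF A.homogeneous_star[OF tensor(1)] B.homogeneous_star[OF tensor(2)]]
    by (simp add: fermi_star_scale fermi_scale_scale fermi_scale_one tensor_closed A.homogeneous_closed
        B.homogeneous_closed A.star_closed B.star_closed A.star_star B.star_star)
next
  case (add x y)
  then show ?case by (simp add: fermi_star_add fermi_star_closed)
qed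

theorem fermi_star_algebra: "star_algebra F"
proof
  fix x assume "x \<in> carrier F"
  then obtain f where f: "f \<in> free_carrier A B" "x = cls f" by (rule fermi_carrierE)
  have "f + fscale (-1) f = 0" by (rule poly_mapping_eqI) (simp add: lookup_add)
  then show "x \<ominus>\<^bsub>F\<^esub> x = \<zero>\<^bsub>F\<^esub>" 
    by (simp only: adiff_def f(2) fermi_scale[OF f(1)] fermi_add[OF f(1) free_carrier_scale[OF f(1)]] fermi_zero)
  show "x \<oplus>\<^bsub>F\<^esub> \<zero>\<^bsub>F\<^esub> = x" using f by (simp add: fermi_rules free_closed)
  fix c d
  show "(c + d) \<odot>\<^bsub>F\<^esub> x = c \<odot>\<^bsub>F\<^esub> x \<oplus>\<^bsub>F\<^esub> d \<odot>\<^bsub>F\<^esub> x"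
    using f by (simp add: fermi_rules free_closed free.scale_left_distrib)
next
  show "\<zero>\<^bsub>F\<^esub> \<in> carrier F" by (simp add: fermi_rules free_closed)
qed (fact fermi_add_closed fermi_linear_structure fermi_mult_assoc fermi_star_star fermi_star_mult)+

lemma fermi_grading_involutive:
  "x \<in> carrier F \<Longrightarrow> fermi_grading A \<alpha> B \<beta> (fermi_grading A \<alpha> B \<beta> x) = x"
proof (induction x rule: fermi_induct)
  case (tensor s t a b)
  then show ?case
    by (simp add: fermi_grading_tensor A.homogeneous_closed B.homogeneous_closed A.grading_closed B.grading_closed
        A.grading_involutive B.grading_involutive)
next
  case (add x y)
  then show ?case by (simp add: fermi_grading_add fermi_grading_closed)
qed

lemma fermi_grading_mult:
  assumes x: "x \<in> carrier F" and y: "y \<in> carrier F"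
  shows "fermi_grading A \<alpha> B \<beta> (x \<otimes>\<^bsub>F\<^esub> y) = fermi_grading A \<alpha> B \<beta> x \<otimes>\<^bsub>F\<^esub> fermi_grading A \<alpha> B \<beta> y"
  using x
proof (induction x rule: fermi_induct)
  case 1: (tensor s t a b)
  then have x: "tensor A B a b \<in> carrier F" by (simp add: tensor_closed A.homogeneous_closed B.homogeneous_closed)
  show ?case using y
  proof (induction y rule: fermi_induct)
    case 2: (tensor s' t' a' b')
    show ?case
      using 1 2 fermi_mult_homogeneous[OF _ 1(2) 2(1), of a b']
        fermi_mult_homogeneous[OF _ B.homogeneous_grading[OF 1(2)] A.homogeneous_grading[OF 2(1)], of "\<alpha> a" "\<beta> b'"]
      by (simp add: fermi_grading_tensor fermi_grading_scale tensor_closed A.homogeneous_closed B.homogeneous_closed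
          A.grading_closed B.grading_closed A.mult_closed B.mult_closed A.grading_mult B.grading_mult)
  next
    case (add u v)
    then show ?case using x
      by (simp add: fermi_mult_add_right fermi_grading_add fermi_mult_closed fermi_grading_closed)
  qed
next
  case (add u v)
  then show ?case using y
    by (simp add: fermi_mult_add_left fermi_grading_add fermi_mult_closed fermi_grading_closed)
qed

lemma fermi_grading_star:
  "x \<in> carrier F \<Longrightarrow> fermi_grading A \<alpha> B \<beta> (astar F x) = astar F (fermi_grading A \<alpha> B \<beta> x)"
proof (induction x rule: fermi_induct)
  case (tensor s t a b)
  then show ?case
    using fermi_star_homogeneous[OF tensor]
      fermi_star_homogeneous[OF A.homogeneous_grading[OF tensor(1)] B.homogeneous_grading[OF tensor(2)]]
    by (simp add: fermi_grading_tensor fermi_grading_scale tensor_closed A.homogeneous_closed B.homogeneous_closed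
        A.star_closed B.star_closed A.grading_star B.grading_star)
next
  case (add x y)
  then show ?case by (simp add: fermi_star_add fermi_grading_add fermi_star_closed fermi_grading_closed)
qed

theorem fermi_grading_automorphism: "star_automorphism F (fermi_grading A \<alpha> B \<beta>)"
  unfolding star_automorphism_def
proof (intro conjI ballI allI)
  show "bij_betw (fermi_grading A \<alpha> B \<beta>) (carrier F) (carrier F)"
    by (rule bij_betw_byWitness[where f' = "fermi_grading A \<alpha> B \<beta>"])
      (auto simp: fermi_grading_involutive fermi_grading_closed)
qed (simp_all add: fermi_grading_add fermi_grading_scale fermi_grading_mult fermi_grading_star)

end

section \<open>Tensor products of positive forms\<close>

text \<open>
  Hermitian symmetry is part of this condition, since a complex quadratic form with only real values
  is Hermitian.
\<close>

definition psd_on :: "'i set \<Rightarrow> ('i \<Rightarrow> 'i \<Rightarrow> complex) \<Rightarrow> bool" where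
  "psd_on S K \<longleftrightarrow> (\<forall>v. (\<Sum>i\<in>S. \<Sum>j\<in>S. cnj (v i) * v j * K i j) \<in> \<real>\<^sub>\<ge>\<^sub>0)"

text \<open>
  The quadratic form of the kernel at the vector that is \<open>v\<close> on \<open>S\<close> and \<open>t\<close> at the new index.
\<close>

lemma psd_on_insert:
  assumes S: "finite S" "s \<notin> S" and psd: "psd_on (insert s S) K"
  shows "(\<Sum>i\<in>S. \<Sum>j\<in>S. cnj (v i) * v j * K i j) + t * (\<Sum>i\<in>S. cnj (v i) * K i s)
    + cnj t * (\<Sum>j\<in>S. v j * K s j) + cnj t * t * K s s \<in> \<real>\<^sub>\<ge>\<^sub>0"
proof -
  define w where "w = v(s := t)"
  have w: "w i = v i" if "i \<in> S" for i using that S by (auto simp: w_def)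
  have ws: "w s = t" by (simp add: w_def)
  have "(\<Sum>i\<in>insert s S. \<Sum>j\<in>insert s S. cnj (w i) * w j * K i j) \<in> \<real>\<^sub>\<ge>\<^sub>0"
    using psd by (simp only: psd_on_def)
  moreover have "(\<Sum>i\<in>insert s S. \<Sum>j\<in>insert s S. cnj (w i) * w j * K i j) =
    (\<Sum>i\<in>S. \<Sum>j\<in>S. cnj (v i) * v j * K i j) + t * (\<Sum>i\<in>S. cnj (v i) * K i s)
    + cnj t * (\<Sum>j\<in>S. v j * K s j) + cnj t * t * K s s"
    using S by (simp add: ws w sum.distrib sum_distrib_left algebra_simps cong: sum.cong)
  ultimately show ?thesis by simp
qed

text \<open>
  The Schur product theorem, by Gaussian elimination on \<open>K\<close>: subtracting a rank-one kernel
  \<open>cnj (K s i) K s j / K s s\<close> leaves a positive semidefinite kernel vanishing on the row and column of \<open>s\<close>.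
  The rank-one kernel contributes a value of the quadratic form of \<open>L\<close>, and the remainder is handled by
  induction. If \<open>K s s = 0\<close>, the row and column of \<open>s\<close> vanish already, and division by zero
  makes the subtracted term zero.
\<close>

lemma schur_product:
  assumes "finite S" "psd_on S K" "psd_on S L"
  shows "(\<Sum>i\<in>S. \<Sum>j\<in>S. K i j * L i j) \<in> \<real>\<^sub>\<ge>\<^sub>0"
  using assms
proof (induction S arbitrary: K)
  case empty
  show ?case by simp
next
  case (insert s S)
  note ins = psd_on_insert[OF insert.hyps]
  define c where "c = K s s"
  define Q where "Q v = (\<Sum>i\<in>S. \<Sum>j\<in>S. cnj (v i) * v j * K i j)" for v
  have c: "c \<in> \<real>\<^sub>\<ge>\<^sub>0" using ins[OF insert.prems(1), of "\<lambda>_. 0" 1] by (simp add: c_def)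
  have Q: "Q v \<in> \<real>\<^sub>\<ge>\<^sub>0" for v using ins[OF insert.prems(1), of v 0] by (simp add: Q_def)
  have quad: "Q v + t * (\<Sum>i\<in>S. cnj (v i) * K i s) + cnj t * (\<Sum>j\<in>S. v j * K s j) + cnj t * t * c \<in> \<real>\<^sub>\<ge>\<^sub>0" for v t
    unfolding Q_def c_def by (rule ins[OF insert.prems(1)])
  have herm: "(\<Sum>j\<in>S. v j * K s j) = cnj (\<Sum>i\<in>S. cnj (v i) * K i s)" for v
    by (rule nonneg_quadratic(1)[OF quad Q c])
  have bound: "(cmod (\<Sum>i\<in>S. cnj (v i) * K i s))\<^sup>2 \<le> Re (Q v) * Re c" for v
    by (rule nonneg_quadratic(2)[OF quad Q c])
  have delta: "(\<Sum>i\<in>S. (if i = j then 1 else 0) * f i) = f j" if "j \<in> S" for j and f :: "_ \<Rightarrow> complex"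
    using that insert.hyps by (simp add: if_distrib[of "\<lambda>x. x * _"] cong: if_cong)
  have sj: "K s j = cnj (K j s)" if "j \<in> insert s S" for j
  proof (cases "j = s")
    case True
    then show ?thesis using c by (simp add: c_def complex_nonneg_Reals_iff complex_eq_iff)
  next
    case False
    then show ?thesis using herm[of "\<lambda>i. if i = j then 1 else 0"] that by (simp add: delta)
  qed
  have zero: "K j s = 0" if "j \<in> insert s S" "c = 0" for j
  proof (cases "j = s")
    case False
    then show ?thesis using bound[of "\<lambda>i. if i = j then 1 else 0"] that by (simp add: delta if_distrib[of cnj] cong: if_cong)
  qed (use that in \<open>simp add: c_def\<close>)
  define K' where "K' i j = K i j - K i s * K s j / c" for i j
  \<comment> \<open>If \<open>c \<noteq> 0\<close>, this is the elimination step; if \<open>c = 0\<close>, the entries were zero and nothing is subtracted.\<close>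
  have edge: "K' s j = 0" "K' j s = 0" if "j \<in> insert s S" for j
    using zero[OF that] sj[OF that] by (cases "c = 0"; simp add: K'_def c_def)+
  have "psd_on S K'"
    unfolding psd_on_def
  proof
    fix v
    let ?b = "\<Sum>i\<in>S. cnj (v i) * K i s"
    have "(\<Sum>i\<in>S. \<Sum>j\<in>S. cnj (v i) * v j * K' i j) = Q v - ?b * (\<Sum>j\<in>S. v j * K s j) / c"
      by (simp add: Q_def K'_def right_diff_distrib sum_subtractf sum_product sum_divide_distrib mult_ac)
        (rule sum.swap)
    also have "\<dots> = Q v - of_real ((cmod ?b)\<^sup>2) / c"
      by (simp only: herm complex_norm_square)
    also have "\<dots> \<in> \<real>\<^sub>\<ge>\<^sub>0"
    proof -
      have cr: "c = of_real (Re c)" and Qr: "Q v = of_real (Re (Q v))" and c0: "0 \<le> Re c" "0 \<le> Re (Q v)"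
        using c Q[of v] by (auto simp: complex_nonneg_Reals_iff complex_eq_iff)
      have "(cmod ?b)\<^sup>2 / Re c \<le> Re (Q v)"
        using bound[of v] c0 by (cases "Re c = 0") (simp_all add: divide_le_eq)
      moreover have "Q v - of_real ((cmod ?b)\<^sup>2) / c = of_real (Re (Q v) - (cmod ?b)\<^sup>2 / Re c)"
        by (subst cr, subst Qr) simp
      ultimately show ?thesis by (simp only: nonneg_Reals_of_real_iff diff_ge_0_iff_ge)
    qed
    finally show "(\<Sum>i\<in>S. \<Sum>j\<in>S. cnj (v i) * v j * K' i j) \<in> \<real>\<^sub>\<ge>\<^sub>0" .
  qed
  moreover have "psd_on S L"
    unfolding psd_on_def using ins[OF insert.prems(2), of _ 0] by simp
  ultimately have 1: "(\<Sum>i\<in>S. \<Sum>j\<in>S. K' i j * L i j) \<in> \<real>\<^sub>\<ge>\<^sub>0" by (rule insert.IH)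
  have 2: "(\<Sum>i\<in>insert s S. \<Sum>j\<in>insert s S. cnj (K s i) * K s j * L i j) \<in> \<real>\<^sub>\<ge>\<^sub>0"
    using insert.prems(2) by (simp only: psd_on_def)
  have "(\<Sum>i\<in>insert s S. \<Sum>j\<in>insert s S. K i j * L i j)
      = (\<Sum>i\<in>insert s S. \<Sum>j\<in>insert s S. K' i j * L i j + cnj (K s i) * K s j * L i j / c)"
    by (intro sum.cong refl) (simp add: K'_def sj algebra_simps add_divide_distrib diff_divide_distrib)
  also have "\<dots> = (\<Sum>i\<in>insert s S. \<Sum>j\<in>insert s S. K' i j * L i j)
      + (\<Sum>i\<in>insert s S. \<Sum>j\<in>insert s S. cnj (K s i) * K s j * L i j) / c"
    by (simp only: sum.distrib sum_divide_distrib)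
  also have "(\<Sum>i\<in>insert s S. \<Sum>j\<in>insert s S. K' i j * L i j) = (\<Sum>i\<in>S. \<Sum>j\<in>S. K' i j * L i j)"
    using insert.hyps by (simp add: edge)
  finally show ?case using 1 2 c by (simp only: nonneg_Reals_add_I nonneg_Reals_divide_I)
qed

context star_algebra
begin

lemma linear_on_zero: "linear_on A f \<Longrightarrow> f \<zero> = 0"
  unfolding linear_on_def using scale_zero[OF zero_closed] zero_closed by (metis mult_zero_left)

text \<open>
  The sum \<open>\<Sum> v i \<odot> a i\<close> in an algebra over a carrier, described through all linear functionals. This
  description determines the value of every sesquilinear form at the sum.
\<close>

lemma linear_combination_exists:
  assumes "finite S" "\<And>i. i \<in> S \<Longrightarrow> a i \<in> carrier A"
  shows "\<exists>y\<in>carrier A. \<forall>f. linear_on A f \<longrightarrow> f y = (\<Sum>i\<in>S. v i * f (a i))"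
  using assms
proof (induction S)
  case empty
  show ?case by (intro bexI[of _ \<zero>]) (simp_all add: linear_on_zero zero_closed)
next
  case (insert s S)
  then obtain y where y: "y \<in> carrier A" "\<And>f. linear_on A f \<Longrightarrow> f y = (\<Sum>i\<in>S. v i * f (a i))" by auto
  have "f (v s \<odot> a s \<oplus> y) = (\<Sum>i\<in>insert s S. v i * f (a i))" if "linear_on A f" for f
    using that y insert by (simp add: linear_on_def closed)
  then show ?case using y insert.prems by (intro bexI[of _ "v s \<odot> a s \<oplus> y"]) (simp_all add: closed)
qed

lemma sesquilinear_expand:
  assumes q: "sesquilinear_on A q" and a: "\<And>i. i \<in> S \<Longrightarrow> a i \<in> carrier A"
    and y: "y \<in> carrier A" "\<And>f. linear_on A f \<Longrightarrow> f y = (\<Sum>i\<in>S. v i * f (a i))"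
  shows "q y y = (\<Sum>i\<in>S. \<Sum>j\<in>S. cnj (v i) * v j * q (a i) (a j))"
proof -
  have "cnj (q y z) = (\<Sum>i\<in>S. v i * cnj (q (a i) z))" if "z \<in> carrier A" for z
    using q that y(2)[of "\<lambda>x. cnj (q x z)"] by (simp add: sesquilinear_on_def)
  then have left: "q y z = (\<Sum>i\<in>S. cnj (v i) * q (a i) z)" if "z \<in> carrier A" for z
    using that by (metis (no_types, lifting) cnj_sum complex_cnj_cnj complex_cnj_mult sum.cong)
  have "q y y = (\<Sum>j\<in>S. v j * q y (a j))"
    using q y by (simp add: sesquilinear_on_def)
  also have "\<dots> = (\<Sum>j\<in>S. \<Sum>i\<in>S. cnj (v i) * v j * q (a i) (a j))"
    by (intro sum.cong refl) (simp add: left a sum_distrib_left mult_ac)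
  also have "\<dots> = (\<Sum>i\<in>S. \<Sum>j\<in>S. cnj (v i) * v j * q (a i) (a j))" by (rule sum.swap)
  finally show ?thesis .
qed

lemma gram_psd:
  assumes "positive_form A q" "finite S" "\<And>i. i \<in> S \<Longrightarrow> a i \<in> carrier A"
  shows "psd_on S (\<lambda>i j. q (a i) (a j))"
  unfolding psd_on_def
proof
  fix v
  obtain y where y: "y \<in> carrier A" "\<And>f. linear_on A f \<Longrightarrow> f y = (\<Sum>i\<in>S. v i * f (a i))"
    using linear_combination_exists[of S a v] assms(2,3) by auto
  have "q y y \<in> \<real>\<^sub>\<ge>\<^sub>0" using assms(1) y(1) by (simp add: positive_form_def)
  also have "q y y = (\<Sum>i\<in>S. \<Sum>j\<in>S. cnj (v i) * v j * q (a i) (a j))"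
    using assms by (intro sesquilinear_expand y) (simp_all add: positive_form_def)
  finally show "(\<Sum>i\<in>S. \<Sum>j\<in>S. cnj (v i) * v j * q (a i) (a j)) \<in> \<real>\<^sub>\<ge>\<^sub>0" .
qed

end

text \<open>
  The left-hand side is the value at \<open>\<Sum> a i \<odot> b i\<close> of the tensor product of the two forms, and the Gram
  kernels of positive forms are positive semidefinite.
\<close>

lemma tensor_forms_nonneg:
  assumes "star_algebra A" "positive_form A q" "\<And>i. i \<in> S \<Longrightarrow> a i \<in> carrier A"
    and "star_algebra B" "positive_form B r" "\<And>i. i \<in> S \<Longrightarrow> b i \<in> carrier B"
    and "finite S"
  shows "(\<Sum>i\<in>S. \<Sum>j\<in>S. q (a i) (a j) * r (b i) (b j)) \<in> \<real>\<^sub>\<ge>\<^sub>0"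
  using assms by (intro schur_product star_algebra.gram_psd)

section \<open>States of $C^*$-algebras\<close>

text \<open>
  After normalization by \<open>c\<close> the second hypothesis says that each term is at least the square of the
  preceding one, so \<open>(u 0 / c) ^ (2 ^ n)\<close> grows at most like \<open>r ^ (2 ^ n)\<close>.
\<close>

lemma doubling_growth:
  fixes u :: "nat \<Rightarrow> real"
  assumes u: "\<And>n. 0 \<le> u n" "\<And>n. (u n)\<^sup>2 \<le> c * u (Suc n)" "\<And>n. u n \<le> M * r ^ (2 ^ n)"
    and "0 \<le> c" "0 \<le> r"
  shows "u 0 \<le> r * c"
proof (cases "c = 0")
  case True
  then show ?thesis using u(2)[of 0] by simp
next
  case False
  then have c: "0 < c" using \<open>0 \<le> c\<close> by simp
  \<comment> \<open>The sequence \<open>u n / c\<close> dominates the repeated squares of its first term.\<close>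
  define w where "w = u 0 / c"
  have w0: "0 \<le> w" using u(1) c by (simp add: w_def)
  have pow: "w ^ (2 ^ n) \<le> u n / c" for n
  proof (induction n)
    case 0 show ?case by (simp add: w_def)
  next
    case (Suc n)
    have "w ^ (2 ^ Suc n) = (w ^ (2 ^ n))\<^sup>2" by (simp add: power_mult[symmetric] mult.commute)
    also have "\<dots> \<le> (u n / c)\<^sup>2" using Suc w0 by (intro power_mono) simp_all
    also have "\<dots> \<le> u (Suc n) / c" using u(2)[of n] c by (simp add: power2_eq_square field_simps)
    finally show ?case .
  qed
  have "w \<le> r"
  proof (rule ccontr)
    assume "\<not> w \<le> r"
    then have "r < w" by simp
    show False
    proof (cases "r = 0")
      case True
      then show False using pow[of 0] u(3)[of 0] c \<open>r < w\<close> by (simp add: w_def divide_le_0_iff field_simps)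
    next
      case False
      then have r: "0 < r" using \<open>0 \<le> r\<close> by simp
      have "1 < w / r" using r \<open>r < w\<close> by simp
      then obtain k where k: "M / c < (w / r) ^ k" using real_arch_pow by blast
      have "(w / r) ^ k \<le> (w / r) ^ (2 ^ k)"
        using \<open>1 < w / r\<close> by (intro power_increasing) (simp_all add: less_imp_le)
      also have "\<dots> = w ^ (2 ^ k) / r ^ (2 ^ k)" by (simp add: power_divide)
      also have "\<dots> \<le> (M * r ^ (2 ^ k) / c) / r ^ (2 ^ k)"
        using order_trans[OF pow[of k] divide_right_mono[OF u(3)[of k]]] c r by (intro divide_right_mono) simp_all
      also have "\<dots> = M / c" using r by simp
      finally show False using k by simp
    qed
  qed
  then show ?thesis using c by (simp add: w_def field_simps)
qed

context cstar_algebra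
begin

lemma state_linear: "state A \<phi> \<Longrightarrow> linear_on A \<phi>"
  by (simp add: state_def linear_on_def)

lemma state_positive: "state A \<phi> \<Longrightarrow> positive_functional A \<phi>"
  by (simp add: state_def positive_functional_def linear_on_def)

lemma state_bounded:
  assumes \<phi>: "state A \<phi>" and x: "x \<in> carrier A"
  shows "cmod (\<phi> x) \<le> anorm A x"
proof (cases "anorm A x = 0")
  case True
  then have "x = \<zero>" using norm_eq_zero x by simp
  then show ?thesis using linear_on_zero[OF state_linear[OF \<phi>]] True by simp
next
  case False
  then have pos: "0 < anorm A x" using norm_nonneg[OF x] by simp
  let ?c = "complex_of_real (1 / anorm A x)"
  have "cmod (\<phi> (?c \<odot> x)) \<le> Sup {cmod (\<phi> x) |x. x \<in> carrier A \<and> anorm A x \<le> 1}"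
    using \<phi> x pos unfolding state_def
    by (intro cSup_upper CollectI exI[of _ "?c \<odot> x"]) (simp_all add: closed norm_scale norm_divide)
  then have "cmod (\<phi> (?c \<odot> x)) \<le> 1" using \<phi> by (simp add: state_def)
  then show ?thesis
    using \<phi> x pos by (simp add: state_def norm_mult norm_divide field_simps)
qed

text \<open>
  This is \<open>\<phi> (y\<^sup>*a\<^sup>*a y) \<le> \<parallel>a\<parallel>\<^sup>2 \<phi> (y\<^sup>*y)\<close>. Put \<open>h = a\<^sup>*a\<close> and iterate Cauchy--Schwarz along the powers
  \<open>h ^ (2 ^ n)\<close>: \<open>\<parallel>h ^ (2 ^ n) y\<parallel>\<^sup>2 \<le> \<parallel>y\<parallel> \<parallel>h ^ (2 ^ (n + 1)) y\<parallel>\<close> in the GNS seminorm. Since a state is bounded,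
  these seminorms grow at most like \<open>\<parallel>h\<parallel> ^ (2 ^ n)\<close>, whence \<open>\<parallel>h y\<parallel> \<le> \<parallel>h\<parallel> \<parallel>y\<parallel>\<close>.
\<close>

theorem state_left_bounded:
  assumes \<phi>: "state A \<phi>" and a: "a \<in> carrier A" and y: "y \<in> carrier A"
  shows "gns_seminorm A \<phi> (a \<otimes> y) \<le> anorm A a * gns_seminorm A \<phi> y"
proof -
  note form = gns_form_positive[OF state_positive[OF \<phi>]]
  interpret S: seminorm_on A "gns_seminorm A \<phi>" by (rule gns_seminorm_on[OF state_positive[OF \<phi>]])
  note pull = gns_mult_Cauchy_Schwarz[OF state_positive[OF \<phi>]]
  have le_norm: "gns_seminorm A \<phi> x \<le> anorm A x" if x: "x \<in> carrier A" for x
  proof -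
    have "(gns_seminorm A \<phi> x)\<^sup>2 \<le> cmod (\<phi> (astar A x \<otimes> x))"
      using x by (simp add: gns_seminorm_eq form_norm_square[OF form]) (simp add: gns_form_def complex_Re_le_cmod)
    also have "\<dots> \<le> (anorm A x)\<^sup>2"
      using state_bounded[OF \<phi>, of "astar A x \<otimes> x"] x by (simp add: cstar_identity closed)
    finally show ?thesis using norm_nonneg[OF x] by (rule power2_le_imp_le)
  qed
  define h where "h = astar A a \<otimes> a"
  define H where "H n = ((\<lambda>x. x \<otimes> x) ^^ n) h" for n
  have HS: "H (Suc n) = H n \<otimes> H n" for n by (simp add: H_def)
  have H0: "H 0 = h" by (simp add: H_def)
  have h: "h \<in> carrier A" "astar A h = h" using a by (simp_all add: h_def closed star_mult star_star)
  have HC: "H n \<in> carrier A" for n by (induction n) (simp_all add: H0 HS h closed)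
  have Hstar: "astar A (H n) = H n" for n by (induction n) (simp_all add: H0 HS h HC star_mult)
  have Hnorm: "anorm A (H n) \<le> anorm A h ^ (2 ^ n)" for n
  proof (induction n)
    case 0 show ?case by (simp add: H0)
  next
    case (Suc n)
    have "anorm A (H (Suc n)) \<le> anorm A (H n) * anorm A (H n)" by (simp add: HS norm_mult HC)
    also have "\<dots> \<le> anorm A h ^ (2 ^ n) * anorm A h ^ (2 ^ n)"
      using Suc by (intro mult_mono) (simp_all add: norm_nonneg HC h)
    finally show ?case by (simp add: power_add[symmetric] mult_2)
  qed
  have "gns_seminorm A \<phi> (H 0 \<otimes> y) \<le> anorm A h * gns_seminorm A \<phi> y"
  proof (rule doubling_growth)
    fix n
    show "0 \<le> gns_seminorm A \<phi> (H n \<otimes> y)" by (simp add: S.p_nonneg closed HC y)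
    show "(gns_seminorm A \<phi> (H n \<otimes> y))\<^sup>2 \<le> gns_seminorm A \<phi> y * gns_seminorm A \<phi> (H (Suc n) \<otimes> y)"
      using pull[OF HC y, of n] by (simp add: Hstar HS)
    have "gns_seminorm A \<phi> (H n \<otimes> y) \<le> anorm A (H n \<otimes> y)" by (simp add: le_norm closed HC y)
    also have "\<dots> \<le> anorm A (H n) * anorm A y" by (rule norm_mult[OF HC y])
    also have "\<dots> \<le> anorm A h ^ (2 ^ n) * anorm A y" by (intro mult_right_mono Hnorm norm_nonneg y)
    finally show "gns_seminorm A \<phi> (H n \<otimes> y) \<le> anorm A y * anorm A h ^ (2 ^ n)" by (simp add: mult.commute)
  qed (simp_all add: S.p_nonneg norm_nonneg y h)
  then have "(gns_seminorm A \<phi> (a \<otimes> y))\<^sup>2 \<le> gns_seminorm A \<phi> y * (anorm A h * gns_seminorm A \<phi> y)"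
    using pull[OF a y] S.p_nonneg[OF y] by (auto simp: H0 h_def intro: order_trans mult_left_mono)
  also have "\<dots> = (anorm A a * gns_seminorm A \<phi> y)\<^sup>2"
    using a by (simp add: h_def cstar_identity) (simp add: power2_eq_square)
  finally show ?thesis by (rule power2_le_imp_le) (simp add: norm_nonneg S.p_nonneg a y)
qed

lemma state_defect_form:
  assumes \<phi>: "state A \<phi>" and a: "a \<in> carrier A"
  shows "positive_form A (\<lambda>x y. of_real ((anorm A a)\<^sup>2) * gns_form \<phi> x y - gns_form \<phi> (a \<otimes> x) (a \<otimes> y))"
proof -
  note form = gns_form_positive[OF state_positive[OF \<phi>]]
  have "of_real ((anorm A a)\<^sup>2) * gns_form \<phi> x x - gns_form \<phi> (a \<otimes> x) (a \<otimes> x) \<in> \<real>\<^sub>\<ge>\<^sub>0" if x: "x \<in> carrier A" for x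
  proof -
    have "(gns_seminorm A \<phi> (a \<otimes> x))\<^sup>2 \<le> (anorm A a * gns_seminorm A \<phi> x)\<^sup>2"
      using seminorm_on.p_nonneg[OF gns_seminorm_on[OF state_positive[OF \<phi>]]] a x
      by (intro power_mono state_left_bounded \<phi>) (simp_all add: closed)
    then show ?thesis
      using form_positive[OF form, of x] form_positive[OF form, of "a \<otimes> x"] a x
      by (simp add: complex_nonneg_Reals_iff gns_seminorm_eq power_mult_distrib form_norm_square[OF form] closed)
  qed
  moreover have "sesquilinear_on A (gns_form \<phi>)" "sesquilinear_on A (\<lambda>x y. gns_form \<phi> (a \<otimes> x) (a \<otimes> y))"
    using sesquilinear_pullback gns_form_sesquilinear state_linear[OF \<phi>] a by auto
  ultimately show ?thesis
    by (simp add: positive_form_def sesquilinear_on_def linear_on_def algebra_simps)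
qed

lemma state_pullback_form:
  assumes \<phi>: "state A \<phi>" and a: "a \<in> carrier A"
  shows "positive_form A (\<lambda>x y. gns_form \<phi> (a \<otimes> x) (a \<otimes> y))"
  using gns_form_positive[OF state_positive[OF \<phi>]] a
  by (simp add: positive_form_def sesquilinear_pullback closed)

end

section \<open>Product functionals\<close>

context fermi_pair
begin

sublocale F: star_algebra F
  by (rule fermi_star_algebra)

text \<open>
  As for linear combinations above, the sum is expressed through all linear functionals.
\<close>

lemma sum_of_homogeneous_tensors:
  assumes "x \<in> carrier F"
  obtains n :: nat and s a t b where
    "\<And>i. i < n \<Longrightarrow> homogeneous A \<alpha> (s i) (a i)" "\<And>i. i < n \<Longrightarrow> homogeneous B \<beta> (t i) (b i)"
    "\<And>f. linear_on F f \<Longrightarrow> f x = (\<Sum>i<n. f (tensor A B (a i) (b i)))"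
proof -
  let ?hom = "\<lambda>(s, a, t, b). homogeneous A \<alpha> s a \<and> homogeneous B \<beta> t b"
  let ?val = "\<lambda>f (s, a, t, b). f (tensor A B a b)"
  have "\<exists>ps. list_all ?hom ps \<and> (\<forall>f. linear_on F f \<longrightarrow> f x = sum_list (map (?val f) ps))"
    using assms
  proof (induction x rule: fermi_induct)
    case (tensor s t a b)
    then show ?case by (intro exI[of _ "[(s, a, t, b)]"]) simp
  next
    case (add x y)
    then obtain ps qs where "list_all ?hom ps" "\<And>f. linear_on F f \<Longrightarrow> f x = sum_list (map (?val f) ps)"
      "list_all ?hom qs" "\<And>f. linear_on F f \<Longrightarrow> f y = sum_list (map (?val f) qs)" by blast
    moreover have "f (x \<oplus>\<^bsub>F\<^esub> y) = f x + f y" if "linear_on F f" for f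
      using that add.hyps by (simp add: linear_on_def)
    ultimately show ?case by (intro exI[of _ "ps @ qs"]) simp
  qed
  then obtain ps where ps: "list_all ?hom ps"
    "\<And>f. linear_on F f \<Longrightarrow> f x = sum_list (map (?val f) ps)" by blast
  show thesis
  proof (rule that[of "length ps" "\<lambda>i. fst (ps ! i)" "\<lambda>i. fst (snd (ps ! i))" "\<lambda>i. fst (snd (snd (ps ! i)))"
        "\<lambda>i. snd (snd (snd (ps ! i)))"])
    fix i assume "i < length ps"
    then show "homogeneous A \<alpha> (fst (ps ! i)) (fst (snd (ps ! i)))"
      "homogeneous B \<beta> (fst (snd (snd (ps ! i)))) (snd (snd (snd (ps ! i))))"
      using ps(1) by (simp_all add: list_all_length case_prod_unfold)
  next
    fix f assume "linear_on F f"
    then show "f x = (\<Sum>i<length ps. f (tensor A B (fst (snd (ps ! i))) (snd (snd (snd (ps ! i))))))"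
      by (simp add: ps(2) sum_list_sum_nth atLeast0LessThan case_prod_unfold)
  qed
qed

text \<open>
  The defining sum is linear on the free vector space and kills the bilinearity relations, so its value
  on a class is its value on any representative.
\<close>

lemma product_functional_linear:
  assumes \<phi>: "state A \<phi>" and \<psi>: "state B \<psi>"
  shows "linear_on F (product_functional \<phi> \<psi>)"
proof -
  define f where "f x = (\<Sum>p\<in>Poly_Mapping.keys x. Poly_Mapping.lookup x p * (\<phi> (fst p) * \<psi> (snd p)))"
    for x :: "('a, 'b) free"
  \<comment> \<open>A scalar-valued linear extension is a coefficient of a \<open>free_ext\<close> with one-point index set.\<close>
  have ext: "f x = Poly_Mapping.lookup (free_ext (\<lambda>c. c) (\<lambda>p. Poly_Mapping.single () (\<phi> (fst p) * \<psi> (snd p))) x) ()" for x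
    by (simp add: f_def free_ext_def lookup_sum)
  have add: "f (x + y) = f x + f y" and diff: "f (x - y) = f x - f y" and scale: "f (fscale c x) = c * f x"
    and gen: "f (pure a b) = \<phi> a * \<psi> b" for x y c a b
    by (simp_all only: ext lin.free_ext_add lin.free_ext_diff lin.free_ext_scale lin.free_ext_pure
        lookup_add lookup_minus lookup_fscale lookup_single_eq fst_conv snd_conv)
  have rels: "f x = 0" if "x \<in> bilinearity_relations A B" for x
    using that \<phi> \<psi> unfolding bilinearity_relations_def state_def
    by (elim UnE CollectE exE conjE; simp only: diff scale gen; simp add: algebra_simps)
  have span: "f x = 0" if "x \<in> tspan A B" for x
    using that by (induction x rule: free.span_induct_alt) (simp_all only: add scale rels, simp_all add: f_def)
  have cls: "product_functional \<phi> \<psi> (cls x) = f x" if x: "x \<in> free_carrier A B" for x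
  proof -
    have "f ` cls x = {f x}"
    proof (rule image_constant_on)
      show "x \<in> cls x" using x by (rule equiv_class_self[OF equiv_tensor_rel])
      show "f y = f x" if "y \<in> cls x" for y
        using that span[of "x - y"] by (simp add: tensor_rel_def diff)
    qed
    then show ?thesis by (simp add: product_functional_def quot_value_def f_def[symmetric])
  qed
  show ?thesis
    unfolding linear_on_def by (auto elim!: fermi_carrierE simp: fermi_rules free_closed cls add scale)
qed

lemma tensor_in_F: "\<lbrakk>homogeneous A \<alpha> s a; homogeneous B \<beta> t b\<rbrakk> \<Longrightarrow> tensor A B a b \<in> carrier F"
  by (simp add: tensor_closed A.homogeneous_closed B.homogeneous_closed)

context
  fixes \<phi> \<psi> assumes \<phi>: "\<phi> \<in> even_states A \<alpha>" and \<psi>: "\<psi> \<in> even_states B \<beta>"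
begin

lemma states: "state A \<phi>" "state B \<psi>"
  using \<phi> \<psi> by (simp_all add: even_states_def)

text \<open>
  The product \<open>a\<^sup>*a'\<close> is odd, and an even functional vanishes on odd elements.
\<close>

lemma even_state_orthogonal:
  assumes a: "homogeneous A \<alpha> s a" "homogeneous A \<alpha> t a'" and "s \<noteq> t"
  shows "A.gns_form \<phi> a a' = 0"
proof -
  let ?c = "astar A a \<otimes>\<^bsub>A\<^esub> a'"
  have c: "?c \<in> carrier A" "\<alpha> ?c = (-1) \<odot>\<^bsub>A\<^esub> ?c"
    using A.homogeneous_mult[OF A.homogeneous_star[OF a(1)] a(2)] \<open>s \<noteq> t\<close>
    by (simp_all add: homogeneous_def parity_sign_def)
  have "\<phi> ?c = \<phi> (\<alpha> ?c)" using \<phi> c(1) by (simp add: even_states_def)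
  also have "\<dots> = - \<phi> ?c" using states(1) c(1) unfolding c(2) by (simp add: state_def)
  finally show ?thesis by (simp add: A.gns_form_def)
qed

text \<open>
  The inner product is that of the ordinary tensor product: the signs of the involution and of the
  product are \<open>\<epsilon>(a, b) \<epsilon>(b, a')\<close>, which is \<open>1\<close> if \<open>a\<close> and \<open>a'\<close> have the same parity, and otherwise the inner
  product vanishes.
\<close>

lemma product_form_tensors:
  assumes a: "homogeneous A \<alpha> s a" "homogeneous A \<alpha> s' a'"
    and b: "homogeneous B \<beta> t b" "homogeneous B \<beta> t' b'"
  shows "F.gns_form (product_functional \<phi> \<psi>) (tensor A B a b) (tensor A B a' b')
    = A.gns_form \<phi> a a' * B.gns_form \<psi> b b'"
proof -
  note c = a[THEN A.homogeneous_closed] b[THEN B.homogeneous_closed]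
  note m = c A.mult_closed B.mult_closed A.star_closed B.star_closed tensor_closed
  have "astar F (tensor A B a b) \<otimes>\<^bsub>F\<^esub> tensor A B a' b'
      = (koszul s t * koszul t s') \<odot>\<^bsub>F\<^esub> tensor A B (astar A a \<otimes>\<^bsub>A\<^esub> a') (astar B b \<otimes>\<^bsub>B\<^esub> b')"
    using fermi_star_homogeneous[OF a(1) b(1)]
      fermi_mult_homogeneous[OF A.star_closed[OF c(1)] B.homogeneous_star[OF b(1)] a(2) c(4)]
    by (simp add: m fermi_mult_scale_left fermi_scale_scale)
  then have "F.gns_form (product_functional \<phi> \<psi>) (tensor A B a b) (tensor A B a' b')
      = koszul s t * koszul t s' * (A.gns_form \<phi> a a' * B.gns_form \<psi> b b')"
    using product_functional_linear[OF states]
    by (simp add: F.gns_form_def A.gns_form_def B.gns_form_def linear_on_def product_functional_tensor[OF states] m)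
  moreover have "koszul s t * koszul t s' = 1 \<or> A.gns_form \<phi> a a' = 0"
    using even_state_orthogonal[OF a] by (cases "s = s'") (auto simp: koszul_def)
  ultimately show ?thesis by auto
qed

lemma product_functional_positive: "positive_functional F (product_functional \<phi> \<psi>)"
  unfolding positive_functional_def
proof (intro conjI ballI)
  note lin = product_functional_linear[OF states]
  then show "linear_on F (product_functional \<phi> \<psi>)" .
  fix x assume x: "x \<in> carrier F"
  obtain n :: nat and s a t b where ab: "\<And>i. i < n \<Longrightarrow> homogeneous A \<alpha> (s i) (a i)" "\<And>i. i < n \<Longrightarrow> homogeneous B \<beta> (t i) (b i)"
    and sum: "\<And>f. linear_on F f \<Longrightarrow> f x = (\<Sum>i<n. f (tensor A B (a i) (b i)))"
    using sum_of_homogeneous_tensors[OF x] by blast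
  have T: "tensor A B (a i) (b i) \<in> carrier F" if "i < n" for i
    using that ab tensor_in_F by blast
  have c: "a i \<in> carrier A" "b i \<in> carrier B" if "i < n" for i
    using that ab A.homogeneous_closed B.homogeneous_closed by blast+
  have "F.gns_form (product_functional \<phi> \<psi>) x x
      = (\<Sum>i<n. \<Sum>j<n. cnj 1 * 1 * F.gns_form (product_functional \<phi> \<psi>) (tensor A B (a i) (b i)) (tensor A B (a j) (b j)))"
    by (rule F.sesquilinear_expand[OF F.gns_form_sesquilinear[OF lin] _ x])
      (use T sum in auto)
  also have "\<dots> = (\<Sum>i<n. \<Sum>j<n. A.gns_form \<phi> (a i) (a j) * B.gns_form \<psi> (b i) (b j))"
    by (intro sum.cong refl) (simp add: product_form_tensors[OF ab(1) ab(1) ab(2) ab(2)])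
  also have "\<dots> \<in> \<real>\<^sub>\<ge>\<^sub>0"
    by (rule tensor_forms_nonneg[OF A.star_algebra_axioms A.gns_form_positive[OF A.state_positive[OF states(1)]] _
          B.star_algebra_axioms B.gns_form_positive[OF B.state_positive[OF states(2)]]])
      (auto simp: c)
  finally show "product_functional \<phi> \<psi> (astar F x \<otimes>\<^bsub>F\<^esub> x) \<in> \<real>\<^sub>\<ge>\<^sub>0" by (simp add: F.gns_form_def)
qed

text \<open>
  Left multiplication by \<open>a \<odot> b\<close> acts on the two factors separately, up to signs that again drop out of
  the inner product. The difference of the squares of the two sides is
  \<open>(\<parallel>a\<parallel>\<^sup>2 G - G') \<parallel>b\<parallel>\<^sup>2 H + G' (\<parallel>b\<parallel>\<^sup>2 H - H')\<close>, summed over entries, where \<open>G\<close>, \<open>H\<close> are the Gram kernels of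
  the factors and \<open>G'\<close>, \<open>H'\<close> those after multiplication. Both terms are Schur products of positive kernels.
\<close>

lemma product_left_bounded:
  assumes a: "homogeneous A \<alpha> s a" and b: "homogeneous B \<beta> t b" and x: "x \<in> carrier F"
  shows "gns_seminorm F (product_functional \<phi> \<psi>) (tensor A B a b \<otimes>\<^bsub>F\<^esub> x)
    \<le> anorm A a * anorm B b * gns_seminorm F (product_functional \<phi> \<psi>) x"
proof -
  let ?\<omega> = "product_functional \<phi> \<psi>" and ?u = "tensor A B a b"
  note lin = product_functional_linear[OF states]
  note form = F.gns_form_positive[OF product_functional_positive]
  have ca: "a \<in> carrier A" and cb: "b \<in> carrier B" and u: "?u \<in> carrier F"
    using a b A.homogeneous_closed B.homogeneous_closed tensor_in_F by blast+
  obtain n :: nat and s' a' t' b' where a': "\<And>i. i < n \<Longrightarrow> homogeneous A \<alpha> (s' i) (a' i)"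
    and b': "\<And>i. i < n \<Longrightarrow> homogeneous B \<beta> (t' i) (b' i)"
    and sum: "\<And>f. linear_on F f \<Longrightarrow> f x = (\<Sum>i<n. f (tensor A B (a' i) (b' i)))"
    using sum_of_homogeneous_tensors[OF x] by blast
  have ca': "a' i \<in> carrier A" and cb': "b' i \<in> carrier B" if "i < n" for i
    using that a' b' A.homogeneous_closed B.homogeneous_closed by blast+
  have T: "tensor A B (a' i) (b' i) \<in> carrier F" if "i < n" for i
    using that a' b' tensor_in_F by blast
  let ?G = "\<lambda>i j. A.gns_form \<phi> (a' i) (a' j)" and ?H = "\<lambda>i j. B.gns_form \<psi> (b' i) (b' j)"
  let ?G' = "\<lambda>i j. A.gns_form \<phi> (a \<otimes>\<^bsub>A\<^esub> a' i) (a \<otimes>\<^bsub>A\<^esub> a' j)"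
    and ?H' = "\<lambda>i j. B.gns_form \<psi> (b \<otimes>\<^bsub>B\<^esub> b' i) (b \<otimes>\<^bsub>B\<^esub> b' j)"
  have "F.gns_form ?\<omega> x x = (\<Sum>i<n. \<Sum>j<n. cnj 1 * 1 * F.gns_form ?\<omega> (tensor A B (a' i) (b' i)) (tensor A B (a' j) (b' j)))"
    by (rule F.sesquilinear_expand[OF F.gns_form_sesquilinear[OF lin] _ x]) (use T sum in auto)
  also have "\<dots> = (\<Sum>i<n. \<Sum>j<n. ?G i j * ?H i j)"
    by (intro sum.cong refl) (simp add: product_form_tensors[OF a' a' b' b'])
  finally have xx: "F.gns_form ?\<omega> x x = (\<Sum>i<n. \<Sum>j<n. ?G i j * ?H i j)" .
  have entry: "F.gns_form ?\<omega> (?u \<otimes>\<^bsub>F\<^esub> tensor A B (a' i) (b' i)) (?u \<otimes>\<^bsub>F\<^esub> tensor A B (a' j) (b' j)) = ?G' i j * ?H' i j"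
    if ij: "i < n" "j < n" for i j
  proof -
    have cT: "tensor A B (a \<otimes>\<^bsub>A\<^esub> a' i) (b \<otimes>\<^bsub>B\<^esub> b' i) \<in> carrier F" if "i < n" for i
      using that by (intro tensor_closed A.mult_closed B.mult_closed ca cb ca' cb')
    have mult: "?u \<otimes>\<^bsub>F\<^esub> tensor A B (a' i) (b' i) = koszul t (s' i) \<odot>\<^bsub>F\<^esub> tensor A B (a \<otimes>\<^bsub>A\<^esub> a' i) (b \<otimes>\<^bsub>B\<^esub> b' i)" if "i < n" for i
      using that by (intro fermi_mult_homogeneous[OF ca b a' cb'])
    have "F.gns_form ?\<omega> (?u \<otimes>\<^bsub>F\<^esub> tensor A B (a' i) (b' i)) (?u \<otimes>\<^bsub>F\<^esub> tensor A B (a' j) (b' j))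
        = cnj (koszul t (s' i)) * koszul t (s' j) * (?G' i j * ?H' i j)"
      using ij by (simp add: mult cT fermi_scale_closed F.form_scale_left[OF form] F.form_scale_right[OF form]
          product_form_tensors[OF A.homogeneous_mult[OF a a'] A.homogeneous_mult[OF a a']
            B.homogeneous_mult[OF b b'] B.homogeneous_mult[OF b b']])
    moreover have "cnj (koszul t (s' i)) * koszul t (s' j) = 1 \<or> ?G' i j = 0"
      using even_state_orthogonal[OF A.homogeneous_mult[OF a a'] A.homogeneous_mult[OF a a'], of i j] ij
      by (cases "s' i = s' j") (auto simp: koszul_def)
    ultimately show ?thesis by auto
  qed
  have "F.gns_form ?\<omega> (?u \<otimes>\<^bsub>F\<^esub> x) (?u \<otimes>\<^bsub>F\<^esub> x) = (\<Sum>i<n. \<Sum>j<n. cnj 1 * 1 *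
      F.gns_form ?\<omega> (?u \<otimes>\<^bsub>F\<^esub> tensor A B (a' i) (b' i)) (?u \<otimes>\<^bsub>F\<^esub> tensor A B (a' j) (b' j)))"
    by (rule F.sesquilinear_expand[OF F.sesquilinear_pullback[OF F.gns_form_sesquilinear[OF lin] u] _ x])
      (use T sum in auto)
  also have "\<dots> = (\<Sum>i<n. \<Sum>j<n. ?G' i j * ?H' i j)"
    by (intro sum.cong refl) (simp add: entry)
  finally have ux: "F.gns_form ?\<omega> (?u \<otimes>\<^bsub>F\<^esub> x) (?u \<otimes>\<^bsub>F\<^esub> x) = (\<Sum>i<n. \<Sum>j<n. ?G' i j * ?H' i j)" .
  let ?K = "of_real ((anorm A a)\<^sup>2) :: complex" and ?L = "of_real ((anorm B b)\<^sup>2) :: complex"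
  have "(\<Sum>i<n. \<Sum>j<n. (?K * ?G i j - ?G' i j) * ?H i j) \<in> \<real>\<^sub>\<ge>\<^sub>0"
    by (rule tensor_forms_nonneg[OF A.star_algebra_axioms A.state_defect_form[OF states(1) ca] _
          B.star_algebra_axioms B.gns_form_positive[OF B.state_positive[OF states(2)]]])
      (auto simp: ca' cb')
  moreover have "(\<Sum>i<n. \<Sum>j<n. ?G' i j * (?L * ?H i j - ?H' i j)) \<in> \<real>\<^sub>\<ge>\<^sub>0"
    by (rule tensor_forms_nonneg[OF A.star_algebra_axioms A.state_pullback_form[OF states(1) ca] _
          B.star_algebra_axioms B.state_defect_form[OF states(2) cb]])
      (auto simp: ca' cb')
  moreover have "?L \<in> \<real>\<^sub>\<ge>\<^sub>0" by (simp only: nonneg_Reals_of_real_iff zero_le_power2)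
  ultimately have "?L * (\<Sum>i<n. \<Sum>j<n. (?K * ?G i j - ?G' i j) * ?H i j)
      + (\<Sum>i<n. \<Sum>j<n. ?G' i j * (?L * ?H i j - ?H' i j)) \<in> \<real>\<^sub>\<ge>\<^sub>0"
    by (intro nonneg_Reals_add_I nonneg_Reals_mult_I)
  also have "?L * (\<Sum>i<n. \<Sum>j<n. (?K * ?G i j - ?G' i j) * ?H i j)
      + (\<Sum>i<n. \<Sum>j<n. ?G' i j * (?L * ?H i j - ?H' i j))
      = ?K * ?L * F.gns_form ?\<omega> x x - F.gns_form ?\<omega> (?u \<otimes>\<^bsub>F\<^esub> x) (?u \<otimes>\<^bsub>F\<^esub> x)"
    unfolding xx ux sum_distrib_left sum.distrib[symmetric] sum_subtractf[symmetric]
    by (intro sum.cong refl) (simp add: algebra_simps)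
  finally have "Re (F.gns_form ?\<omega> (?u \<otimes>\<^bsub>F\<^esub> x) (?u \<otimes>\<^bsub>F\<^esub> x)) \<le> (anorm A a)\<^sup>2 * (anorm B b)\<^sup>2 * Re (F.gns_form ?\<omega> x x)"
    by (simp add: complex_nonneg_Reals_iff flip: of_real_power of_real_mult)
  then have "(gns_seminorm F ?\<omega> (?u \<otimes>\<^bsub>F\<^esub> x))\<^sup>2 \<le> (anorm A a * anorm B b * gns_seminorm F ?\<omega> x)\<^sup>2"
    using u x by (simp add: F.gns_seminorm_eq power_mult_distrib F.form_norm_square[OF form] F.closed)
  then show ?thesis
    by (rule power2_le_imp_le)
      (simp add: ca cb x A.norm_nonneg B.norm_nonneg seminorm_on.p_nonneg[OF F.gns_seminorm_on[OF product_functional_positive]])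
qed

lemma product_functional_even:
  assumes "x \<in> carrier F"
  shows "product_functional \<phi> \<psi> (fermi_grading A \<alpha> B \<beta> x) = product_functional \<phi> \<psi> x"
  using assms
proof (induction x rule: fermi_induct)
  case (tensor s t a b)
  then have "a \<in> carrier A" "b \<in> carrier B" using A.homogeneous_closed B.homogeneous_closed by blast+
  then show ?case
    using \<phi> \<psi> by (simp add: fermi_grading_tensor product_functional_tensor[OF states] A.grading_closed
        B.grading_closed even_states_def)
next
  case (add x y)
  then show ?case
    using product_functional_linear[OF states] by (simp add: fermi_grading_add fermi_grading_closed linear_on_def)
qed

end

definition product_functionals where
  "product_functionals = {product_functional \<phi> \<psi> |\<phi> \<psi>. \<phi> \<in> even_states A \<alpha> \<and> \<psi> \<in> even_states B \<beta>}"

lemma fermi_norm_eq: "fermi_norm A \<alpha> B \<beta> = gns_sup_norm F product_functionals"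
proof
  fix x
  have "{gns_opnorm F (product_functional \<phi> \<psi>) x |\<phi> \<psi>. \<phi> \<in> even_states A \<alpha> \<and> \<psi> \<in> even_states B \<beta>}
      = (\<lambda>\<omega>. gns_opnorm F \<omega> x) ` product_functionals"
    by (auto simp: product_functionals_def)
  then show "fermi_norm A \<alpha> B \<beta> x = gns_sup_norm F product_functionals x"
    by (simp only: fermi_norm_def gns_sup_norm_def)
qed

sublocale F: bounded_functionals F product_functionals
proof
  fix x assume "x \<in> carrier F"
  then show "\<exists>K\<ge>0. \<forall>\<omega>\<in>product_functionals. \<forall>y\<in>carrier F. gns_seminorm F \<omega> (x \<otimes>\<^bsub>F\<^esub> y) \<le> K * gns_seminorm F \<omega> y"
  proof (induction x rule: fermi_induct)
    case (tensor s t a b)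
    then have "0 \<le> anorm A a * anorm B b"
      by (simp add: A.norm_nonneg B.norm_nonneg A.homogeneous_closed B.homogeneous_closed)
    then show ?case
      using product_left_bounded[OF _ _ tensor] by (auto simp: product_functionals_def)
  next
    case (add x x')
    then obtain K K' where K: "0 \<le> K" "\<And>\<omega> y. \<lbrakk>\<omega> \<in> product_functionals; y \<in> carrier F\<rbrakk> \<Longrightarrow>
        gns_seminorm F \<omega> (x \<otimes>\<^bsub>F\<^esub> y) \<le> K * gns_seminorm F \<omega> y"
      and K': "0 \<le> K'" "\<And>\<omega> y. \<lbrakk>\<omega> \<in> product_functionals; y \<in> carrier F\<rbrakk> \<Longrightarrow>
        gns_seminorm F \<omega> (x' \<otimes>\<^bsub>F\<^esub> y) \<le> K' * gns_seminorm F \<omega> y" by blast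
    have "gns_seminorm F \<omega> ((x \<oplus>\<^bsub>F\<^esub> x') \<otimes>\<^bsub>F\<^esub> y) \<le> (K + K') * gns_seminorm F \<omega> y"
      if \<omega>: "\<omega> \<in> product_functionals" and y: "y \<in> carrier F" for \<omega> y
    proof -
      have "seminorm_on F (gns_seminorm F \<omega>)"
        using \<omega> F.gns_seminorm_on product_functional_positive by (auto simp: product_functionals_def)
      from seminorm_on.p_triangle[OF this, of "x \<otimes>\<^bsub>F\<^esub> y" "x' \<otimes>\<^bsub>F\<^esub> y"]
      show ?thesis
        using K(2)[OF \<omega> y] K'(2)[OF \<omega> y] add.hyps y by (simp add: F.mult_add_left F.mult_closed distrib_right)
    qed
    then show ?case using K(1) K'(1) by (intro exI[of _ "K + K'"]) simp
  qed
qed (auto simp: product_functionals_def product_functional_positive)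

sublocale N: cstar_seminorm F "fermi_norm A \<alpha> B \<beta>"
  unfolding fermi_norm_eq by (rule F.sup_norm_cstar_seminorm)

lemma fermi_norm_grading:
  "x \<in> carrier F \<Longrightarrow> fermi_norm A \<alpha> B \<beta> (fermi_grading A \<alpha> B \<beta> x) = fermi_norm A \<alpha> B \<beta> x"
  unfolding fermi_norm_eq
  by (rule F.sup_norm_automorphism[OF fermi_grading_automorphism])
    (auto simp: product_functionals_def product_functional_even fermi_grading_involutive)

end

section \<open>The grading of the Fermi $C^*$-tensor product\<close>

theorem proposition4p1:
  fixes A :: "'a normed_star_algebra" and \<alpha> :: "'a \<Rightarrow> 'a"
    and B :: "'b normed_star_algebra" and \<beta> :: "'b \<Rightarrow> 'b"
  assumes "graded_cstar_algebra A \<alpha>" and "graded_cstar_algebra B \<beta>"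
  shows "\<exists>\<theta>. star_automorphism (fermi_cstar_tensor A \<alpha> B \<beta>) \<theta> \<and>
           (\<forall>\<xi>\<in>carrier (fermi_cstar_tensor A \<alpha> B \<beta>). \<theta> (\<theta> \<xi>) = \<xi>) \<and>
           (\<forall>x\<in>carrier (fermi_algebra A \<alpha> B \<beta>).
              \<theta> (fermi_embed A \<alpha> B \<beta> x) = fermi_embed A \<alpha> B \<beta> (fermi_grading A \<alpha> B \<beta> x)) \<and>
           (\<forall>\<theta>'. star_automorphism (fermi_cstar_tensor A \<alpha> B \<beta>) \<theta>' \<and>
              (\<forall>x\<in>carrier (fermi_algebra A \<alpha> B \<beta>).
                 \<theta>' (fermi_embed A \<alpha> B \<beta> x) = fermi_embed A \<alpha> B \<beta> (fermi_grading A \<alpha> B \<beta> x)) \<longrightarrow>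
              (\<forall>\<xi>\<in>carrier (fermi_cstar_tensor A \<alpha> B \<beta>). \<theta>' \<xi> = \<theta> \<xi>)) \<and>
           graded_cstar_algebra (fermi_cstar_tensor A \<alpha> B \<beta>) \<theta>"
proof -
  interpret fermi_pair A \<alpha> B \<beta> using assms by (rule fermi_pair.intro)
  let ?C = "fermi_cstar_tensor A \<alpha> B \<beta>" and ?\<theta>\<^sub>o = "fermi_grading A \<alpha> B \<beta>"
  let ?\<theta> = "N.completion_map ?\<theta>\<^sub>o"
  have ext: "star_automorphism ?C ?\<theta>" "\<And>\<xi>. \<xi> \<in> carrier ?C \<Longrightarrow> ?\<theta> (?\<theta> \<xi>) = \<xi>"
    "\<And>x. x \<in> carrier F \<Longrightarrow> ?\<theta> (fermi_embed A \<alpha> B \<beta> x) = fermi_embed A \<alpha> B \<beta> (?\<theta>\<^sub>o x)"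
    unfolding fermi_cstar_tensor_def fermi_embed_def
    by (rule N.completion_map_automorphism[OF fermi_grading_automorphism];
        simp add: fermi_norm_grading fermi_grading_involutive)+
  interpret C: cstar_algebra ?C
    unfolding fermi_cstar_tensor_def by (rule N.completion_cstar_algebra)
  \<comment> \<open>Two \<open>*\<close>-automorphisms are continuous and agree on the dense image of the algebraic tensor product.\<close>
  have unique: "\<theta>' \<xi> = ?\<theta> \<xi>"
    if aut: "star_automorphism ?C \<theta>'"
      and agree: "\<And>x. x \<in> carrier F \<Longrightarrow> \<theta>' (fermi_embed A \<alpha> B \<beta> x) = fermi_embed A \<alpha> B \<beta> (?\<theta>\<^sub>o x)"
      and \<xi>: "\<xi> \<in> carrier ?C" for \<theta>' \<xi>
  proof -
    obtain X where X: "seminorm_Cauchy F (fermi_norm A \<alpha> B \<beta>) X" "\<xi> = N.Cls X"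
      using \<xi> by (auto simp: fermi_cstar_tensor_def N.completion_simps elim: N.completion_carrierE)
    have "fermi_embed A \<alpha> B \<beta> (X n) \<in> carrier ?C" for n
      using N.Cauchy_closed[OF X(1)]
      by (simp add: fermi_cstar_tensor_def fermi_embed_def completion_embed_def N.completion_simps
          N.Cls_in_carrier N.Cauchy_const)
    moreover have "(\<lambda>n. anorm ?C (\<xi> \<ominus>\<^bsub>?C\<^esub> fermi_embed A \<alpha> B \<beta> (X n))) \<longlonglongrightarrow> 0"
      using N.embed_dense[OF X(1)]
      by (simp add: fermi_cstar_tensor_def fermi_embed_def completion_embed_def N.completion_simps X(2))
    moreover have "\<theta>' (fermi_embed A \<alpha> B \<beta> (X n)) = ?\<theta> (fermi_embed A \<alpha> B \<beta> (X n))" for n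
      using N.Cauchy_closed[OF X(1)] by (simp add: agree ext(3))
    ultimately show ?thesis
      by (intro C.star_automorphisms_agree_limit[OF aut ext(1) _ \<xi>])
  qed
  have "graded_cstar_algebra ?C ?\<theta>"
    using ext by unfold_locales
  show ?thesis
  proof (intro exI[of _ ?\<theta>] conjI ballI allI impI)
    show "star_automorphism ?C ?\<theta>" by (rule ext(1))
    show "graded_cstar_algebra ?C ?\<theta>" by fact
    show "?\<theta> (?\<theta> \<xi>) = \<xi>" if "\<xi> \<in> carrier ?C" for \<xi> using that by (rule ext(2))
    show "?\<theta> (fermi_embed A \<alpha> B \<beta> x) = fermi_embed A \<alpha> B \<beta> (?\<theta>\<^sub>o x)" if "x \<in> carrier F" for x
      using that by (rule ext(3))
    show "\<theta>' \<xi> = ?\<theta> \<xi>"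
      if "star_automorphism ?C \<theta>' \<and> (\<forall>x\<in>carrier F. \<theta>' (fermi_embed A \<alpha> B \<beta> x) = fermi_embed A \<alpha> B \<beta> (?\<theta>\<^sub>o x))"
        and "\<xi> \<in> carrier ?C" for \<theta>' \<xi>
      using that by (intro unique) simp_all
  qed
qed

end
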